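(* Let $n\ge2$, let $k$ be a field, and for $1\le d\le n$ let $I_d\subseteq k[x_1,\dots,x_n]$ be the ideal generated by all square-free monomials of degree $d$. There is a one-to-one correspondence between the spanning trees of the complete graph $K_n$ and the maximal polarizations of $I_{n-1}$ (up to renaming, for each $i$, the copies of the variable $x_i$), given by $T\mapsto P_T$; and likewise a one-to-one correspondence between the spanning trees of $K_n$ and the maximal polarizations of $I_2$ (up to the same renaming), given by $T\mapsto D(P_T)$.
   Context: Polarization: Let $J$ be a monomial ideal in $S=k[x_1,\dots,x_n]$. A polarization of $J$ is a square-free monomial ideal $\widetilde J$ in $\widetilde S=k[x_i^{(j)}]$ (finitely many copies $x_i^{(j)}$ of each variable $x_i$, all of them actually used) such that the differences $x_i^{(j_0)}-x_i^{(j)}$ between a fixed copy and each other copy of $x_i$, for all $i$, form a regular $\widetilde S/\widetilde J$-sequence and substituting $x_i^{(j)}\mapsto x_i$ carries $\widetilde J$ to $J$. An ideal is maximal polarized if it has no non-trivial polarization (i.e. none other than a renaming of variables); a maximal polarization of $J$ is a polarization of $J$ that is maximal polarized. Alexander dual: if a square-free monomial ideal in a polynomial ring is generated by square-free monomials with supports $\sigma_1,\dots,\sigma_r$, its Alexander dual $D(\cdot)$ is the ideal of the same ring generated by all square-free monomials whose support $\tau$ satisfies $\tau\cap\sigma_j\neq\emptyset$ for all $j$. One has $D(I_{n-1})=I_2$. The ideal $P_T$: let $T$ be a spanning tree of $K_n$ (vertex set $\{1,\dots,n\}$) with edges labeled $e_1,\dots,e_{n-1}$. Removing the edge $e_i=(v_i,w_i)$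 disconnects $T$ into two components; label every vertex in the component containing $v_i$ by $w_i^{(i)}$ and every vertex in the component containing $w_i$ by $v_i^{(i)}$. For each vertex $v$ put $m_v=\prod x_j^{(i)}$, the product over all labels $j^{(i)}$ of $v$. Then $P_T=(m_1,\dots,m_n)$, in the polynomial ring on the variables $x_j^{(i)}$ with $j$ an endpoint of $e_i$. *)

theory Defs
  imports "HOL-Library.Poly_Mapping" "HOL-Algebra.QuotRing"
begin

section \<open>Polynomial rings on a set of variables\<close>

text \<open>Exponent vectors are finitely supported maps from variables to naturals; polynomials are
  finitely supported maps from exponent vectors to the field.\<close>

type_synonym ('v, 'k) mpoly = "('v \<Rightarrow>\<^sub>0 nat) \<Rightarrow>\<^sub>0 'k"

definition poly_ring :: "'v set \<Rightarrow> ('v, 'k::field) mpoly ring" where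
  "poly_ring V = \<lparr>carrier = {p. \<forall>m\<in>Poly_Mapping.keys p. Poly_Mapping.keys m \<subseteq> V},
     monoid.mult = (*), one = 1, zero = 0, add = (+)\<rparr>"

lemma cring_poly_ring: "cring (poly_ring V :: ('v, 'k::field) mpoly ring)" (is "cring ?R")
proof -
  have add: "p + q \<in> carrier ?R" if "p \<in> carrier ?R" "q \<in> carrier ?R" for p q
    using that keys_add[of p q] unfolding poly_ring_def by auto
  have mult: "p * q \<in> carrier ?R" if p: "p \<in> carrier ?R" and q: "q \<in> carrier ?R" for p q
  proof -
    have "Poly_Mapping.keys m \<subseteq> V" if m: "m \<in> Poly_Mapping.keys (p * q)" for m
    proof -
      obtain a b where "m = a + b" "a \<in> Poly_Mapping.keys p" "b \<in> Poly_Mapping.keys q"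
        using m keys_mult[of p q] by blast
      with p q show ?thesis
        using keys_add[of a b] unfolding poly_ring_def by fastforce
    qed
    then show ?thesis unfolding poly_ring_def by auto
  qed
  have uminus: "- p \<in> carrier ?R" if "p \<in> carrier ?R" for p
    using that by (auto simp: poly_ring_def in_keys_iff)
  have zero: "0 \<in> carrier ?R" and one: "1 \<in> carrier ?R"
    by (auto simp: poly_ring_def)
  have ops: "add ?R = (+)" "monoid.mult ?R = (*)" "ring.zero ?R = 0" "monoid.one ?R = 1"
    by (simp_all add: poly_ring_def)
  show ?thesis
  proof (rule cringI)
    show "abelian_group ?R"
    proof (rule abelian_groupI, unfold ops)
      show "\<exists>q\<in>carrier ?R. q + p = 0" if "p \<in> carrier ?R" for p
        using uminus[OF that] by (intro bexI[of _ "- p"]) simp_all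
    qed (simp_all add: add zero add.assoc add.commute)
    show "comm_monoid ?R"
      by (rule comm_monoidI, unfold ops) (simp_all add: mult one mult.assoc mult.commute)
  qed (simp add: ops distrib_right)
qed

definition monomial :: "('v \<Rightarrow>\<^sub>0 nat) \<Rightarrow> ('v, 'k::field) mpoly" where
  "monomial m = Poly_Mapping.single m 1"

definition var :: "'v \<Rightarrow> ('v, 'k::field) mpoly" where
  "var v = monomial (Poly_Mapping.single v 1)"

definition sqfree_monomial :: "'v set \<Rightarrow> ('v, 'k::field) mpoly" where
  "sqfree_monomial \<sigma> = (\<Prod>v\<in>\<sigma>. var v)"

text \<open>The additive map with \<open>single k c \<mapsto> single (g k) c\<close>. Applied to exponent vectors and then
  to polynomials it is the algebra homomorphism sending the variable \<open>v\<close> to the variable \<open>g v\<close>,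
  where \<open>g\<close> need not be injective.\<close>

definition push_keys :: "('a \<Rightarrow> 'b) \<Rightarrow> ('a \<Rightarrow>\<^sub>0 'c::comm_monoid_add) \<Rightarrow> ('b \<Rightarrow>\<^sub>0 'c)" where
  "push_keys g p = (\<Sum>k\<in>Poly_Mapping.keys p. Poly_Mapping.single (g k) (Poly_Mapping.lookup p k))"

definition subst_vars :: "('v \<Rightarrow> 'w) \<Rightarrow> ('v, 'k::field) mpoly \<Rightarrow> ('w, 'k) mpoly" where
  "subst_vars g = push_keys (push_keys g)"


section \<open>Square-free monomial ideals and Alexander duality\<close>

definition sqfree_monomial_ideal :: "'v set \<Rightarrow> ('v, 'k::field) mpoly set \<Rightarrow> bool" where
  "sqfree_monomial_ideal V I \<longleftrightarrow>
     (\<exists>\<Sigma> \<subseteq> Fpow V. I = Idl\<^bsub>poly_ring V\<^esub> (sqfree_monomial ` \<Sigma>))"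

text \<open>Exponent vectors of the minimal monomial generators of a monomial ideal.\<close>

definition min_gens :: "('v, 'k::field) mpoly set \<Rightarrow> ('v \<Rightarrow>\<^sub>0 nat) set" where
  "min_gens I = {m. monomial m \<in> I \<and>
     (\<forall>m'. monomial m' \<in> I \<and> (\<forall>v. Poly_Mapping.lookup m' v \<le> Poly_Mapping.lookup m v) \<longrightarrow> m' = m)}"

definition used_vars :: "('v, 'k::field) mpoly set \<Rightarrow> 'v set" where
  "used_vars I = (\<Union>m\<in>min_gens I. Poly_Mapping.keys m)"

text \<open>Meant for square-free monomial ideals, taking the minimal generators as the generating
  square-free monomials; any other choice of square-free generators gives the same ideal.\<close>

definition alexander_dual :: "'v set \<Rightarrow> ('v, 'k::field) mpoly set \<Rightarrow> ('v, 'k) mpoly set" where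
  "alexander_dual V I = Idl\<^bsub>poly_ring V\<^esub>
     (sqfree_monomial ` {\<tau> \<in> Fpow V. \<forall>m\<in>min_gens I. \<tau> \<inter> Poly_Mapping.keys m \<noteq> {}})"


section \<open>Polarizations\<close>

text \<open>\<open>fs\<close> is a regular sequence on the \<open>R\<close>-module \<open>R/J\<close>: each entry is a non-zero-divisor modulo
  \<open>J\<close> and the preceding entries, and the final quotient is non-zero.\<close>

definition regular_on_quotient :: "('a, 'm) ring_scheme \<Rightarrow> 'a set \<Rightarrow> 'a list \<Rightarrow> bool" where
  "regular_on_quotient R J fs \<longleftrightarrow>
     set fs \<subseteq> carrier R \<and>
     (\<forall>i<length fs. \<forall>a\<in>carrier R.
        fs ! i \<otimes>\<^bsub>R\<^esub> a \<in> Idl\<^bsub>R\<^esub> (J \<union> set (take i fs)) \<longrightarrow> a \<in> Idl\<^bsub>R\<^esub> (J \<union> set (take i fs))) \<and>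
     Idl\<^bsub>R\<^esub> (J \<union> set fs) \<noteq> carrier R"

text \<open>\<open>polarization X J Y I\<close>: the ideal \<open>I\<close> of \<open>k[Y]\<close> is a polarization of the ideal \<open>J\<close> of \<open>k[X]\<close>.
  The pair \<open>(x, j)\<close> is the copy \<open>x\<^sup>(\<^sup>j\<^sup>)\<close> of \<open>x\<close>, and \<open>c x\<close> is the index of the fixed copy. The
  differences are homogeneous, so neither the choice of \<open>c\<close> nor the order of the sequence matters.\<close>

definition polarization ::
  "'v set \<Rightarrow> ('v, 'k::field) mpoly set \<Rightarrow> ('v \<times> nat) set \<Rightarrow> ('v \<times> nat, 'k) mpoly set \<Rightarrow> bool" where
  "polarization X J Y I \<longleftrightarrow>
     finite Y \<and> fst ` Y \<subseteq> X \<and>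
     sqfree_monomial_ideal Y I \<and>
     used_vars I = Y \<and>
     (\<exists>c. (\<forall>x\<in>fst ` Y. (x, c x) \<in> Y) \<and>
        (\<exists>ys. distinct ys \<and> set ys = {(x, j). (x, j) \<in> Y \<and> j \<noteq> c x} \<and>
           regular_on_quotient (poly_ring Y) I (map (\<lambda>(x, j). var (x, c x) - var (x, j)) ys))) \<and>
     Idl\<^bsub>poly_ring X\<^esub> (subst_vars fst ` I) = J"

text \<open>A polarization is trivial when no variable has two copies: the substitution is then itself
  a renaming of variables.\<close>

definition maximal_polarized :: "'v set \<Rightarrow> ('v, 'k::field) mpoly set \<Rightarrow> bool" where
  "maximal_polarized X J \<longleftrightarrow> (\<forall>Y I. polarization X J Y I \<longrightarrow> inj_on fst Y)"

definition maximal_polarizations ::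
  "'v set \<Rightarrow> ('v, 'k::field) mpoly set \<Rightarrow> (('v \<times> nat) set \<times> ('v \<times> nat, 'k) mpoly set) set" where
  "maximal_polarizations X J = {(Y, I). polarization X J Y I \<and> maximal_polarized Y I}"

text \<open>Ideals (with their ambient sets of variables) agreeing up to renaming, for each \<open>x\<close>, the
  copies of \<open>x\<close>.\<close>

definition copy_renaming ::
  "((('v \<times> nat) set \<times> ('v \<times> nat, 'k::field) mpoly set) \<times>
    (('v \<times> nat) set \<times> ('v \<times> nat, 'k) mpoly set)) set" where
  "copy_renaming = {((Y, I), (Y', I')).
     \<exists>r. bij_betw r Y Y' \<and> (\<forall>y\<in>Y. fst (r y) = fst y) \<and> I' = subst_vars r ` I}"


section \<open>Spanning trees of complete graphs\<close>

definition complete_edges :: "nat \<Rightarrow> nat set set" where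
  "complete_edges n = {{u, v} | u v. u \<in> {1..n} \<and> v \<in> {1..n} \<and> u \<noteq> v}"

definition reachable_by :: "'a set set \<Rightarrow> ('a \<times> 'a) set" where
  "reachable_by E = {(u, v). {u, v} \<in> E}\<^sup>*"

definition is_cycle :: "'a set set \<Rightarrow> 'a list \<Rightarrow> bool" where
  "is_cycle E vs \<longleftrightarrow> length vs \<ge> 3 \<and> distinct vs \<and>
     (\<forall>i<length vs. {vs ! i, vs ! (Suc i mod length vs)} \<in> E)"

definition spanning_trees :: "nat \<Rightarrow> nat set set set" where
  "spanning_trees n = {T. T \<subseteq> complete_edges n \<and>
     (\<forall>u\<in>{1..n}. \<forall>v\<in>{1..n}. (u, v) \<in> reachable_by T) \<and> (\<nexists>vs. is_cycle T vs)}"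


section \<open>The ideals\<close>

definition sqfree_degree_ideal :: "nat \<Rightarrow> nat \<Rightarrow> (nat, 'k::field) mpoly set" where
  "sqfree_degree_ideal n d = Idl\<^bsub>poly_ring {1..n}\<^esub> (sqfree_monomial ` {\<sigma>. \<sigma> \<subseteq> {1..n} \<and> card \<sigma> = d})"

text \<open>For a tree with edges \<open>e 1, \<dots>, e (n - 1)\<close>: the vertex \<open>v\<close> gets, for each \<open>i\<close>, the label
  \<open>(w, i)\<close> where \<open>w\<close> is the endpoint of \<open>e i\<close> outside the component of \<open>v\<close> after removal of \<open>e i\<close>.\<close>

definition tree_labels :: "nat \<Rightarrow> (nat \<Rightarrow> nat set) \<Rightarrow> nat \<Rightarrow> (nat \<times> nat) set" where
  "tree_labels n e v = {(w, i). i \<in> {1..n-1} \<and> w \<in> e i \<and>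
     (v, w) \<notin> reachable_by (e ` {1..n-1} - {e i})}"

definition tree_vars :: "nat \<Rightarrow> (nat \<Rightarrow> nat set) \<Rightarrow> (nat \<times> nat) set" where
  "tree_vars n e = {(w, i). i \<in> {1..n-1} \<and> w \<in> e i}"

definition tree_ideal :: "nat \<Rightarrow> (nat \<Rightarrow> nat set) \<Rightarrow> (nat \<times> nat, 'k::field) mpoly set" where
  "tree_ideal n e = Idl\<^bsub>poly_ring (tree_vars n e)\<^esub> ((\<lambda>v. sqfree_monomial (tree_labels n e v)) ` {1..n})"

end

theory Submission
  imports Defs
begin

text \<open>For a square-free target the condition that differences of copies form a regular sequence is
  combinatorial: the generators of the polarization biject with those of the target, and whenever
  two generators \<open>\<sigma>\<close>, \<open>\<tau>\<close> contain different copies \<open>x\<close>, \<open>y\<close> of one variable, some generator lies in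
  \<open>\<sigma> \<union> \<tau> - {x, y}\<close>. Identifying one pair of variables at a time, \<open>x - y\<close> is a non-zero-divisor modulo
  a monomial ideal iff \<open>x w\<close>, \<open>y w\<close> in the ideal imply \<open>w\<close> in the ideal, and this property descends
  from the identified ideal to the original one.

  A polarization of \<open>I\<^sub>n\<^sub>-\<^sub>1\<close> or of \<open>I\<^sub>2\<close> is then the same thing as a family of partitions of the
  vertices other than \<open>j\<close>, one for each \<open>j\<close>, such that \<open>j\<close> and \<open>v\<close> lie in the same class at \<open>u\<close>
  whenever \<open>u\<close> and \<open>v\<close> lie in different classes at \<open>j\<close>. The pairs that no third vertex separates
  form a connected graph, and the branches at \<open>j\<close> of any of its spanning trees refine the classes at
  \<open>j\<close>. So every polarization is a specialization of one coming from a tree, and those coming from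
  trees admit no further separation. In a tree the pairs that no third vertex separates are the
  edges, so the partitions determine the tree.\<close>

text \<open>After the first difference of a regular sequence the quotients are no longer by monomial
  ideals. Each is traded for the monomial ideal obtained by carrying out the identifications made so
  far, so that all algebra happens on sets of exponents and one statement about a single difference
  suffices.

  Maximality speaks of polarizations of a polarization, so the construction must iterate: the
  notions below see only supports of generators and accept variables of any type, copies of copies
  included.

  The condition on partitions says: if \<open>j\<close> lies between \<open>u\<close> and
  \<open>v\<close>, then \<open>j\<close> and \<open>v\<close> lie in the same direction from
  \<open>u\<close>. It is the exchange condition for both families of generators, so both ideals
  share one argument. Refining a system by a tree of unseparated pairs is a further lift; if the
  polarization is maximal, this lift is trivial, so the classes already are the branches. A tree
  admits no further lift because the neighbour of \<open>j\<close> at the root of a branch sees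
  \<open>j\<close> in another direction than the rest of that branch.\<close>

abbreviation lookup :: "('a \<Rightarrow>\<^sub>0 'b::zero) \<Rightarrow> 'a \<Rightarrow> 'b" where
  "lookup \<equiv> Poly_Mapping.lookup"

abbreviation sgl :: "'a \<Rightarrow> 'b \<Rightarrow> ('a \<Rightarrow>\<^sub>0 'b::zero)" where
  "sgl \<equiv> Poly_Mapping.single"

abbreviation supp :: "('a \<Rightarrow>\<^sub>0 'b::zero) \<Rightarrow> 'a set" where
  "supp \<equiv> Poly_Mapping.keys"

definition unit_exp :: "'v \<Rightarrow> ('v \<Rightarrow>\<^sub>0 nat)" where
  "unit_exp v = sgl v 1"

lemma supp_unit_exp [simp]: "supp (unit_exp v) = {v}"
  by (simp add: unit_exp_def)

lemma lookup_unit_exp: "lookup (unit_exp v) w = (if w = v then 1 else 0)"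
  by (simp add: unit_exp_def lookup_single when_def)

lemma var_eq: "var v = monomial (unit_exp v)"
  by (simp add: var_def unit_exp_def)

section \<open>Pushing keys forward\<close>

lemma poly_mapping_eq_sum_single:
  fixes p :: "'a \<Rightarrow>\<^sub>0 'b::comm_monoid_add"
  assumes "finite A" "supp p \<subseteq> A"
  shows "p = (\<Sum>k\<in>A. sgl k (lookup p k))"
proof (rule poly_mapping_eqI)
  fix k
  have "lookup (\<Sum>k\<in>A. sgl k (lookup p k)) k
      = (\<Sum>j\<in>A. if j = k then lookup p k else 0)"
    by (auto simp: lookup_sum lookup_single when_def intro!: sum.cong)
  also have "\<dots> = lookup p k"
    using assms by (auto simp: sum.delta in_keys_iff)
  finally show "lookup p k = lookup (\<Sum>k\<in>A. sgl k (lookup p k)) k" ..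
qed

lemma push_keys_superset:
  assumes "finite A" "supp p \<subseteq> A"
  shows "push_keys g p = (\<Sum>k\<in>A. sgl (g k) (lookup p k))"
  unfolding push_keys_def using assms
  by (intro sum.mono_neutral_left) (auto simp: in_keys_iff)

lemma push_keys_single [simp]: "push_keys g (sgl k c) = sgl (g k) c"
  by (subst push_keys_superset[of "{k}"]) auto

lemma push_keys_unit_exp [simp]: "push_keys g (unit_exp v) = unit_exp (g v)"
  by (simp add: unit_exp_def)

lemma push_keys_zero [simp]: "push_keys g 0 = 0"
  by (simp add: push_keys_def)

lemma push_keys_add: "push_keys g (p + q) = push_keys g p + push_keys g q"
proof -
  have "supp (p + q) \<subseteq> supp p \<union> supp q" by (rule keys_add)
  then show ?thesis
    by (simp add: push_keys_superset[of "supp p \<union> supp q"] lookup_add single_add sum.distrib)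
qed

lemma push_keys_sum: "push_keys g (sum f A) = (\<Sum>a\<in>A. push_keys g (f a))"
  by (induction A rule: infinite_finite_induct) (auto simp: push_keys_add)

lemma push_keys_comp: "push_keys f (push_keys g p) = push_keys (f \<circ> g) p"
  by (simp add: push_keys_def[of g] push_keys_def[of "f \<circ> g"] push_keys_sum)

lemma push_keys_cong: "(\<And>k. k \<in> supp p \<Longrightarrow> f k = g k) \<Longrightarrow> push_keys f p = push_keys g p"
  by (simp add: push_keys_def)

lemma push_keys_ident: "(\<And>k. k \<in> supp p \<Longrightarrow> g k = k) \<Longrightarrow> push_keys g p = p"
  using poly_mapping_eq_sum_single[of "supp p" p] by (simp add: push_keys_def)

lemma keys_push_keys_subset: "supp (push_keys g p) \<subseteq> g ` supp p"
  unfolding push_keys_def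
  by (rule order.trans[OF Poly_Mapping.keys_sum]) (auto split: if_splits)

lemma lookup_push_keys: "lookup (push_keys g p) w = (\<Sum>k\<in>{k\<in>supp p. g k = w}. lookup p k)"
  by (auto simp: push_keys_def lookup_sum lookup_single when_def sum.If_cases Int_def intro!: sum.cong)

lemma keys_push_keys_nat: "supp (push_keys g (m :: 'v \<Rightarrow>\<^sub>0 nat)) = g ` supp m"
proof
  show "g ` supp m \<subseteq> supp (push_keys g m)"
  proof
    fix w assume "w \<in> g ` supp m"
    then obtain k where "k \<in> supp m" "g k = w" by auto
    then show "w \<in> supp (push_keys g m)"
      by (auto simp: in_keys_iff lookup_push_keys)
  qed
qed (rule keys_push_keys_subset)

lemma push_keys_minus:
  fixes p :: "'a \<Rightarrow>\<^sub>0 'b::ab_group_add"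
  shows "push_keys g (p - q) = push_keys g p - push_keys g q"
  using push_keys_add[of g "p - q" q] by simp

section \<open>Substitution of variables as an algebra homomorphism\<close>

lemma subst_vars_add: "subst_vars g (p + q) = subst_vars g p + subst_vars g q"
  by (simp add: subst_vars_def push_keys_add)

lemma subst_vars_minus: "subst_vars g (p - q) = subst_vars g p - subst_vars g q"
  by (simp add: subst_vars_def push_keys_minus)

lemma subst_vars_zero [simp]: "subst_vars g 0 = 0"
  by (simp add: subst_vars_def)

lemma subst_vars_single [simp]:
  "subst_vars g (sgl m c) = sgl (push_keys g m) c"
  by (simp add: subst_vars_def)

lemma subst_vars_monomial [simp]: "subst_vars g (monomial m) = monomial (push_keys g m)"
  by (simp add: monomial_def)

lemma subst_vars_var [simp]: "subst_vars g (var v) = var (g v)"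
  by (simp add: var_eq)

lemma subst_vars_sum: "subst_vars g (sum f A) = (\<Sum>a\<in>A. subst_vars g (f a))"
  by (simp add: subst_vars_def push_keys_sum)

lemma subst_vars_mult: "subst_vars g (p * q) = subst_vars g p * subst_vars g q"
proof -
  let ?s = "\<lambda>p k. sgl k (lookup p k)"
  let ?t = "\<lambda>p k. sgl (push_keys g k) (lookup p k)"
  have eq: "p * q = (\<Sum>i\<in>supp p. ?s p i) * (\<Sum>j\<in>supp q. ?s q j)"
    using poly_mapping_eq_sum_single[of "supp p" p] poly_mapping_eq_sum_single[of "supp q" q] by simp
  have l: "subst_vars g (p * q) = (\<Sum>i\<in>supp p. \<Sum>j\<in>supp q. ?t p i * ?t q j)"
    by (simp only: eq sum_product subst_vars_sum mult_single subst_vars_single push_keys_add)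
  have r: "subst_vars g p * subst_vars g q = (\<Sum>i\<in>supp p. \<Sum>j\<in>supp q. ?t p i * ?t q j)"
    by (simp only: sum_product subst_vars_def push_keys_def[of "push_keys g"])
  show ?thesis unfolding r by (rule l)
qed

lemma subst_vars_comp: "subst_vars f (subst_vars g p) = subst_vars (f \<circ> g) p"
proof -
  have eq: "push_keys f \<circ> push_keys g = push_keys (f \<circ> g)"
    by (auto simp: push_keys_comp)
  show ?thesis unfolding subst_vars_def push_keys_comp eq ..
qed

lemma supp_subst_vars_subset: "supp (subst_vars g p) \<subseteq> push_keys g ` supp p"
  unfolding subst_vars_def by (rule keys_push_keys_subset)

lemma exp_le_imp_add:
  fixes a m :: "'v \<Rightarrow>\<^sub>0 nat"
  assumes "\<And>v. lookup a v \<le> lookup m v"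
  obtains d where "m = a + d"
proof
  show "m = a + (m - a)"
    using assms by (intro poly_mapping_eqI) (simp add: lookup_add lookup_minus)
qed

lemma supp_add_exp: "supp (a + b :: 'v \<Rightarrow>\<^sub>0 nat) = supp a \<union> supp b"
  by (auto simp: in_keys_iff lookup_add)

section \<open>Monomial ideals\<close>

definition exponents :: "'v set \<Rightarrow> ('v \<Rightarrow>\<^sub>0 nat) set" where
  "exponents V = {m. supp m \<subseteq> V}"

definition upset :: "'v set \<Rightarrow> ('v \<Rightarrow>\<^sub>0 nat) set \<Rightarrow> bool" where
  "upset V N \<longleftrightarrow> N \<subseteq> exponents V \<and> (\<forall>m\<in>N. \<forall>k\<in>exponents V. m + k \<in> N)"

text \<open>The span of the monomials with exponent in \<open>N\<close>. Membership is read off the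
  support, so ideal arithmetic becomes set theory on exponents, with neither the field nor the
  ambient ring involved.\<close>

definition mideal :: "('v \<Rightarrow>\<^sub>0 nat) set \<Rightarrow> ('v, 'k::field) mpoly set" where
  "mideal N = {p. supp p \<subseteq> N}"

lemma carrier_poly_ring: "carrier (poly_ring V) = mideal (exponents V)"
  by (auto simp: poly_ring_def mideal_def exponents_def)

lemma poly_ring_ops [simp]:
  "add (poly_ring V) = (+)" "monoid.mult (poly_ring V) = (*)"
  "ring.zero (poly_ring V) = 0" "monoid.one (poly_ring V) = 1"
  by (simp_all add: poly_ring_def)

lemma zero_mideal [simp]: "0 \<in> mideal N"
  by (simp add: mideal_def)

lemma mideal_add: "p \<in> mideal N \<Longrightarrow> q \<in> mideal N \<Longrightarrow> p + q \<in> mideal N"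
  using keys_add[of p q] by (auto simp: mideal_def)

lemma mideal_uminus: "p \<in> mideal N \<Longrightarrow> - p \<in> mideal N"
  by (auto simp: mideal_def in_keys_iff)

lemma mideal_minus: "p \<in> mideal N \<Longrightarrow> q \<in> mideal N \<Longrightarrow> p - q \<in> mideal N"
  using mideal_add[of p N "- q"] mideal_uminus[of q N] by simp

lemma mideal_mult:
  assumes "upset V N" "p \<in> mideal N" "q \<in> mideal (exponents V)"
  shows "p * q \<in> mideal N"
proof -
  have "a + b \<in> N" if "a \<in> supp p" "b \<in> supp q" for a b
    using assms that unfolding mideal_def upset_def by blast
  then show ?thesis
    using keys_mult[of p q] unfolding mideal_def by blast
qed

lemma single_mideal: "m \<in> N \<Longrightarrow> sgl m c \<in> mideal N"
  by (auto simp: mideal_def)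

lemma monomial_mideal [simp]: "monomial m \<in> mideal N \<longleftrightarrow> m \<in> N"
  by (auto simp: mideal_def monomial_def)

lemma var_mideal: "var v \<in> mideal N \<longleftrightarrow> unit_exp v \<in> N"
  by (simp add: var_eq)

lemma mideal_inject: "mideal N = (mideal N' :: ('v, 'k::field) mpoly set) \<longleftrightarrow> N = N'"
proof
  assume eq: "mideal N = (mideal N' :: ('v, 'k::field) mpoly set)"
  have "m \<in> N \<longleftrightarrow> m \<in> N'" for m
    using monomial_mideal[where 'b = 'k, of m N] monomial_mideal[where 'b = 'k, of m N'] eq by simp
  then show "N = N'" by blast
qed simp

lemma ideal_poly_ringI:
  assumes "I \<subseteq> carrier (poly_ring V)" "0 \<in> I"
    and "\<And>p q. p \<in> I \<Longrightarrow> q \<in> I \<Longrightarrow> p + q \<in> I"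
    and "\<And>p q. p \<in> I \<Longrightarrow> q \<in> carrier (poly_ring V) \<Longrightarrow> p * q \<in> I"
  shows "ideal I (poly_ring V :: ('v, 'k::field) mpoly ring)"
proof -
  interpret cring "poly_ring V :: ('v, 'k) mpoly ring" by (rule cring_poly_ring)
  have m1: "- 1 \<in> carrier (poly_ring V :: ('v, 'k) mpoly ring)"
    by (auto simp: carrier_poly_ring mideal_def exponents_def in_keys_iff lookup_one when_def)
  show ?thesis
  proof (rule idealI)
    show "subgroup I (add_monoid (poly_ring V))"
    proof (rule group.subgroupI)
      show "group (add_monoid (poly_ring V :: ('v, 'k) mpoly ring))" by (rule a_group)
      show "I \<noteq> {}" using assms(2) by auto
      fix a assume a: "a \<in> I"
      have "a * (- 1) \<in> I" using assms(4)[OF a m1] .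
      then have m: "- a \<in> I" by simp
      have "inv\<^bsub>add_monoid (poly_ring V)\<^esub> a = - a"
      proof (rule comm_monoid.comm_inv_char)
        show "comm_monoid (add_monoid (poly_ring V :: ('v, 'k) mpoly ring))"
          using a_comm_monoid by simp
      qed (use a m assms(1) in auto)
      then show "inv\<^bsub>add_monoid (poly_ring V)\<^esub> a \<in> I" using m by simp
    qed (use assms in \<open>auto simp: carrier_poly_ring\<close>)
  qed (use assms in \<open>auto simp: ring_axioms mult.commute\<close>)
qed

lemma ideal_mideal: "upset V N \<Longrightarrow> ideal (mideal N) (poly_ring V)"
  by (rule ideal_poly_ringI)
     (auto simp: carrier_poly_ring mideal_add intro: mideal_mult, auto simp: mideal_def upset_def)

lemma ideal_sum:
  assumes "ideal I (poly_ring V)" "\<And>a. a \<in> A \<Longrightarrow> f a \<in> I"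
  shows "sum f A \<in> I"
proof -
  interpret ideal I "poly_ring V" by (rule assms(1))
  show ?thesis using assms(2)
    using additive_subgroup.zero_closed[OF additive_subgroup_axioms]
      additive_subgroup.a_closed[OF additive_subgroup_axioms]
    by (induction A rule: infinite_finite_induct) auto
qed

lemma ideal_minus:
  assumes "ideal I (poly_ring V)" "a \<in> I" "b \<in> I"
  shows "a - b \<in> I"
proof -
  interpret ideal I "poly_ring V" by (rule assms(1))
  have "- 1 \<in> carrier (poly_ring V)"
    by (auto simp: carrier_poly_ring mideal_def exponents_def in_keys_iff lookup_one when_def)
  from I_l_closed[OF assms(3) this] have "- b \<in> I" by simp
  with assms(2) have "a + - b \<in> I" 
    using additive_subgroup.a_closed[OF additive_subgroup_axioms] by fastforce
  then show ?thesis by simp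
qed

definition up :: "'v set \<Rightarrow> ('v \<Rightarrow>\<^sub>0 nat) set \<Rightarrow> ('v \<Rightarrow>\<^sub>0 nat) set" where
  "up V A = {a + k | a k. a \<in> A \<and> k \<in> exponents V}"

lemma upset_up: "A \<subseteq> exponents V \<Longrightarrow> upset V (up V A)"
  unfolding upset_def
proof (intro conjI ballI)
  assume A: "A \<subseteq> exponents V"
  then show "up V A \<subseteq> exponents V"
    by (force simp: up_def exponents_def supp_add_exp)
  fix m k assume "m \<in> up V A" "k \<in> exponents V"
  then obtain a l where "m = a + l" "a \<in> A" "l \<in> exponents V"
    by (auto simp: up_def)
  with \<open>k \<in> exponents V\<close> have "m + k = a + (l + k)" "l + k \<in> exponents V"
    by (simp_all add: add.assoc exponents_def supp_add_exp)
  with \<open>a \<in> A\<close> show "m + k \<in> up V A"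
    by (auto simp: up_def)
qed

lemma up_self: "A \<subseteq> up V A"
  by (force simp: up_def exponents_def)

text \<open>Every term of a polynomial in \<open>mideal (up V A)\<close> is a multiple of some
  \<open>monomial a\<close>. The set \<open>S\<close> is only sandwiched, so that both sets of
  monomial generators and images of whole ideals under a substitution are covered.\<close>

lemma Idl_eq_mideal:
  fixes S :: "('v, 'k::field) mpoly set"
  assumes A: "A \<subseteq> exponents V" and "monomial ` A \<subseteq> S" "S \<subseteq> mideal (up V A)"
  shows "Idl\<^bsub>poly_ring V\<^esub> S = mideal (up V A)"
proof
  interpret cring "poly_ring V :: ('v, 'k) mpoly ring" by (rule cring_poly_ring)
  have S: "S \<subseteq> carrier (poly_ring V)"
    using assms(3) upset_up[OF A] unfolding carrier_poly_ring mideal_def upset_def by blast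
  show "Idl\<^bsub>poly_ring V\<^esub> S \<subseteq> mideal (up V A)"
    by (rule genideal_minimal[OF ideal_mideal[OF upset_up[OF A]] assms(3)])
  interpret I: ideal "Idl\<^bsub>poly_ring V\<^esub> S" "poly_ring V" by (rule genideal_ideal[OF S])
  show "mideal (up V A) \<subseteq> Idl\<^bsub>poly_ring V\<^esub> S"
  proof
    fix p :: "('v, 'k) mpoly" assume p: "p \<in> mideal (up V A)"
    have "sgl m (lookup p m) \<in> Idl\<^bsub>poly_ring V\<^esub> S" if "m \<in> supp p" for m
    proof -
      obtain a k where m: "m = a + k" "a \<in> A" "k \<in> exponents V"
        using p \<open>m \<in> supp p\<close> by (auto simp: mideal_def up_def)
      have "monomial a \<in> Idl\<^bsub>poly_ring V\<^esub> S"
        using genideal_self[OF S] assms(2) m by auto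
      moreover have "sgl k (lookup p m) \<in> carrier (poly_ring V)"
        unfolding carrier_poly_ring using m(3) by (rule single_mideal)
      ultimately have "monomial a * sgl k (lookup p m) \<in> Idl\<^bsub>poly_ring V\<^esub> S"
        using I.I_r_closed by simp
      then show ?thesis by (simp add: monomial_def mult_single m)
    qed
    then have "(\<Sum>m\<in>supp p. sgl m (lookup p m)) \<in> Idl\<^bsub>poly_ring V\<^esub> S"
      by (rule ideal_sum[OF I.ideal_axioms])
    then show "p \<in> Idl\<^bsub>poly_ring V\<^esub> S"
      using poly_mapping_eq_sum_single[of "supp p" p] by simp
  qed
qed

section \<open>Square-free monomial ideals\<close>

lemma monomial_add: "monomial (a + b) = monomial a * monomial b"
  by (simp add: monomial_def mult_single)

definition ind_exp :: "'v set \<Rightarrow> ('v \<Rightarrow>\<^sub>0 nat)" where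
  "ind_exp \<sigma> = (\<Sum>v\<in>\<sigma>. unit_exp v)"

lemma lookup_ind_exp: "finite \<sigma> \<Longrightarrow> lookup (ind_exp \<sigma>) v = (if v \<in> \<sigma> then 1 else 0)"
  by (simp add: ind_exp_def lookup_sum lookup_unit_exp sum.delta)

lemma supp_ind_exp [simp]: "finite \<sigma> \<Longrightarrow> supp (ind_exp \<sigma>) = \<sigma>"
  by (auto simp: in_keys_iff lookup_ind_exp split: if_splits)

lemma sqfree_monomial_eq: "sqfree_monomial \<sigma> = monomial (ind_exp \<sigma>)"
proof (induction \<sigma> rule: infinite_finite_induct)
  case (insert v \<sigma>)
  then show ?case
    by (simp add: sqfree_monomial_def ind_exp_def var_eq monomial_add)
qed (auto simp: sqfree_monomial_def ind_exp_def monomial_def)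

lemma ind_exp_le:
  "finite \<sigma> \<Longrightarrow> \<sigma> \<subseteq> supp m \<Longrightarrow> lookup (ind_exp \<sigma>) v \<le> lookup m v"
  by (auto simp: lookup_ind_exp in_keys_iff Suc_le_eq)

text \<open>The exponents of the ideal generated by square-free monomials: divisibility by such a
  monomial depends only on the support.\<close>

definition sq_exps :: "'v set \<Rightarrow> 'v set set \<Rightarrow> ('v \<Rightarrow>\<^sub>0 nat) set" where
  "sq_exps V \<Sigma> = {m. supp m \<subseteq> V \<and> (\<exists>\<sigma>\<in>\<Sigma>. \<sigma> \<subseteq> supp m)}"

abbreviation sq_ideal :: "'v set \<Rightarrow> 'v set set \<Rightarrow> ('v, 'k::field) mpoly set" where
  "sq_ideal V \<Sigma> \<equiv> Idl\<^bsub>poly_ring V\<^esub> (sqfree_monomial ` \<Sigma>)"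

lemma upset_sq_exps: "upset V (sq_exps V \<Sigma>)"
  unfolding upset_def sq_exps_def exponents_def by (auto simp: supp_add_exp)

text \<open>Extension to a larger polynomial ring: a substitution lands in the ring on the variables
  that actually occur, while the target ideal lives over all of \<open>X\<close>.\<close>

lemma up_sq_exps: "V' \<subseteq> V \<Longrightarrow> \<Sigma> \<subseteq> Fpow V' \<Longrightarrow> up V (sq_exps V' \<Sigma>) = sq_exps V \<Sigma>"
proof (intro subset_antisym subsetI)
  fix m assume V: "V' \<subseteq> V" and "m \<in> up V (sq_exps V' \<Sigma>)"
  then obtain a k \<sigma> where "m = a + k" "supp a \<subseteq> V'" "supp k \<subseteq> V" "\<sigma> \<in> \<Sigma>" "\<sigma> \<subseteq> supp a"
    by (auto simp: up_def sq_exps_def exponents_def)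
  with V show "m \<in> sq_exps V \<Sigma>"
    by (auto simp: sq_exps_def supp_add_exp)
next
  fix m assume \<Sigma>: "\<Sigma> \<subseteq> Fpow V'" and "m \<in> sq_exps V \<Sigma>"
  then obtain \<sigma> where \<sigma>: "supp m \<subseteq> V" "\<sigma> \<in> \<Sigma>" "\<sigma> \<subseteq> supp m" "finite \<sigma>" "\<sigma> \<subseteq> V'"
    by (auto simp: sq_exps_def Fpow_def)
  obtain d where d: "m = ind_exp \<sigma> + d"
    using exp_le_imp_add[OF ind_exp_le[OF \<sigma>(4,3)]] .
  have "ind_exp \<sigma> \<in> sq_exps V' \<Sigma>" "d \<in> exponents V"
    using \<sigma> d by (auto simp: sq_exps_def exponents_def supp_add_exp)
  then show "m \<in> up V (sq_exps V' \<Sigma>)"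
    using d by (auto simp: up_def)
qed

lemma up_ind_exp:
  assumes "\<Sigma> \<subseteq> Fpow V"
  shows "up V (ind_exp ` \<Sigma>) = sq_exps V \<Sigma>"
proof (intro subset_antisym subsetI)
  fix m assume "m \<in> up V (ind_exp ` \<Sigma>)"
  then obtain \<sigma> k where "m = ind_exp \<sigma> + k" "\<sigma> \<in> \<Sigma>" "supp k \<subseteq> V"
    by (auto simp: up_def exponents_def)
  moreover from this(2) have "finite \<sigma>" "\<sigma> \<subseteq> V" using assms by (auto simp: Fpow_def)
  ultimately show "m \<in> sq_exps V \<Sigma>"
    by (auto simp: sq_exps_def supp_add_exp)
next
  fix m assume "m \<in> sq_exps V \<Sigma>"
  then obtain \<sigma> where \<sigma>: "supp m \<subseteq> V" "\<sigma> \<in> \<Sigma>" "\<sigma> \<subseteq> supp m" "finite \<sigma>"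
    using assms by (auto simp: sq_exps_def Fpow_def)
  obtain d where d: "m = ind_exp \<sigma> + d"
    using exp_le_imp_add[OF ind_exp_le[OF \<sigma>(4,3)]] .
  have "d \<in> exponents V"
    using \<sigma> d by (auto simp: exponents_def supp_add_exp)
  then show "m \<in> up V (ind_exp ` \<Sigma>)"
    using d \<sigma> by (auto simp: up_def)
qed

lemma ind_exp_exponents: "\<Sigma> \<subseteq> Fpow V \<Longrightarrow> ind_exp ` \<Sigma> \<subseteq> exponents V"
  unfolding exponents_def Fpow_def using supp_ind_exp by fastforce

lemma sq_ideal_eq:
  assumes "\<Sigma> \<subseteq> Fpow V"
  shows "(sq_ideal V \<Sigma> :: ('v, 'k::field) mpoly set) = mideal (sq_exps V \<Sigma>)"
proof -
  have A: "ind_exp ` \<Sigma> \<subseteq> exponents V"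
    using assms by (intro ind_exp_exponents) auto
  have im: "sqfree_monomial ` \<Sigma> = (monomial ` ind_exp ` \<Sigma> :: ('v, 'k::field) mpoly set)"
    by (auto simp: sqfree_monomial_eq)
  show ?thesis
    unfolding im up_ind_exp[OF assms, symmetric]
    by (rule Idl_eq_mideal[OF A]) (use up_self in force)+
qed

section \<open>Minimal generators\<close>

definition antichain :: "'v set set \<Rightarrow> bool" where
  "antichain \<Sigma> \<longleftrightarrow> (\<forall>\<sigma>\<in>\<Sigma>. \<forall>\<tau>\<in>\<Sigma>. \<sigma> \<subseteq> \<tau> \<longrightarrow> \<sigma> = \<tau>)"

definition exp_le :: "('v \<Rightarrow>\<^sub>0 nat) \<Rightarrow> ('v \<Rightarrow>\<^sub>0 nat) \<Rightarrow> bool" where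
  "exp_le a b \<longleftrightarrow> (\<forall>v. lookup a v \<le> lookup b v)"

lemma exp_le_refl [simp]: "exp_le a a"
  by (simp add: exp_le_def)

lemma exp_le_trans: "exp_le a b \<Longrightarrow> exp_le b c \<Longrightarrow> exp_le a c"
  by (auto simp: exp_le_def intro: order.trans)

lemma exp_le_antisym: "exp_le a b \<Longrightarrow> exp_le b a \<Longrightarrow> a = b"
  by (auto simp: exp_le_def intro!: poly_mapping_eqI le_antisym)

lemma exp_le_iff_add: "exp_le a b \<longleftrightarrow> (\<exists>d. b = a + d)"
  by (auto simp: exp_le_def lookup_add) (metis exp_le_imp_add)

lemma exp_le_push: "exp_le a b \<Longrightarrow> exp_le (push_keys g a) (push_keys g b)"
  by (auto simp: exp_le_iff_add push_keys_add)

lemma exp_le_supp: "exp_le a b \<Longrightarrow> supp a \<subseteq> supp b"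
  by (auto simp: exp_le_iff_add supp_add_exp)

lemma upset_exp_le: "upset V N \<Longrightarrow> a \<in> N \<Longrightarrow> exp_le a b \<Longrightarrow> b \<in> exponents V \<Longrightarrow> b \<in> N"
  by (auto simp: exp_le_iff_add upset_def exponents_def supp_add_exp)

definition min_exps :: "('v \<Rightarrow>\<^sub>0 nat) set \<Rightarrow> ('v \<Rightarrow>\<^sub>0 nat) set" where
  "min_exps N = {m \<in> N. \<forall>m'\<in>N. exp_le m' m \<longrightarrow> m' = m}"

lemma min_gens_mideal: "min_gens (mideal N :: ('v, 'k::field) mpoly set) = min_exps N"
  by (auto simp: min_gens_def min_exps_def exp_le_def)

definition exp_degree :: "('v \<Rightarrow>\<^sub>0 nat) \<Rightarrow> nat" where
  "exp_degree m = (\<Sum>v\<in>supp m. lookup m v)"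

lemma exp_degree_add: "exp_degree (a + b) = exp_degree a + exp_degree b"
proof -
  have deg: "exp_degree m = (\<Sum>v\<in>supp a \<union> supp b. lookup m v)"
    if "supp m \<subseteq> supp a \<union> supp b" for m
    unfolding exp_degree_def using that
    by (intro sum.mono_neutral_left) (auto simp: in_keys_iff)
  show ?thesis
    by (simp add: deg supp_add_exp lookup_add sum.distrib)
qed

lemma exp_degree_unit [simp]: "exp_degree (unit_exp v) = 1"
  by (simp add: exp_degree_def lookup_unit_exp)

lemma exp_degree_eq_0: "exp_degree m = 0 \<longleftrightarrow> m = 0"
  by (auto simp: exp_degree_def in_keys_iff)
     (metis lookup_zero poly_mapping_eqI)

lemma exp_eq_unit_add:
  assumes "lookup m v > 0"
  obtains p where "m = p + unit_exp v"
proof -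
  have "exp_le (unit_exp v) m"
    using assms by (auto simp: exp_le_def lookup_unit_exp)
  then show ?thesis
    using that by (auto simp: exp_le_iff_add add.commute)
qed

lemma exp_induct [case_names zero add]:
  assumes "P 0" "\<And>m v. P m \<Longrightarrow> P (m + unit_exp v)"
  shows "P (m :: 'v \<Rightarrow>\<^sub>0 nat)"
proof (induction "exp_degree m" arbitrary: m)
  case 0
  then show ?case using assms(1) by (simp add: exp_degree_eq_0)
next
  case (Suc k)
  then obtain v where "lookup m v > 0"
    by (metis Zero_not_Suc exp_degree_eq_0 gr0I lookup_zero poly_mapping_eqI)
  then obtain p where p: "m = p + unit_exp v" by (rule exp_eq_unit_add)
  with Suc show ?case by (simp add: exp_degree_add assms(2))
qed

lemma min_exps_below:
  assumes "m \<in> N"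
  obtains m0 where "m0 \<in> min_exps N" "exp_le m0 m"
proof -
  have "\<exists>m0\<in>min_exps N. exp_le m0 m" using assms
  proof (induction "exp_degree m" arbitrary: m rule: less_induct)
    case less
    show ?case
    proof (cases "m \<in> min_exps N")
      case False
      with less.prems obtain m' where m': "m' \<in> N" "exp_le m' m" "m' \<noteq> m"
        by (auto simp: min_exps_def)
      then obtain d where "m = m' + d" by (auto simp: exp_le_iff_add)
      with m' have "exp_degree m' < exp_degree m"
        using exp_degree_eq_0[of d] by (auto simp: exp_degree_add)
      from less.hyps[OF this m'(1)] show ?thesis
        using m'(2) exp_le_trans by blast
    qed (auto intro: exp_le_refl)
  qed
  then show ?thesis using that by blast
qed

lemma min_exps_up:
  assumes "A \<subseteq> exponents V"
  shows "min_exps (up V A) = min_exps A"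
proof -
  have below: "\<exists>a\<in>A. exp_le a m" if "m \<in> up V A" for m
    using that by (auto simp: up_def exp_le_iff_add)
  show ?thesis
    unfolding min_exps_def using below up_self[of A V] exp_le_trans exp_le_antisym
    by (smt (verit, ccfv_SIG) Collect_cong in_mono)
qed

lemma min_exps_sq_exps:
  assumes "\<Sigma> \<subseteq> Fpow V" "antichain \<Sigma>"
  shows "min_exps (sq_exps V \<Sigma>) = ind_exp ` \<Sigma>"
proof -
  have fin: "finite \<sigma>" if "\<sigma> \<in> \<Sigma>" for \<sigma> using assms that by (auto simp: Fpow_def)
  have A: "ind_exp ` \<Sigma> \<subseteq> exponents V"
    using assms by (intro ind_exp_exponents) auto
  have "min_exps (ind_exp ` \<Sigma>) = ind_exp ` \<Sigma>"
  proof -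
    have "\<sigma> = \<tau>" if "\<sigma> \<in> \<Sigma>" "\<tau> \<in> \<Sigma>" "exp_le (ind_exp \<sigma>) (ind_exp \<tau>)" for \<sigma> \<tau>
      using exp_le_supp[OF that(3)] assms(2) that fin by (auto simp: antichain_def)
    then show ?thesis by (auto simp: min_exps_def)
  qed
  then show ?thesis
    unfolding up_ind_exp[OF assms(1), symmetric] min_exps_up[OF A] .
qed

lemma inj_on_ind_exp: "\<Sigma> \<subseteq> Fpow V \<Longrightarrow> inj_on ind_exp \<Sigma>"
  by (rule inj_onI) (metis (no_types, lifting) Fpow_def in_mono mem_Collect_eq supp_ind_exp)

lemma min_gens_sq_ideal:
  assumes "\<Sigma> \<subseteq> Fpow V" "antichain \<Sigma>"
  shows "min_gens (sq_ideal V \<Sigma> :: ('v, 'k::field) mpoly set) = ind_exp ` \<Sigma>"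
  by (simp add: sq_ideal_eq[OF assms(1)] min_gens_mideal min_exps_sq_exps[OF assms])

text \<open>Minimal generators make no reference to the ambient ring, and for an antichain their
  supports are exactly its members.\<close>

lemma sq_ideal_inject:
  assumes "\<Sigma> \<subseteq> Fpow V" "antichain \<Sigma>" "\<Sigma>' \<subseteq> Fpow V'" "antichain \<Sigma>'"
    and "sq_ideal V \<Sigma> = (sq_ideal V' \<Sigma>' :: ('v, 'k::field) mpoly set)"
  shows "\<Sigma> = \<Sigma>'"
proof -
  have "supp ` min_gens (sq_ideal V \<Sigma> :: ('v, 'k) mpoly set) = \<Sigma>"
    if "\<Sigma> \<subseteq> Fpow V" "antichain \<Sigma>" for \<Sigma> and V :: "'v set"
  proof -
    have "supp (ind_exp \<sigma>) = \<sigma>" if "\<sigma> \<in> \<Sigma>" for \<sigma>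
      using that \<open>\<Sigma> \<subseteq> Fpow V\<close> by (auto simp: Fpow_def)
    then show ?thesis by (simp add: min_gens_sq_ideal[OF that] image_image)
  qed
  from this[OF assms(1,2)] this[OF assms(3,4)] show ?thesis using assms(5) by simp
qed

lemma used_vars_sq_ideal:
  assumes "\<Sigma> \<subseteq> Fpow V" "antichain \<Sigma>"
  shows "used_vars (sq_ideal V \<Sigma> :: ('v, 'k::field) mpoly set) = \<Union>\<Sigma>"
proof -
  have "supp (ind_exp \<sigma>) = \<sigma>" if "\<sigma> \<in> \<Sigma>" for \<sigma>
    using that assms(1) by (auto simp: Fpow_def)
  then show ?thesis
    by (simp add: used_vars_def min_gens_sq_ideal[OF assms])
qed

lemma sqfree_monomial_ideal_antichain:
  assumes "sqfree_monomial_ideal V (I :: ('v, 'k::field) mpoly set)" "finite V"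
  obtains G where "G \<subseteq> Fpow V" "antichain G" "I = sq_ideal V G"
proof -
  obtain \<Sigma> where \<Sigma>: "\<Sigma> \<subseteq> Fpow V" "I = sq_ideal V \<Sigma>"
    using assms(1) by (auto simp: sqfree_monomial_ideal_def)
  define G where "G = {\<sigma>\<in>\<Sigma>. \<forall>\<tau>\<in>\<Sigma>. \<tau> \<subseteq> \<sigma> \<longrightarrow> \<tau> = \<sigma>}"
  have GS: "G \<subseteq> \<Sigma>" by (auto simp: G_def)
  have "finite \<Sigma>"
    by (rule finite_subset[of _ "Pow V"]) (use \<Sigma>(1) assms(2) in \<open>auto simp: Fpow_def\<close>)
  have "\<exists>\<tau>\<in>G. \<tau> \<subseteq> \<sigma>" if \<sigma>: "\<sigma> \<in> \<Sigma>" for \<sigma>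
  proof -
    obtain \<tau> where "\<tau> \<in> \<Sigma>" "\<tau> \<subseteq> \<sigma>" "\<forall>\<rho>\<in>\<Sigma>. \<rho> \<subseteq> \<tau> \<longrightarrow> \<tau> = \<rho>"
      using finite_has_minimal2[OF \<open>finite \<Sigma>\<close> \<sigma>] by blast
    then show ?thesis unfolding G_def by blast
  qed
  then have "(\<exists>\<sigma>\<in>\<Sigma>. \<sigma> \<subseteq> A) \<longleftrightarrow> (\<exists>\<sigma>\<in>G. \<sigma> \<subseteq> A)" for A
    using GS by (meson order.trans subsetD)
  then have "sq_exps V \<Sigma> = sq_exps V G"
    by (simp add: sq_exps_def)
  moreover have "G \<subseteq> Fpow V" "antichain G"
    using \<Sigma>(1) by (auto simp: G_def antichain_def)
  ultimately show ?thesis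
    using that \<Sigma> by (simp add: sq_ideal_eq)
qed

section \<open>Identifying two variables\<close>

text \<open>For an upset \<open>N\<close> of exponents this says that \<open>x - y\<close> is a non-zero-divisor modulo the
  monomial ideal of \<open>N\<close>.\<close>

definition nzd :: "('v \<Rightarrow>\<^sub>0 nat) set \<Rightarrow> 'v \<Rightarrow> 'v \<Rightarrow> bool" where
  "nzd N x y \<longleftrightarrow> (\<forall>w. w + unit_exp x \<in> N \<longrightarrow> w + unit_exp y \<in> N \<longrightarrow> w \<in> N)"

lemma nzd_sym: "nzd N x y \<longleftrightarrow> nzd N y x"
  by (auto simp: nzd_def)

lemma upset_add_unit:
  assumes "upset V N" "w \<in> N" "y \<in> V"
  shows "w + unit_exp y \<in> N"
  using assms by (auto simp: upset_def exponents_def)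

text \<open>The exponent \<open>k\<close> is lowered one step at a time: \<open>w z^(k-1)\<close>
  times \<open>c\<close> lies in \<open>N\<close> because \<open>w c\<close> does, and
  \<open>w z^(k-1)\<close> times \<open>z\<close> is \<open>w z^k\<close>.\<close>

lemma nzd_power:
  assumes "nzd N z c" "upset V N" "w + unit_exp c \<in> N" "w + sgl z k \<in> N" "z \<in> V"
  shows "w \<in> N"
  using assms(4)
proof (induction k)
  case (Suc k)
  let ?w = "w + sgl z k"
  have "sgl z k \<in> exponents V"
    using \<open>z \<in> V\<close> by (auto simp: exponents_def)
  then have "w + unit_exp c + sgl z k \<in> N"
    using assms(2,3) by (auto simp: upset_def)
  then have "?w + unit_exp c \<in> N"
    by (simp add: ac_simps)
  moreover have "?w + unit_exp z \<in> N"
    using Suc.prems by (simp add: unit_exp_def add.assoc flip: single_add)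
  ultimately have "?w \<in> N" using assms(1) by (auto simp: nzd_def)
  then show ?case by (rule Suc.IH)
qed simp

text \<open>Here the image of \<open>w'\<close> under \<open>z := c\<close> divides that of
  \<open>w\<close>, but \<open>w'\<close> has too much \<open>z\<close>. Then \<open>w\<close> has
  an excess of \<open>c\<close>. Giving up one \<open>c\<close> and adding the missing power of
  \<open>z\<close> leaves a multiple of \<open>w'\<close>, which puts the pair \<open>p\<close>,
  \<open>k\<close> in reach of \<open>nzd_power\<close>.\<close>

lemma merge_exchange:
  fixes w w' :: "'v \<Rightarrow>\<^sub>0 nat"
  assumes N: "upset V N" "w' \<in> N" and "w \<in> exponents V" and zc: "z \<noteq> c"
    and le: "\<And>v. v \<noteq> z \<Longrightarrow> v \<noteq> c \<Longrightarrow> lookup w' v \<le> lookup w v"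
    and sum: "lookup w' z + lookup w' c \<le> lookup w z + lookup w c"
    and lt: "lookup w z < lookup w' z"
  obtains p k where "w = p + unit_exp c" "p \<in> exponents V" "p + sgl z k \<in> N" "z \<in> V"
proof -
  have "lookup w' c < lookup w c" using sum lt by linarith
  then obtain p where p: "w = p + unit_exp c"
    using exp_eq_unit_add[of w c] by auto
  have zV: "z \<in> V"
    using lt N by (force simp: upset_def exponents_def in_keys_iff)
  have pV: "p \<in> exponents V" using p assms(3) by (auto simp: exponents_def supp_add_exp)
  let ?k = "lookup w' z - lookup w z"
  have "exp_le w' (p + sgl z ?k)"
    unfolding exp_le_def
  proof
    fix v
    show "lookup w' v \<le> lookup (p + sgl z ?k) v"
      using le[of v] lt sum zc unfolding p
      by (cases "v = z"; cases "v = c") (auto simp: lookup_add lookup_single lookup_unit_exp when_def)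
  qed
  then have "p + sgl z ?k \<in> N"
    by (rule upset_exp_le[OF N]) (use pV zV in \<open>auto simp: exponents_def supp_add_exp split: if_splits\<close>)
  then show ?thesis using that p pV zV by blast
qed

lemma lookup_push_upd:
  fixes m :: "'v \<Rightarrow>\<^sub>0 nat"
  assumes "z \<noteq> c"
  shows "lookup (push_keys (id(z := c)) m) v =
    (if v = c then lookup m z + lookup m c else if v = z then 0 else lookup m v)"
proof -
  have "lookup (push_keys (id(z := c)) m) v
     = (\<Sum>k\<in>{k\<in>supp m. (id(z := c)) k = v}. lookup m k)"
    by (rule lookup_push_keys)
  also have "\<dots> = (\<Sum>k\<in>(if v = c then {z, c} else if v = z then {} else {v}). lookup m k)"
    using assms by (intro sum.mono_neutral_left) (auto simp: in_keys_iff split: if_splits)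
  finally show ?thesis using assms by auto
qed

text \<open>If \<open>m\<close> had more \<open>z\<close> or more \<open>c\<close> than
  \<open>m'\<close>, exchange and \<open>nzd_power\<close> would produce a proper divisor of
  \<open>m'\<close> in \<open>N\<close>. Hence minimal generators neither collide nor become
  comparable when \<open>z\<close> and \<open>c\<close> are identified.\<close>

lemma nzd_merge_min:
  assumes N: "upset V N" and nzd: "nzd N z c" and zc: "z \<noteq> c"
    and m: "m \<in> min_exps N" "m' \<in> min_exps N"
    and le: "exp_le (push_keys (id(z := c)) m) (push_keys (id(z := c)) m')"
  shows "m = m'"
proof -
  have mN: "m \<in> N" "m' \<in> N" using m by (auto simp: min_exps_def)
  have mV: "m' \<in> exponents V" using mN N by (auto simp: upset_def)
  have le1: "lookup m v \<le> lookup m' v" if "v \<noteq> z" "v \<noteq> c" for v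
    using le that zc by (auto simp: exp_le_def lookup_push_upd dest!: spec[of _ v])
  have le2: "lookup m z + lookup m c \<le> lookup m' z + lookup m' c"
    using le zc by (auto simp: exp_le_def lookup_push_upd dest!: spec[of _ c])
  \<comment> \<open>One argument for both excesses: \<open>a\<close> and \<open>b\<close> are
    \<open>z\<close> and \<open>c\<close> in either order.\<close>
  have no: False if nzd: "nzd N a b" and ab: "a = z \<and> b = c \<or> a = c \<and> b = z" and lt: "lookup m' a < lookup m a" for a b
  proof -
    have "a \<noteq> b" using ab zc by auto
    moreover have "lookup m v \<le> lookup m' v" if "v \<noteq> a" "v \<noteq> b" for v
      using le1 that ab by blast
    moreover have "lookup m a + lookup m b \<le> lookup m' a + lookup m' b"
      using le2 ab by auto
    ultimately obtain p k where p: "m' = p + unit_exp b" "p \<in> exponents V"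
      "p + sgl a k \<in> N" "a \<in> V"
      using merge_exchange[OF N mN(1) mV _ _ _ lt] by blast
    have "p \<in> N" using nzd_power[OF nzd N _ p(3,4)] p(1) mN by auto
    moreover have "exp_le p m'" using p(1) by (auto simp: exp_le_iff_add)
    ultimately have "p = m'" using m(2) by (auto simp: min_exps_def)
    with p(1) show False using exp_degree_add[of p "unit_exp b"] by (metis exp_degree_unit add_cancel_right_right zero_neq_one)
  qed
  have "lookup m z \<le> lookup m' z" "lookup m c \<le> lookup m' c"
    using no[of z c] no[of c z] nzd nzd_sym[of N z c] by (auto simp: not_less[symmetric])
  with le1 have "exp_le m m'" unfolding exp_le_def by metis
  then show ?thesis using m by (auto simp: min_exps_def)
qed

text \<open>Every counterexample \<open>w\<close> to the conclusion yields a smaller one: its image lies in the image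
  of \<open>N\<close>, so some \<open>w'\<close> in \<open>N\<close> has the same image, and \<open>w\<close> may be divided by \<open>z\<close> or \<open>c\<close>.\<close>

lemma nzd_merge_descend:
  assumes N: "upset V N" and nzd: "nzd N z c" and zc: "z \<noteq> c"
    and merged: "nzd (push_keys (id(z := c)) ` N) ((id(z := c)) x) ((id(z := c)) y)"
  shows "nzd N x y"
proof -
  let ?h = "id(z := c)"
  have "w \<in> N" if "w + unit_exp x \<in> N" "w + unit_exp y \<in> N" for w
    using that
  proof (induction "lookup w z + lookup w c" arbitrary: w rule: less_induct)
    case less
    have "push_keys ?h w + unit_exp (?h v) \<in> push_keys ?h ` N" if "w + unit_exp v \<in> N" for v
      using that by (auto simp: push_keys_add intro!: rev_image_eqI)
    then have "push_keys ?h w \<in> push_keys ?h ` N"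
      using merged less.prems unfolding nzd_def by blast
    then obtain w' where w': "w' \<in> N" "push_keys ?h w' = push_keys ?h w" by auto
    have eq: "lookup w' v = lookup w v" if "v \<noteq> z" "v \<noteq> c" for v
      using w'(2) that zc by (metis lookup_push_upd)
    have sum: "lookup w' z + lookup w' c = lookup w z + lookup w c"
      using w'(2) zc by (metis lookup_push_upd)
    have xyV: "x \<in> V" "y \<in> V" "w \<in> exponents V"
      using subsetD[OF N[unfolded upset_def, THEN conjunct1] less.prems(1)]
        subsetD[OF N[unfolded upset_def, THEN conjunct1] less.prems(2)]
      by (auto simp: exponents_def supp_add_exp)
    have step: "w \<in> N" if nzd: "nzd N a b" and ab: "a = z \<and> b = c \<or> a = c \<and> b = z" and lt: "lookup w a < lookup w' a" for a b
    proof -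
      have ne: "a \<noteq> b" using ab zc by auto
      moreover have "lookup w' v \<le> lookup w v" if "v \<noteq> a" "v \<noteq> b" for v
        using eq[of v] that ab by (metis order_refl)
      moreover have "lookup w' a + lookup w' b \<le> lookup w a + lookup w b"
        using sum ab by auto
      ultimately obtain p k where p: "w = p + unit_exp b" "p \<in> exponents V"
        "p + sgl a k \<in> N" "a \<in> V"
        using merge_exchange[OF N w'(1) xyV(3) _ _ _ lt] by blast
      \<comment> \<open>Both \<open>p v b = w v\<close> and \<open>p v a^k\<close> lie in
        \<open>N\<close>, hence \<open>p v\<close> does. So \<open>p\<close> satisfies the
        hypotheses made on \<open>w\<close>, with smaller degree in \<open>z\<close> and
        \<open>c\<close>.\<close>
      have pv: "p + unit_exp v \<in> N" if "v \<in> V" "w + unit_exp v \<in> N" for v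
      proof (rule nzd_power[OF nzd N _ _ p(4)])
        show "p + unit_exp v + unit_exp b \<in> N" using that p(1) by (simp add: ac_simps)
        have "p + sgl a k + unit_exp v \<in> N"
          by (rule upset_add_unit[OF N p(3) that(1)])
        then show "p + unit_exp v + sgl a k \<in> N" by (simp add: ac_simps)
      qed
      have "lookup p a + lookup p b < lookup w a + lookup w b"
        using ne by (simp add: p(1) lookup_add lookup_unit_exp)
      then have "lookup p z + lookup p c < lookup w z + lookup w c"
        using ab by auto
      then have "p \<in> N" using less.hyps less.prems pv xyV by blast
      moreover have "b \<in> V" using p(1) xyV(3) by (auto simp: exponents_def supp_add_exp)
      ultimately show "w \<in> N" using upset_add_unit[OF N] p(1) by blast
    qed
    show ?case
    proof (cases "lookup w z = lookup w' z")
      case True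
      then have "w = w'" using eq sum by (intro poly_mapping_eqI) (metis add_left_cancel)
      then show ?thesis using w' by simp
    next
      case False
      then have "lookup w z < lookup w' z \<or> lookup w c < lookup w' c" using sum by linarith
      then show ?thesis
        using step[of z c] step[of c z] nzd nzd_sym[of N z c] by auto
    qed
  qed
  then show ?thesis by (auto simp: nzd_def)
qed

text \<open>In general a substitution may make one generator divide another; the hypothesis excludes
  this.\<close>

lemma min_exps_push:
  assumes "\<And>m m'. m \<in> min_exps N \<Longrightarrow> m' \<in> min_exps N \<Longrightarrow>
      exp_le (push_keys f m) (push_keys f m') \<Longrightarrow> m = m'"
  shows "min_exps (push_keys f ` N) = push_keys f ` min_exps N"
proof (intro subset_antisym subsetI)
  fix k assume k: "k \<in> min_exps (push_keys f ` N)"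
  then obtain m where m: "m \<in> N" "k = push_keys f m" by (auto simp: min_exps_def)
  obtain m0 where m0: "m0 \<in> min_exps N" "exp_le m0 m" using min_exps_below[OF m(1)] .
  then have "push_keys f m0 = k"
    using k m exp_le_push[OF m0(2), of f] by (auto simp: min_exps_def)
  then show "k \<in> push_keys f ` min_exps N" using m0 by auto
next
  fix k assume "k \<in> push_keys f ` min_exps N"
  then obtain m where m: "m \<in> min_exps N" "k = push_keys f m" by auto
  have "push_keys f m' = k" if m': "m' \<in> N" "exp_le (push_keys f m') k" for m'
  proof -
    obtain m0 where m0: "m0 \<in> min_exps N" "exp_le m0 m'" using min_exps_below[OF m'(1)] .
    have "exp_le (push_keys f m0) (push_keys f m)"
      using exp_le_trans[OF exp_le_push[OF m0(2)] m'(2)] m(2) by simp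
    then have "m0 = m" using assms m0(1) m(1) by blast
    then show ?thesis using exp_le_push[OF m0(2), of f] m'(2) m(2) exp_le_antisym by blast
  qed
  then show "k \<in> min_exps (push_keys f ` N)" using m by (auto simp: min_exps_def)
qed

section \<open>Regular sequences of differences of variables\<close>

lemma push_keys_surj:
  assumes "k \<in> exponents (g ` Y)"
  obtains m where "m \<in> exponents Y" "push_keys g m = k"
proof
  let ?s = "inv_into Y g"
  have s: "?s v \<in> Y" "g (?s v) = v" if "v \<in> supp k" for v
    using assms that by (auto simp: exponents_def intro: inv_into_into f_inv_into_f)
  show "push_keys ?s k \<in> exponents Y"
    using s by (auto simp: exponents_def keys_push_keys_nat)
  show "push_keys g (push_keys ?s k) = k"
    unfolding push_keys_comp by (rule push_keys_ident) (simp add: s)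
qed

lemma push_keys_exponents: "m \<in> exponents Y \<Longrightarrow> push_keys g m \<in> exponents (g ` Y)"
  by (auto simp: exponents_def keys_push_keys_nat)

lemma upset_push:
  assumes "upset Y M"
  shows "upset (g ` Y) (push_keys g ` M)"
  unfolding upset_def
proof (intro conjI ballI)
  show "push_keys g ` M \<subseteq> exponents (g ` Y)"
    using assms push_keys_exponents unfolding upset_def by blast
  fix m k assume "m \<in> push_keys g ` M" "k \<in> exponents (g ` Y)"
  then obtain m' k' where "m' \<in> M" "m = push_keys g m'" "k' \<in> exponents Y" "k = push_keys g k'"
    by (metis imageE push_keys_surj)
  then show "m + k \<in> push_keys g ` M"
    using assms by (auto simp: upset_def push_keys_add[symmetric])
qed

lemma subst_vars_mideal: "p \<in> mideal M \<Longrightarrow> subst_vars g p \<in> mideal (push_keys g ` M)"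
  using supp_subst_vars_subset[of g p] unfolding mideal_def by blast

text \<open>Modulo the differences every monomial equals its substitute. As \<open>r\<close> avoids
  \<open>Z\<close>, the substitution \<open>g\<close> is idempotent and kills the differences, so
  the ideal is the full preimage of a monomial ideal.\<close>

lemma Idl_differences:
  fixes M :: "('v \<Rightarrow>\<^sub>0 nat) set"
  assumes M: "upset Y M" and Z: "Z \<subseteq> Y" "r ` Z \<subseteq> Y - Z"
  defines "g \<equiv> \<lambda>v. if v \<in> Z then r v else v"
  shows "Idl\<^bsub>poly_ring Y\<^esub> (mideal M \<union> (\<lambda>z. var (r z) - var z) ` Z) =
    {p \<in> carrier (poly_ring Y). subst_vars g p \<in> (mideal (push_keys g ` M) :: ('v, 'k::field) mpoly set)}"
    (is "Idl\<^bsub>_\<^esub> ?S = ?R")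
proof
  interpret cring "poly_ring Y :: ('v, 'k) mpoly ring" by (rule cring_poly_ring)
  have UY: "upset Y (exponents Y)" by (auto simp: upset_def exponents_def supp_add_exp)
  have varY: "(var v :: ('v, 'k) mpoly) \<in> carrier (poly_ring Y)" if "v \<in> Y" for v
    using that by (simp add: carrier_poly_ring var_mideal exponents_def)
  have gY: "g v \<in> Y" if "v \<in> Y" for v using that Z by (auto simp: g_def)
  have gg: "g (r z) = r z" if "z \<in> Z" for z using that Z by (auto simp: g_def)
  have D: "var (r z) - var z \<in> carrier (poly_ring Y :: ('v, 'k) mpoly ring)" if "z \<in> Z" for z
    using that Z varY[of z] varY[of "r z"] unfolding carrier_poly_ring by (auto intro: mideal_minus)
  have MC: "mideal M \<subseteq> carrier (poly_ring Y :: ('v, 'k) mpoly ring)"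
    using M by (auto simp: carrier_poly_ring mideal_def upset_def)
  have S: "?S \<subseteq> carrier (poly_ring Y)" using D MC by auto
  have UM: "upset (g ` Y) (push_keys g ` M)" by (rule upset_push[OF M])
  show "Idl\<^bsub>poly_ring Y\<^esub> ?S \<subseteq> ?R"
  proof (rule genideal_minimal)
    show "ideal ?R (poly_ring Y)"
    proof (rule ideal_poly_ringI)
      fix p q :: "('v, 'k) mpoly" assume p: "p \<in> ?R"
      then have pc: "p \<in> carrier (poly_ring Y)" by simp
      {
        assume "q \<in> ?R"
        then show "p + q \<in> ?R"
          using p by (auto simp: subst_vars_add mideal_add carrier_poly_ring)
      next
        assume q: "q \<in> carrier (poly_ring Y)"
        have "subst_vars g q \<in> mideal (push_keys g ` exponents Y)"
          using q unfolding carrier_poly_ring by (rule subst_vars_mideal)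
        then have "subst_vars g q \<in> mideal (exponents (g ` Y))"
          unfolding mideal_def using push_keys_exponents by blast
        then have "subst_vars g (p * q) \<in> mideal (push_keys g ` M)"
          using mideal_mult[OF UM] p by (auto simp: subst_vars_mult)
        moreover have "p * q \<in> carrier (poly_ring Y)"
          using pc q unfolding carrier_poly_ring by (rule mideal_mult[OF UY])
        ultimately show "p * q \<in> ?R" by simp
      }
    qed (auto simp: carrier_poly_ring)
    have "subst_vars g (var (r z) - var z) = (0 :: ('v, 'k) mpoly)" if "z \<in> Z" for z
      using that gg[OF that] by (simp add: subst_vars_minus g_def)
    then show "?S \<subseteq> ?R" using D MC by (auto intro: subst_vars_mideal)
  qed
  define K where "K = Idl\<^bsub>poly_ring Y\<^esub> ?S"
  have K: "ideal K (poly_ring Y)" unfolding K_def by (rule genideal_ideal[OF S])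
  have SK: "?S \<subseteq> K" unfolding K_def by (rule genideal_self[OF S])
  have Kmult: "a * b \<in> K" if "a \<in> K" "b \<in> carrier (poly_ring Y)" for a b
    using ideal.I_r_closed[OF K that] by simp
  have Kadd: "a + b \<in> K" if "a \<in> K" "b \<in> K" for a b
    using additive_subgroup.a_closed[OF ideal.axioms(1)[OF K] that] by simp
  have K0: "0 \<in> K"
    using additive_subgroup.zero_closed[OF ideal.axioms(1)[OF K]] by simp
  \<comment> \<open>Telescoping, one variable at a time.\<close>
  have mono: "monomial m - monomial (push_keys g m) \<in> K" if "m \<in> exponents Y" for m
    using that
  proof (induction m rule: exp_induct)
    case zero
    then show ?case using K0 by simp
  next
    case (add m v)
    then have m: "m \<in> exponents Y" "v \<in> Y" by (auto simp: exponents_def supp_add_exp)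
    have gm: "push_keys g m \<in> exponents Y"
      using m(1) gY by (auto simp: exponents_def keys_push_keys_nat)
    have d: "var v - var (g v) \<in> K"
    proof (cases "v \<in> Z")
      case True
      then have "var (r v) - var v \<in> ?S" by simp
      then have "var (r v) - var v \<in> K" by (rule subsetD[OF SK])
      then have "0 - (var (r v) - var v) \<in> K" by (rule ideal_minus[OF K K0])
      then show ?thesis using True by (simp add: g_def)
    next
      case False
      then show ?thesis using K0 by (simp add: g_def)
    qed
    have "(var v - var (g v)) * monomial m + (monomial m - monomial (push_keys g m)) * var (g v) \<in> K"
      using m gY by (intro Kadd Kmult d add.IH varY) (auto simp: carrier_poly_ring)
    then show ?case
      by (simp add: push_keys_add monomial_add var_eq algebra_simps)
  qed
  have single: "sgl m c - sgl (push_keys g m) c \<in> K"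
    if "m \<in> exponents Y" for m c
  proof -
    have "(monomial m - monomial (push_keys g m)) * sgl 0 c \<in> K"
      by (intro Kmult mono that) (auto simp: carrier_poly_ring mideal_def exponents_def)
    then show ?thesis by (simp add: monomial_def algebra_simps mult_single)
  qed
  show "?R \<subseteq> Idl\<^bsub>poly_ring Y\<^esub> ?S"
  proof
    fix p assume p: "p \<in> ?R"
    have "(\<Sum>m\<in>supp p. sgl m (lookup p m) - sgl (push_keys g m) (lookup p m)) \<in> K"
      using p by (intro ideal_sum[OF K] single) (auto simp: carrier_poly_ring mideal_def)
    moreover have "(\<Sum>m\<in>supp p. sgl m (lookup p m)) = p"
      using poly_mapping_eq_sum_single[of "supp p" p] by simp
    moreover have "(\<Sum>m\<in>supp p. sgl (push_keys g m) (lookup p m)) = subst_vars g p"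
      by (simp add: subst_vars_def push_keys_def[of "push_keys g"])
    ultimately have 1: "p - subst_vars g p \<in> K"
      by (simp add: sum_subtractf)
    let ?q = "subst_vars g p"
    \<comment> \<open>A term of the substitute is the image of a term with exponent in
      \<open>M\<close>; the latter is in \<open>K\<close>, and the two differ by an element of
      \<open>K\<close>.\<close>
    have "sgl k (lookup ?q k) \<in> K" if k: "k \<in> supp ?q" for k
    proof -
      obtain m where m: "m \<in> M" "k = push_keys g m"
        using p k by (auto simp: mideal_def)
      have "sgl m (lookup ?q k) \<in> K"
        using SK single_mideal[OF m(1)] by blast
      moreover have "m \<in> exponents Y" using m(1) M by (auto simp: upset_def)
      ultimately have "sgl m (lookup ?q k) -
          (sgl m (lookup ?q k) - sgl (push_keys g m) (lookup ?q k)) \<in> K"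
        by (rule ideal_minus[OF K _ single])
      then show ?thesis by (simp add: m(2))
    qed
    then have "(\<Sum>k\<in>supp ?q. sgl k (lookup ?q k)) \<in> K"
      by (rule ideal_sum[OF K])
    then have "?q \<in> K"
      using poly_mapping_eq_sum_single[of "supp ?q" ?q] by simp
    from Kadd[OF 1 this] show "p \<in> Idl\<^bsub>poly_ring Y\<^esub> ?S" by (simp add: K_def)
  qed
qed

text \<open>For an upset this says that the monomial ideal is radical: membership depends only on
  the support.\<close>

definition radical_exps :: "'v set \<Rightarrow> ('v \<Rightarrow>\<^sub>0 nat) set \<Rightarrow> bool" where
  "radical_exps V N \<longleftrightarrow> (\<forall>m\<in>N. \<forall>m'\<in>exponents V. supp m \<subseteq> supp m' \<longrightarrow> m' \<in> N)"

lemma lookup_var_mult: "lookup (var x * b) (m + unit_exp x) = lookup b m"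
proof -
  have "var x * b = var x * (\<Sum>k\<in>supp b. sgl k (lookup b k))"
    using poly_mapping_eq_sum_single[of "supp b" b] by simp
  also have "\<dots> = (\<Sum>k\<in>supp b. sgl (unit_exp x + k) (lookup b k))"
    by (simp add: sum_distrib_left var_eq monomial_def mult_single)
  finally have "lookup (var x * b) (m + unit_exp x)
      = (\<Sum>k\<in>supp b. if k = m then lookup b m else 0)"
    by (simp add: lookup_sum lookup_single when_def add.commute if_distrib cong: if_cong sum.cong)
  then show ?thesis by (simp add: sum.delta' in_keys_iff)
qed

lemma in_supp_var_mult:
  assumes "k \<in> supp (var y * b)"
  obtains m where "m \<in> supp b" "k = m + unit_exp y"
  using assms keys_mult[of "var y" b] by (auto simp: var_eq monomial_def add.commute split: if_splits)

text \<open>A key \<open>w\<close> of \<open>b\<close> outside \<open>N\<close> of maximal \<open>x\<close>-degree survives in \<open>(x - y) b\<close> as \<open>x w\<close>. As \<open>N\<close> is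
  radical, neither \<open>x\<close> nor, by symmetry, \<open>y\<close> occurs in such keys, so all of them are extremal.\<close>

lemma difference_regular:
  fixes b :: "('v, 'k::field) mpoly"
  assumes N: "upset V N" "radical_exps V N" and nzd: "nzd N x y" and xy: "x \<noteq> y" "x \<in> V" "y \<in> V"
    and b: "b \<in> mideal (exponents V)" "(var x - var y) * b \<in> mideal N"
  shows "b \<in> mideal N"
proof (rule ccontr)
  assume "b \<notin> mideal N"
  define S where "S = supp b - N"
  have S: "finite S" "S \<noteq> {}" using \<open>b \<notin> mideal N\<close> by (auto simp: S_def mideal_def)
  have top: "m + unit_exp x \<in> N"
    if b': "(var x - var y) * b \<in> mideal N" and xy: "x \<noteq> y" "y \<in> V" and m: "m \<in> S"
      and max: "\<forall>m'\<in>S. lookup m' x \<le> lookup m x" for x y m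
  proof (rule ccontr)
    assume no: "m + unit_exp x \<notin> N"
    then have "lookup ((var x - var y) * b) (m + unit_exp x) = 0"
      using b' by (auto simp: mideal_def in_keys_iff)
    then have "lookup (var y * b) (m + unit_exp x) = lookup b m"
      by (simp add: left_diff_distrib lookup_minus lookup_var_mult)
    moreover have "lookup b m \<noteq> 0" using m by (auto simp: S_def in_keys_iff)
    ultimately have "m + unit_exp x \<in> supp (var y * b)" by (simp add: in_keys_iff)
    \<comment> \<open>The term \<open>m x\<close> can only be cancelled by some \<open>m' y\<close>.
      Comparing degrees, \<open>m'\<close> has one more \<open>x\<close> than \<open>m\<close>,
      against maximality.\<close>
    then obtain m' where m': "m' \<in> supp b" "m + unit_exp x = m' + unit_exp y"
      by (rule in_supp_var_mult)
    have "m' \<notin> N" using upset_add_unit[OF N(1)] m'(2) no \<open>y \<in> V\<close> by metis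
    then have "m' \<in> S" using m' by (simp add: S_def)
    moreover have "lookup m x + 1 = lookup m' x"
      using arg_cong[OF m'(2), of "\<lambda>k. lookup k x"] xy by (simp add: lookup_add lookup_unit_exp)
    ultimately show False using max by fastforce
  qed
  have zero: "lookup m x = 0"
    if b': "(var x - var y) * b \<in> mideal N" and xy: "x \<noteq> y" "y \<in> V" and m: "m \<in> S" for x y m
  proof -
    let ?L = "(\<lambda>m. lookup m x) ` S"
    have L: "finite ?L" "?L \<noteq> {}" using S by auto
    obtain m0 where "m0 \<in> S" "lookup m0 x = Max ?L"
      using Max_in[OF L] by (metis imageE)
    then have m0: "m0 \<in> S" "\<forall>m'\<in>S. lookup m' x \<le> lookup m0 x"
      using Max_ge[OF L(1)] by auto
    have "m0 + unit_exp x \<in> N" by (rule top[OF b' xy m0])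
    moreover have "m0 \<in> exponents V" "m0 \<notin> N" using m0(1) b(1) by (auto simp: S_def mideal_def)
    ultimately have "\<not> supp (m0 + unit_exp x) \<subseteq> supp m0"
      using N(2) by (auto simp: radical_exps_def)
    then have "lookup m0 x = 0" by (auto simp: supp_add_exp in_keys_iff)
    then show ?thesis using m0(2) m by fastforce
  qed
  obtain m where m: "m \<in> S" using S by auto
  have b': "(var y - var x) * b \<in> mideal N"
    using mideal_uminus[OF b(2)] by (simp add: algebra_simps)
  have "m + unit_exp x \<in> N"
    by (rule top[OF b(2) xy(1,3) m]) (simp add: zero[OF b(2) xy(1,3)])
  moreover have "m + unit_exp y \<in> N"
    by (rule top[OF b' xy(1)[symmetric] xy(2) m]) (simp add: zero[OF b' xy(1)[symmetric] xy(2)])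
  ultimately have "m \<in> N" using nzd by (auto simp: nzd_def)
  then show False using m by (simp add: S_def)
qed

section \<open>Identifying a list of variables one after another\<close>

text \<open>The list \<open>zs\<close> gives the variables to be eliminated, in the order of the
  regular sequence, and \<open>r\<close> the variable replacing each. Replacements are never
  eliminated themselves, so each stage is the previous one followed by a single
  identification.\<close>

locale variable_merging =
  fixes Y :: "'v set" and M :: "('v \<Rightarrow>\<^sub>0 nat) set" and zs :: "'v list" and r :: "'v \<Rightarrow> 'v"
  assumes M: "upset Y M" and dist: "distinct zs" and zs: "set zs \<subseteq> Y"
    and r: "r ` set zs \<subseteq> Y - set zs"
begin

definition merge :: "nat \<Rightarrow> 'v \<Rightarrow> 'v" where
  "merge i v = (if v \<in> set (take i zs) then r v else v)"

abbreviation stage :: "nat \<Rightarrow> ('v \<Rightarrow>\<^sub>0 nat) set" where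
  "stage i \<equiv> push_keys (merge i) ` M"

lemma r_zs: "i < length zs \<Longrightarrow> r (zs ! i) \<in> Y - set zs"
  using r nth_mem[of i zs] by (metis image_eqI subsetD)

lemma merge_in: "v \<in> Y \<Longrightarrow> merge i v \<in> Y"
  using r set_take_subset[of i zs] by (auto simp: merge_def)

lemma merge_idem: "merge i (merge i v) = merge i v"
  using r set_take_subset[of i zs] by (auto simp: merge_def)

lemma merge_nth: "i < length zs \<Longrightarrow> merge i (zs ! i) = zs ! i"
proof -
  assume i: "i < length zs"
  then have "zs ! i \<in> set (drop i zs)"
    by (metis Cons_nth_drop_Suc list.set_intros(1))
  then have "zs ! i \<notin> set (take i zs)"
    using set_take_disj_set_drop_if_distinct[OF dist order_refl] by blast
  then show ?thesis by (simp add: merge_def)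
qed

lemma merge_r_nth: "i < length zs \<Longrightarrow> merge i (r (zs ! i)) = r (zs ! i)"
  using r_zs[of i] set_take_subset[of i zs] by (auto simp: merge_def)

lemma nth_neq_r: "i < length zs \<Longrightarrow> zs ! i \<noteq> r (zs ! i)"
  using r_zs[of i] nth_mem[of i zs] by auto

lemma merge_Suc:
  assumes "i < length zs"
  shows "merge (Suc i) = id(zs ! i := r (zs ! i)) \<circ> merge i"
proof
  fix v
  have t: "set (take (Suc i) zs) = insert (zs ! i) (set (take i zs))"
    using assms by (simp add: take_Suc_conv_app_nth)
  show "merge (Suc i) v = (id(zs ! i := r (zs ! i)) \<circ> merge i) v"
  proof (cases "v \<in> set (take i zs)")
    case True
    then have "v \<in> set zs" by (rule in_set_takeD)
    then have "r v \<notin> set zs" using r by auto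
    then have "r v \<noteq> zs ! i" using nth_mem[OF assms] by auto
    with True show ?thesis by (simp add: merge_def t)
  next
    case False
    then show ?thesis by (simp add: merge_def t)
  qed
qed

lemma stage_0: "stage 0 = M"
proof -
  have "merge 0 = (\<lambda>v. v)" by (auto simp: merge_def)
  then have "push_keys (merge 0) = (id :: ('v \<Rightarrow>\<^sub>0 nat) \<Rightarrow> _)" by (intro ext) (simp add: push_keys_ident)
  then show ?thesis by simp
qed

lemma stage_Suc: "i < length zs \<Longrightarrow> stage (Suc i) = push_keys (id(zs ! i := r (zs ! i))) ` stage i"
  by (simp add: merge_Suc image_image push_keys_comp)

lemma upset_stage: "upset (merge i ` Y) (stage i)"
  by (rule upset_push[OF M])

lemma stage_exponents: "stage i \<subseteq> exponents Y"
proof -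
  have "merge i ` Y \<subseteq> Y" by (rule image_subsetI) (rule merge_in)
  then have "exponents (merge i ` Y) \<subseteq> exponents Y" unfolding exponents_def by blast
  then show ?thesis using upset_stage[of i] unfolding upset_def by blast
qed

text \<open>The ideal preceding the \<open>i\<close>-th difference is not monomial, but membership
  in it is membership of the substitute in the monomial ideal of \<open>stage i\<close>.\<close>

lemma Idl_stage:
  "Idl\<^bsub>poly_ring Y\<^esub> (mideal M \<union> set (take i (map (\<lambda>z. var (r z) - var z) zs))) =
    {p \<in> carrier (poly_ring Y). subst_vars (merge i) p \<in> (mideal (stage i) :: ('v, 'k::field) mpoly set)}"
proof -
  let ?Z = "set (take i zs)"
  have Z: "?Z \<subseteq> Y" "r ` ?Z \<subseteq> Y - ?Z"
    using zs r set_take_subset[of i zs] by blast+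
  have e: "set (take i (map (\<lambda>z. var (r z) - var z) zs)) = ((\<lambda>z. var (r z) - var z) ` ?Z :: ('v, 'k) mpoly set)"
    by (simp add: take_map)
  have g: "merge i = (\<lambda>v. if v \<in> ?Z then r v else v)" by (auto simp: merge_def)
  show ?thesis unfolding e g by (rule Idl_differences[OF M Z])
qed

text \<open>Regularity is tested on the single monomial \<open>w\<close>. As \<open>w x\<close> lies
  in \<open>stage i\<close>, only surviving variables occur in \<open>w\<close>, so
  \<open>merge i\<close> fixes it.\<close>

lemma regular_imp_nzd:
  assumes reg: "regular_on_quotient (poly_ring Y) (mideal M :: ('v, 'k::field) mpoly set)
      (map (\<lambda>z. var (r z) - var z) zs)"
    and i: "i < length zs"
  shows "nzd (stage i) (r (zs ! i)) (zs ! i)"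
  unfolding nzd_def
proof (intro allI impI)
  fix w
  assume w: "w + unit_exp (r (zs ! i)) \<in> stage i" "w + unit_exp (zs ! i) \<in> stage i"
  let ?f = "var (r (zs ! i)) - var (zs ! i) :: ('v, 'k) mpoly"
  let ?m = "monomial w :: ('v, 'k) mpoly"
  have wg: "w \<in> exponents (merge i ` Y)"
    using subsetD[OF conjunct1[OF upset_stage[of i, unfolded upset_def]] w(1)]
    by (simp add: exponents_def supp_add_exp)
  have "merge i ` Y \<subseteq> Y" by (rule image_subsetI) (rule merge_in)
  with wg have wY: "w \<in> exponents Y" unfolding exponents_def by blast
  have pw: "push_keys (merge i) w = w"
    by (rule push_keys_ident) (use wg merge_idem in \<open>auto simp: exponents_def\<close>)
  have eq: "?f * ?m = monomial (w + unit_exp (r (zs ! i))) - monomial (w + unit_exp (zs ! i))"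
    by (simp add: left_diff_distrib var_eq monomial_add mult.commute[of "monomial w"])
  have C: "?m \<in> carrier (poly_ring Y)" using wY by (simp add: carrier_poly_ring)
  have "w + unit_exp (r (zs ! i)) \<in> exponents Y" "w + unit_exp (zs ! i) \<in> exponents Y"
    using w stage_exponents by blast+
  then have "?f * ?m \<in> carrier (poly_ring Y)"
    unfolding eq carrier_poly_ring by (intro mideal_minus) simp_all
  moreover have "subst_vars (merge i) (?f * ?m) \<in> mideal (stage i)"
    unfolding eq using w
    by (simp add: subst_vars_minus push_keys_add pw merge_nth[OF i] merge_r_nth[OF i] mideal_minus)
  ultimately have "?f * ?m \<in> Idl\<^bsub>poly_ring Y\<^esub> (mideal M \<union> set (take i (map (\<lambda>z. var (r z) - var z) zs)))"
    by (simp add: Idl_stage)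
  then have "?m \<in> Idl\<^bsub>poly_ring Y\<^esub> (mideal M \<union> set (take i (map (\<lambda>z. var (r z) - var z) zs)))"
    using reg i C unfolding regular_on_quotient_def by (simp del: take_map)
  then show "w \<in> stage i" by (simp add: Idl_stage pw)
qed

text \<open>An arbitrary \<open>a\<close> is replaced by its substitute in the ring on the surviving
  variables, where \<open>difference_regular\<close> applies.\<close>

lemma nzd_imp_regular:
  assumes nzd: "\<And>i. i < length zs \<Longrightarrow> nzd (stage i) (r (zs ! i)) (zs ! i)"
    and rad: "\<And>i. i < length zs \<Longrightarrow> radical_exps (merge i ` Y) (stage i)"
    and "0 \<notin> M"
  shows "regular_on_quotient (poly_ring Y) (mideal M :: ('v, 'k::field) mpoly set)
      (map (\<lambda>z. var (r z) - var z) zs)"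
  unfolding regular_on_quotient_def
proof (intro conjI allI ballI impI)
  let ?fs = "map (\<lambda>z. var (r z) - var z :: ('v, 'k) mpoly) zs"
  have varY: "(var v :: ('v, 'k) mpoly) \<in> carrier (poly_ring Y)" if "v \<in> Y" for v
    using that by (simp add: carrier_poly_ring var_mideal exponents_def)
  show "set ?fs \<subseteq> carrier (poly_ring Y)"
  proof
    fix f assume "f \<in> set ?fs"
    then obtain z where "z \<in> set zs" "f = var (r z) - var z" by auto
    then show "f \<in> carrier (poly_ring Y)"
      using varY[of z] varY[of "r z"] zs r by (auto simp: carrier_poly_ring intro!: mideal_minus)
  qed
  show "Idl\<^bsub>poly_ring Y\<^esub> (mideal M \<union> set ?fs) \<noteq> carrier (poly_ring Y)"
  proof
    assume "Idl\<^bsub>poly_ring Y\<^esub> (mideal M \<union> set ?fs) = carrier (poly_ring Y)"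
    moreover have "monomial 0 \<in> carrier (poly_ring Y :: ('v, 'k) mpoly ring)"
      by (simp add: carrier_poly_ring exponents_def)
    ultimately have "monomial 0 \<in> Idl\<^bsub>poly_ring Y\<^esub> (mideal M \<union> set (take (length zs) ?fs))" by simp
    \<comment> \<open>If the last quotient vanished, the unit monomial would come from
      \<open>M\<close>. Pushing exponents forward never empties a support, so its preimage would be
      0 as well.\<close>
    then have "0 \<in> stage (length zs)" unfolding Idl_stage by simp
    then obtain m where m: "m \<in> M" "push_keys (merge (length zs)) m = 0" by auto
    then have "supp m = {}" using keys_push_keys_nat[of "merge (length zs)" m] by simp
    then show False using m(1) \<open>0 \<notin> M\<close> by simp
  qed
  fix i a
  assume i: "i < length ?fs" and a: "a \<in> carrier (poly_ring Y)"
    and fa: "?fs ! i \<otimes>\<^bsub>poly_ring Y\<^esub> a \<in> Idl\<^bsub>poly_ring Y\<^esub> (mideal M \<union> set (take i ?fs))"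
  let ?b = "subst_vars (merge i) a"
  have i': "i < length zs" using i by simp
  have "subst_vars (merge i) ((var (r (zs ! i)) - var (zs ! i)) * a) \<in> mideal (stage i)"
    using fa i' unfolding Idl_stage by simp
  then have "(var (r (zs ! i)) - var (zs ! i)) * ?b \<in> mideal (stage i)"
    by (simp add: subst_vars_mult subst_vars_minus merge_nth[OF i'] merge_r_nth[OF i'])
  moreover have "?b \<in> mideal (exponents (merge i ` Y))"
    using subst_vars_mideal[of a "exponents Y" "merge i"] a push_keys_exponents
    unfolding carrier_poly_ring mideal_def by blast
  moreover have "r (zs ! i) \<in> merge i ` Y" "zs ! i \<in> merge i ` Y"
    using merge_nth[OF i'] merge_r_nth[OF i'] r_zs[OF i'] zs nth_mem[OF i']
    by (metis DiffD1 image_eqI subsetD)+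
  ultimately have "?b \<in> mideal (stage i)"
    using difference_regular[OF upset_stage rad[OF i'] nzd[OF i']] nth_neq_r[OF i'] by metis
  then show "a \<in> Idl\<^bsub>poly_ring Y\<^esub> (mideal M \<union> set (take i ?fs))"
    unfolding Idl_stage using a by simp
qed

text \<open>Iterating \<open>nzd_merge_min\<close>. At the last stage this gives the bijection
  between the generators of a polarization and those of its target.\<close>

lemma stage_min_exps:
  assumes nzd: "\<And>i. i < length zs \<Longrightarrow> nzd (stage i) (r (zs ! i)) (zs ! i)"
    and i: "i \<le> length zs"
  shows "min_exps (stage i) = push_keys (merge i) ` min_exps M \<and>
    (\<forall>m\<in>min_exps M. \<forall>m'\<in>min_exps M.
       exp_le (push_keys (merge i) m) (push_keys (merge i) m') \<longrightarrow> m = m')"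
  using i
proof (induction i)
  case 0
  have "merge 0 = (\<lambda>v. v)" by (auto simp: merge_def)
  then have p: "push_keys (merge 0) m = m" for m :: "'v \<Rightarrow>\<^sub>0 nat" by (simp add: push_keys_ident)
  show ?case by (auto simp: p min_exps_def)
next
  case (Suc i)
  then have i: "i < length zs" by simp
  let ?h = "id(zs ! i := r (zs ! i))"
  have IH: "min_exps (stage i) = push_keys (merge i) ` min_exps M"
    "m = m'" if "m \<in> min_exps M" "m' \<in> min_exps M" "exp_le (push_keys (merge i) m) (push_keys (merge i) m')" for m m'
    using Suc that by auto
  have IH1: "min_exps (stage i) = push_keys (merge i) ` min_exps M" using Suc by auto
  have inj: "m = m'" if "m \<in> min_exps (stage i)" "m' \<in> min_exps (stage i)"
    "exp_le (push_keys ?h m) (push_keys ?h m')" for m m'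
    using nzd_merge_min[OF upset_stage _ nth_neq_r[OF i] that] nzd[OF i] nzd_sym by metis
  have "min_exps (stage (Suc i)) = push_keys ?h ` push_keys (merge i) ` min_exps M"
    unfolding stage_Suc[OF i] IH1[symmetric] by (rule min_exps_push[OF inj])
  then have "min_exps (stage (Suc i)) = push_keys (merge (Suc i)) ` min_exps M"
    unfolding image_image push_keys_comp merge_Suc[OF i, symmetric] .
  moreover have "m = m'" if m: "m \<in> min_exps M" "m' \<in> min_exps M"
    and le: "exp_le (push_keys (merge (Suc i)) m) (push_keys (merge (Suc i)) m')" for m m'
  proof -
    have "push_keys (merge i) m = push_keys (merge i) m'"
      by (rule inj) (use m le IH1 in \<open>auto simp: merge_Suc[OF i] push_keys_comp\<close>)
    then show ?thesis using IH(2)[OF m] by simp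
  qed
  ultimately show ?case by blast
qed

text \<open>At the first stage where \<open>x\<close> and \<open>y\<close> coincide, their images
  are exactly the pair being identified, so the hypothesis applies there.
  \<open>nzd_merge_descend\<close> then carries the property back to stage 0, for pairs that are not
  themselves members of the given sequence of differences.\<close>

lemma nzd_of_merged:
  assumes nzd: "\<And>i. i < length zs \<Longrightarrow> nzd (stage i) (r (zs ! i)) (zs ! i)"
    and xy: "x \<noteq> y" "merge (length zs) x = merge (length zs) y"
  shows "nzd M x y"
proof -
  define k where "k = (LEAST k. merge k x = merge k y)"
  have k: "merge k x = merge k y" "k \<le> length zs"
    unfolding k_def using xy(2) by (auto intro: LeastI Least_le)
  have "k \<noteq> 0"
  proof
    assume "k = 0"
    with k(1) xy(1) show False by (simp add: merge_def)
  qed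
  then obtain i where i: "k = Suc i" by (cases k) auto
  then have il: "i < length zs" using k by simp
  have "merge i x \<noteq> merge i y"
    using not_less_Least[of i "\<lambda>k. merge k x = merge k y"] i k_def by simp
  with k(1) have "merge i x = zs ! i \<and> merge i y = r (zs ! i) \<or> merge i y = zs ! i \<and> merge i x = r (zs ! i)"
    unfolding i merge_Suc[OF il] by (auto split: if_splits)
  then have "nzd (stage i) (merge i x) (merge i y)"
    using nzd[OF il] nzd_sym by metis
  then have "nzd (stage 0) (merge 0 x) (merge 0 y)"
    using il
  proof (induction i)
    case (Suc j)
    then have j: "j < length zs" by simp
    have "nzd (stage j) (merge j x) (merge j y)"
    proof (rule nzd_merge_descend[OF upset_stage _ nth_neq_r[OF j]])
      show "nzd (stage j) (zs ! j) (r (zs ! j))" using nzd[OF j] nzd_sym by metis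
      show "nzd (push_keys (id(zs ! j := r (zs ! j))) ` stage j)
          ((id(zs ! j := r (zs ! j))) (merge j x)) ((id(zs ! j := r (zs ! j))) (merge j y))"
        using Suc.prems(1) unfolding stage_Suc[OF j, symmetric]
          fun_cong[OF merge_Suc[OF j], of x, unfolded o_apply]
          fun_cong[OF merge_Suc[OF j], of y, unfolded o_apply] .
    qed
    then show ?case using Suc.IH j by simp
  qed
  then show ?thesis unfolding stage_0 by (simp add: merge_def)
qed

end

section \<open>Polarizations of square-free monomial ideals\<close>

text \<open>The target enters only through the supports \<open>H\<close> of its generators, so that
  lifts of lifts are again instances. Injectivity of \<open>fst\<close> on each generator keeps its
  image square-free; the last clause is the exchange condition expressing regularity.\<close>

definition is_lift :: "'v set set \<Rightarrow> ('v \<times> nat) set \<Rightarrow> ('v \<times> nat) set set \<Rightarrow> bool" where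
  "is_lift H Y G \<longleftrightarrow> finite Y \<and> \<Union>G = Y \<and> (\<forall>\<sigma>\<in>G. inj_on fst \<sigma>) \<and> bij_betw (image fst) G H \<and>
     (\<forall>\<sigma>\<in>G. \<forall>\<tau>\<in>G. \<forall>x\<in>\<sigma>. \<forall>y\<in>\<tau>. x \<noteq> y \<longrightarrow> fst x = fst y \<longrightarrow> (\<exists>\<rho>\<in>G. \<rho> \<subseteq> \<sigma> \<union> \<tau> - {x, y}))"

lemma is_liftD:
  assumes "is_lift H Y G"
  shows "finite Y" "\<Union>G = Y" "\<sigma> \<in> G \<Longrightarrow> inj_on fst \<sigma>" "inj_on (image fst) G" "image fst ` G = H"
    "\<sigma> \<in> G \<Longrightarrow> \<tau> \<in> G \<Longrightarrow> x \<in> \<sigma> \<Longrightarrow> y \<in> \<tau> \<Longrightarrow> x \<noteq> y \<Longrightarrow> fst x = fst y \<Longrightarrow>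
      \<exists>\<rho>\<in>G. \<rho> \<subseteq> \<sigma> \<union> \<tau> - {x, y}"
  using assms unfolding is_lift_def bij_betw_def by (elim conjE, simp)+

lemma is_lift_Fpow: "is_lift H Y G \<Longrightarrow> G \<subseteq> Fpow Y"
  unfolding is_lift_def Fpow_def by (auto intro: finite_subset[OF Union_upper])

lemma is_lift_antichain:
  assumes "is_lift H Y G" "antichain H"
  shows "antichain G"
  unfolding antichain_def
proof (intro ballI impI)
  fix \<sigma> \<tau> assume st: "\<sigma> \<in> G" "\<tau> \<in> G" "\<sigma> \<subseteq> \<tau>"
  have b: "bij_betw (image fst) G H" using assms(1) by (simp add: is_lift_def)
  then have "fst ` \<sigma> \<in> H" "fst ` \<tau> \<in> H" using st by (auto simp: bij_betw_def)
  with st(3) assms(2) have "fst ` \<sigma> = fst ` \<tau>" by (simp add: antichain_def image_mono)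
  then show "\<sigma> = \<tau>" using b st by (auto simp: bij_betw_def inj_on_def)
qed

lemma radical_sq_exps: "radical_exps V (sq_exps V \<Sigma>)"
  by (auto simp: radical_exps_def sq_exps_def exponents_def) (meson order.trans)

lemma nzd_sq_exps:
  assumes "\<And>\<sigma> \<tau>. \<sigma> \<in> \<Sigma> \<Longrightarrow> \<tau> \<in> \<Sigma> \<Longrightarrow> x \<in> \<sigma> \<Longrightarrow> y \<in> \<tau> \<Longrightarrow> \<exists>\<rho>\<in>\<Sigma>. \<rho> \<subseteq> \<sigma> \<union> \<tau> - {x, y}"
  shows "nzd (sq_exps V \<Sigma>) x y"
  unfolding nzd_def
proof (intro allI impI)
  fix w assume "w + unit_exp x \<in> sq_exps V \<Sigma>" "w + unit_exp y \<in> sq_exps V \<Sigma>"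
  then obtain \<sigma> \<tau> where st: "supp w \<subseteq> V" "\<sigma> \<in> \<Sigma>" "\<tau> \<in> \<Sigma>" "\<sigma> \<subseteq> insert x (supp w)" "\<tau> \<subseteq> insert y (supp w)"
    by (auto simp: sq_exps_def supp_add_exp)
  consider "x \<notin> \<sigma>" | "y \<notin> \<tau>" | "x \<in> \<sigma>" "y \<in> \<tau>" by blast
  then have "\<exists>\<rho>\<in>\<Sigma>. \<rho> \<subseteq> supp w"
  proof cases
    case 3
    then obtain \<rho> where "\<rho> \<in> \<Sigma>" "\<rho> \<subseteq> \<sigma> \<union> \<tau> - {x, y}" using assms st by metis
    moreover have "\<sigma> \<union> \<tau> - {x, y} \<subseteq> supp w" using st by auto
    ultimately show ?thesis by blast
  qed (use st in \<open>auto simp: subset_insert\<close>)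
  then show "w \<in> sq_exps V \<Sigma>" using st(1) by (simp add: sq_exps_def)
qed

lemma nzd_sq_expsD:
  assumes nzd: "nzd (sq_exps V \<Sigma>) x y" and \<Sigma>: "\<Sigma> \<subseteq> Fpow V"
    and st: "\<sigma> \<in> \<Sigma>" "\<tau> \<in> \<Sigma>" "x \<in> \<sigma>" "y \<in> \<tau>" "y \<notin> \<sigma>" "x \<notin> \<tau>"
  shows "\<exists>\<rho>\<in>\<Sigma>. \<rho> \<subseteq> \<sigma> \<union> \<tau> - {x, y}"
proof -
  \<comment> \<open>The smallest \<open>w\<close> for which \<open>\<sigma>\<close> divides
    \<open>x w\<close> and \<open>\<tau>\<close> divides \<open>y w\<close>.\<close>
  let ?w = "ind_exp (\<sigma> \<union> \<tau> - {x, y})"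
  have fin: "finite \<sigma>" "finite \<tau>" "\<sigma> \<subseteq> V" "\<tau> \<subseteq> V" using \<Sigma> st by (auto simp: Fpow_def)
  have w: "supp ?w = \<sigma> \<union> \<tau> - {x, y}" using fin by simp
  have "?w + unit_exp x \<in> sq_exps V \<Sigma>"
    unfolding sq_exps_def mem_Collect_eq supp_add_exp w using st fin
    by (intro conjI bexI[of _ \<sigma>]) auto
  moreover have "?w + unit_exp y \<in> sq_exps V \<Sigma>"
    unfolding sq_exps_def mem_Collect_eq supp_add_exp w using st fin
    by (intro conjI bexI[of _ \<tau>]) auto
  ultimately have "?w \<in> sq_exps V \<Sigma>" using nzd unfolding nzd_def by blast
  then show ?thesis unfolding sq_exps_def mem_Collect_eq w by blast
qed

lemma push_ind_exp:
  assumes "inj_on g \<sigma>"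
  shows "push_keys g (ind_exp \<sigma>) = ind_exp (g ` \<sigma>)"
  using assms by (simp add: ind_exp_def push_keys_sum sum.reindex)

text \<open>Injectivity on every generator guarantees that no square appears after the
  substitution.\<close>

lemma push_sq_exps:
  assumes "G \<subseteq> Fpow Y" "\<And>\<sigma>. \<sigma> \<in> G \<Longrightarrow> inj_on g \<sigma>"
  shows "push_keys g ` sq_exps Y G = sq_exps (g ` Y) (image g ` G)"
proof (intro subset_antisym subsetI)
  fix k assume "k \<in> push_keys g ` sq_exps Y G"
  then obtain m \<sigma> where "k = push_keys g m" "supp m \<subseteq> Y" "\<sigma> \<in> G" "\<sigma> \<subseteq> supp m"
    by (auto simp: sq_exps_def)
  then show "k \<in> sq_exps (g ` Y) (image g ` G)"
    by (auto simp: sq_exps_def keys_push_keys_nat intro!: bexI[of _ \<sigma>])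
next
  fix k assume "k \<in> sq_exps (g ` Y) (image g ` G)"
  then obtain \<sigma> where s: "supp k \<subseteq> g ` Y" "\<sigma> \<in> G" "g ` \<sigma> \<subseteq> supp k"
    by (auto simp: sq_exps_def)
  have fin: "finite \<sigma>" "\<sigma> \<subseteq> Y" using s(2) assms(1) by (auto simp: Fpow_def)
  obtain d where d: "k = ind_exp (g ` \<sigma>) + d"
    using exp_le_imp_add[OF ind_exp_le[OF _ s(3)]] fin by blast
  have "d \<in> exponents (g ` Y)" using s(1) d by (simp add: exponents_def supp_add_exp)
  then obtain d' where d': "d' \<in> exponents Y" "push_keys g d' = d" by (rule push_keys_surj)
  have "ind_exp \<sigma> + d' \<in> sq_exps Y G"
    using fin s(2) d'(1) by (auto simp: sq_exps_def supp_add_exp exponents_def intro!: bexI[of _ \<sigma>])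
  moreover have "push_keys g (ind_exp \<sigma> + d') = k"
    by (simp add: push_keys_add push_ind_exp[OF assms(2)[OF s(2)]] d' d)
  ultimately show "k \<in> push_keys g ` sq_exps Y G" by blast
qed

lemma zero_sq_exps: "0 \<in> sq_exps V \<Sigma> \<longleftrightarrow> {} \<in> \<Sigma>"
  by (auto simp: sq_exps_def)

lemma Idl_subst_fst:
  assumes "upset Y M" "fst ` Y \<subseteq> X"
  shows "Idl\<^bsub>poly_ring X\<^esub> (subst_vars fst ` (mideal M :: ('v \<times> nat, 'k::field) mpoly set)) =
    mideal (up X (push_keys fst ` M))"
proof (rule Idl_eq_mideal)
  have "push_keys fst ` M \<subseteq> exponents (fst ` Y)"
    using upset_push[OF assms(1), of fst] by (simp add: upset_def)
  also have "\<dots> \<subseteq> exponents X" using assms(2) unfolding exponents_def by blast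
  finally show "push_keys fst ` M \<subseteq> exponents X" .
  show "monomial ` push_keys fst ` M \<subseteq> subst_vars fst ` (mideal M :: ('v \<times> nat, 'k) mpoly set)"
  proof (intro subsetI, elim imageE)
    fix p :: "('v, 'k) mpoly" and k m
    assume "p = monomial k" "k = push_keys fst m" "m \<in> M"
    then show "p \<in> subst_vars fst ` (mideal M :: ('v \<times> nat, 'k) mpoly set)"
      by (intro image_eqI[of _ _ "monomial m"]) simp_all
  qed
  show "subst_vars fst ` (mideal M :: ('v \<times> nat, 'k) mpoly set) \<subseteq> mideal (up X (push_keys fst ` M))"
    using subst_vars_mideal[of _ M fst] up_self[of "push_keys fst ` M" X]
    unfolding mideal_def by blast
qed

lemma variable_merging_copies:
  assumes M: "upset Y M" and c: "\<And>x. x \<in> fst ` Y \<Longrightarrow> (x, c x) \<in> Y"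
    and ys: "distinct ys" "set ys = {(x, j). (x, j) \<in> Y \<and> j \<noteq> c x}"
  shows "variable_merging Y M ys (\<lambda>z. (fst z, c (fst z)))"
proof
  show "(\<lambda>z. (fst z, c (fst z))) ` set ys \<subseteq> Y - set ys"
    using c ys(2) by force
qed (use assms in auto)

text \<open>The exchange condition survives every partial identification, so each stage is again
  square-free and satisfies \<open>nzd\<close>. Any copy of \<open>x\<close> may serve as the fixed
  one.\<close>

lemma polarization_of_lift:
  fixes X :: "'v set"
  assumes lift: "is_lift H Y G" and H: "H \<subseteq> Fpow X" "antichain H" "{} \<notin> H"
  shows "polarization X (sq_ideal X H :: ('v, 'k::field) mpoly set) Y (sq_ideal Y G)"
proof -
  note fin = is_liftD(1)[OF lift] and UG = is_liftD(2)[OF lift] and inj = is_liftD(3)[OF lift]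
    and ex = is_liftD(6)[OF lift]
  have G: "G \<subseteq> Fpow Y" "antichain G"
    using is_lift_Fpow[OF lift] is_lift_antichain[OF lift H(2)] .
  note GH = is_liftD(5)[OF lift]
  have HX: "\<Union>H \<subseteq> X" using H(1) by (auto simp: Fpow_def)
  have YX: "fst ` Y \<subseteq> X" unfolding UG[symmetric] image_Union using GH HX by blast
  have G0: "{} \<notin> G" using GH H(3) by (metis image_empty image_eqI)
  define c where "c x = (SOME j. (x, j) \<in> Y)" for x
  have c: "(x, c x) \<in> Y" if "x \<in> fst ` Y" for x
    unfolding c_def using that by (metis (no_types, lifting) imageE prod.collapse someI_ex)
  have "finite {(x, j). (x, j) \<in> Y \<and> j \<noteq> c x}"
    by (rule finite_subset[OF _ fin]) auto
  then obtain ys where ys: "distinct ys" "set ys = {(x, j). (x, j) \<in> Y \<and> j \<noteq> c x}"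
    using finite_distinct_list[of "{(x, j). (x, j) \<in> Y \<and> j \<noteq> c x}"] by blast
  let ?r = "\<lambda>z. (fst z, c (fst z))"
  interpret variable_merging Y "sq_exps Y G" ys ?r
    by (rule variable_merging_copies[OF upset_sq_exps c ys])
  have fst_merge: "fst (merge i v) = fst v" for i v by (simp add: merge_def)
  have injm: "inj_on (merge i) \<sigma>" if "\<sigma> \<in> G" for i \<sigma>
    using inj[OF that] by (metis (no_types, lifting) fst_merge inj_on_def)
  have stage: "stage i = sq_exps (merge i ` Y) (image (merge i) ` G)" for i
    by (rule push_sq_exps[OF G(1) injm])
  have "regular_on_quotient (poly_ring Y) (mideal (sq_exps Y G) :: (_, 'k) mpoly set)
      (map (\<lambda>z. var (?r z) - var z) ys)"
  proof (rule nzd_imp_regular)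
    show "0 \<notin> sq_exps Y G" using G0 by (simp add: zero_sq_exps)
    fix i assume i: "i < length ys"
    show "radical_exps (merge i ` Y) (stage i)" unfolding stage by (rule radical_sq_exps)
    show "nzd (stage i) (?r (ys ! i)) (ys ! i)"
      unfolding stage
    proof (rule nzd_sq_exps)
      let ?x = "?r (ys ! i)" and ?y = "ys ! i"
      fix \<sigma>' \<tau>' assume st': "\<sigma>' \<in> image (merge i) ` G" "\<tau>' \<in> image (merge i) ` G"
        and xy: "?x \<in> \<sigma>'" "?y \<in> \<tau>'"
      obtain \<sigma> where s: "\<sigma> \<in> G" "\<sigma>' = merge i ` \<sigma>" using st'(1) by (rule imageE) simp
      obtain \<tau> where t: "\<tau> \<in> G" "\<tau>' = merge i ` \<tau>" using st'(2) by (rule imageE) simp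
      obtain x where x: "?x = merge i x" "x \<in> \<sigma>" using xy(1) unfolding s(2) by (rule imageE)
      obtain y where y: "?y = merge i y" "y \<in> \<tau>" using xy(2) unfolding t(2) by (rule imageE)
      note st = s(1) t(1) s(2) t(2) x(2) x(1)[symmetric] y(2) y(1)[symmetric]
      have f1: "fst x = fst ?y" using arg_cong[OF st(6), of fst] by (simp only: fst_merge fst_conv)
      have f2: "fst y = fst ?y" using arg_cong[OF st(8), of fst] by (simp only: fst_merge)
      have f: "fst x = fst y" using f1 f2 by simp
      have "x \<noteq> y" using st(6,8) nth_neq_r[OF i] by auto
      then obtain \<rho> where \<rho>: "\<rho> \<in> G" "\<rho> \<subseteq> \<sigma> \<union> \<tau> - {x, y}" using ex[OF st(1,2,5,7)] f by blast
      \<comment> \<open>A generator contains at most one copy of each variable. A further copy of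
        the variable of \<open>x\<close> in \<open>\<rho>\<close> would thus be \<open>x\<close> or
        \<open>y\<close> itself, and both were removed.\<close>
      have no: "merge i v \<noteq> ?x \<and> merge i v \<noteq> ?y" if "v \<in> \<rho>" for v
      proof (rule ccontr)
        assume "\<not> ?thesis"
        then have "fst (merge i v) = fst ?y" by auto
        then have "fst v = fst x" "fst v = fst y" by (simp_all only: fst_merge f1 f2)
        moreover have "v \<in> \<sigma> \<or> v \<in> \<tau>" "v \<noteq> x" "v \<noteq> y" using that \<rho>(2) by auto
        ultimately show False
          using inj_onD[OF inj[OF st(1)], of v x] inj_onD[OF inj[OF st(2)], of v y] st(5,7) by blast
      qed
      have "merge i ` \<rho> \<subseteq> \<sigma>' \<union> \<tau>' - {?x, ?y}"
      proof (rule image_subsetI)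
        fix v assume v: "v \<in> \<rho>"
        then have "v \<in> \<sigma> \<or> v \<in> \<tau>" using \<rho>(2) by auto
        then show "merge i v \<in> \<sigma>' \<union> \<tau>' - {?x, ?y}" using no[OF v] unfolding st(3,4) by auto
      qed
      then show "\<exists>\<rho>'\<in>image (merge i) ` G. \<rho>' \<subseteq> \<sigma>' \<union> \<tau>' - {?x, ?y}"
        using imageI[OF \<rho>(1)] by (rule rev_bexI[rotated])
    qed
  qed
  then have reg: "regular_on_quotient (poly_ring Y) (sq_ideal Y G :: (_, 'k) mpoly set)
      (map (\<lambda>(x, j). var (x, c x) - var (x, j)) ys)"
    by (simp add: sq_ideal_eq[OF G(1)] case_prod_beta' del: map_map)
  have e: "push_keys fst ` sq_exps Y G = sq_exps (fst ` Y) H"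
    using push_sq_exps[of G Y fst] G(1) inj unfolding GH by blast
  have "H \<subseteq> Fpow (fst ` Y)"
    unfolding GH[symmetric] using G(1) by (auto simp: Fpow_def)
  then have "up X (push_keys fst ` sq_exps Y G) = sq_exps X H"
    unfolding e by (rule up_sq_exps[OF YX])
  then have "Idl\<^bsub>poly_ring X\<^esub> (subst_vars fst ` (sq_ideal Y G :: (_, 'k) mpoly set)) = sq_ideal X H"
    by (simp add: sq_ideal_eq[OF G(1)] sq_ideal_eq[OF H(1)] Idl_subst_fst[OF upset_sq_exps YX])
  moreover have "sqfree_monomial_ideal Y (sq_ideal Y G :: (_, 'k) mpoly set)"
    using G(1) by (auto simp: sqfree_monomial_ideal_def)
  moreover have "used_vars (sq_ideal Y G :: (_, 'k) mpoly set) = Y"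
    using used_vars_sq_ideal[OF G] UG by metis
  ultimately show ?thesis
    unfolding polarization_def using fin YX c ys reg by blast
qed

text \<open>Regularity yields \<open>nzd\<close> only stage by stage. All copies of a variable end
  up at the fixed one, so \<open>nzd_of_merged\<close> gives the exchange condition for every pair
  of copies.\<close>

lemma lift_of_polarization:
  fixes X :: "'v set"
  assumes pol: "polarization X (sq_ideal X H :: ('v, 'k::field) mpoly set) Y I"
    and H: "H \<subseteq> Fpow X" "antichain H"
  obtains G where "is_lift H Y G" "I = sq_ideal Y G"
proof -
  obtain c ys where fin: "finite Y" and YX: "fst ` Y \<subseteq> X" and sq: "sqfree_monomial_ideal Y I"
    and used: "used_vars I = Y" and c0: "\<forall>x\<in>fst ` Y. (x, c x) \<in> Y"
    and ys: "distinct ys" "set ys = {(x, j). (x, j) \<in> Y \<and> j \<noteq> c x}"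
    and reg: "regular_on_quotient (poly_ring Y) I (map (\<lambda>(x, j). var (x, c x) - var (x, j)) ys)"
    and Idl: "Idl\<^bsub>poly_ring X\<^esub> (subst_vars fst ` I) = sq_ideal X H"
    using pol unfolding polarization_def by (elim conjE exE)
  have c: "(x, c x) \<in> Y" if "x \<in> fst ` Y" for x using c0 that by (rule bspec)
  obtain G where G: "G \<subseteq> Fpow Y" "antichain G" and I: "I = sq_ideal Y G"
    using sqfree_monomial_ideal_antichain[OF sq fin] .
  have UG: "\<Union>G = Y" using used unfolding I used_vars_sq_ideal[OF G] .
  have finG: "finite \<sigma>" if "\<sigma> \<in> G" for \<sigma> using that G(1) by (auto simp: Fpow_def)
  let ?r = "\<lambda>z. (fst z, c (fst z))"
  interpret variable_merging Y "sq_exps Y G" ys ?r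
    by (rule variable_merging_copies[OF upset_sq_exps c ys])
  have nzd: "nzd (stage i) (?r (ys ! i)) (ys ! i)" if "i < length ys" for i
  proof (rule regular_imp_nzd[OF _ that])
    show "regular_on_quotient (poly_ring Y) (mideal (sq_exps Y G) :: (_, 'k) mpoly set)
        (map (\<lambda>z. var (?r z) - var z) ys)"
      using reg unfolding I sq_ideal_eq[OF G(1)] by (simp add: case_prod_beta')
  qed
  let ?L = "length ys"
  have merge_eq: "merge ?L v = (fst v, c (fst v))" if "v \<in> Y" for v
    using that ys(2) by (cases v) (auto simp: merge_def)
  have minM: "min_exps (sq_exps Y G) = ind_exp ` G" by (rule min_exps_sq_exps[OF G])
  have suppM: "supp (ind_exp \<sigma>) \<subseteq> Y" if "\<sigma> \<in> G" for \<sigma>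
    using that G(1) supp_ind_exp[OF finG[OF that]] by (auto simp: Fpow_def)
  \<comment> \<open>The final identification factors as \<open>fst\<close> followed by the section
    \<open>x\<close> to \<open>(x, c x)\<close>, so comparability after forgetting copies is
    comparability at the last stage.\<close>
  have inj: "m = m'" if m: "m \<in> min_exps (sq_exps Y G)" "m' \<in> min_exps (sq_exps Y G)"
    and le: "exp_le (push_keys fst m) (push_keys fst m')" for m m'
  proof -
    have "push_keys (merge ?L) k = push_keys (\<lambda>x. (x, c x)) (push_keys fst k)"
      if km: "k \<in> min_exps (sq_exps Y G)" for k
      unfolding push_keys_comp
    proof (rule push_keys_cong)
      fix v assume v: "v \<in> supp k"
      obtain \<sigma> where "\<sigma> \<in> G" "k = ind_exp \<sigma>" using km unfolding minM by (rule imageE) simp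
      then have "v \<in> Y" using v suppM by (auto simp del: supp_ind_exp)
      then show "merge ?L v = ((\<lambda>x. (x, c x)) \<circ> fst) v" by (simp add: merge_eq)
    qed
    then have "exp_le (push_keys (merge ?L) m) (push_keys (merge ?L) m')"
      using exp_le_push[OF le, of "\<lambda>x. (x, c x)"] m by simp
    then show ?thesis using stage_min_exps[OF nzd, of ?L] m by blast
  qed
  have pM: "push_keys fst ` sq_exps Y G \<subseteq> exponents X"
    using upset_push[OF upset_sq_exps, of fst Y G] YX
    unfolding upset_def exponents_def by (auto dest!: subsetD)
  have "mideal (up X (push_keys fst ` sq_exps Y G)) = (mideal (sq_exps X H) :: ('v, 'k) mpoly set)"
    using Idl unfolding I sq_ideal_eq[OF G(1)] sq_ideal_eq[OF H(1)] Idl_subst_fst[OF upset_sq_exps YX] .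
  then have "min_exps (up X (push_keys fst ` sq_exps Y G)) = min_exps (sq_exps X H)"
    by (simp add: mideal_inject)
  moreover have "min_exps (push_keys fst ` sq_exps Y G) = push_keys fst ` min_exps (sq_exps Y G)"
    by (rule min_exps_push) (rule inj)
  ultimately have pmin: "push_keys fst ` ind_exp ` G = ind_exp ` H"
    unfolding min_exps_up[OF pM] minM min_exps_sq_exps[OF H] by simp
  have pi: "\<exists>\<eta>\<in>H. push_keys fst (ind_exp \<sigma>) = ind_exp \<eta> \<and> fst ` \<sigma> = \<eta>" if s: "\<sigma> \<in> G" for \<sigma>
  proof -
    have "push_keys fst (ind_exp \<sigma>) \<in> ind_exp ` H" unfolding pmin[symmetric] using s by blast
    then obtain \<eta> where \<eta>: "\<eta> \<in> H" "push_keys fst (ind_exp \<sigma>) = ind_exp \<eta>" by blast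
    moreover have "finite \<eta>" using \<eta>(1) H(1) by (auto simp: Fpow_def)
    ultimately have "fst ` \<sigma> = \<eta>"
      using keys_push_keys_nat[of fst "ind_exp \<sigma>"] finG[OF s] by simp
    with \<eta> show ?thesis by blast
  qed
  \<comment> \<open>Two copies of a variable in one generator would give exponent at least 2 in a
    square-free generator of the target.\<close>
  have injs: "inj_on fst \<sigma>" if s: "\<sigma> \<in> G" for \<sigma>
  proof (rule inj_onI, rule ccontr)
    fix x y assume xy: "x \<in> \<sigma>" "y \<in> \<sigma>" "fst x = fst y" "x \<noteq> y"
    obtain \<eta> where \<eta>: "\<eta> \<in> H" "push_keys fst (ind_exp \<sigma>) = ind_exp \<eta>" using pi[OF s] by blast
    then have "finite \<eta>" using H(1) by (auto simp: Fpow_def)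
    then have "lookup (push_keys fst (ind_exp \<sigma>)) (fst x) \<le> 1" by (simp add: \<eta> lookup_ind_exp)
    moreover have "(\<Sum>k\<in>{x, y}. lookup (ind_exp \<sigma>) k) \<le> lookup (push_keys fst (ind_exp \<sigma>)) (fst x)"
      unfolding lookup_push_keys using xy finG[OF s] by (intro sum_mono2) auto
    ultimately show False using xy finG[OF s] by (simp add: lookup_ind_exp)
  qed
  have "image fst ` G = H"
  proof (intro subset_antisym subsetI)
    fix \<eta> assume "\<eta> \<in> H"
    then have "ind_exp \<eta> \<in> push_keys fst ` ind_exp ` G" unfolding pmin by blast
    then obtain \<sigma> where s: "\<sigma> \<in> G" "ind_exp \<eta> = push_keys fst (ind_exp \<sigma>)" by blast
    moreover have "finite \<eta>" using \<open>\<eta> \<in> H\<close> H(1) by (auto simp: Fpow_def)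
    ultimately have "\<eta> = fst ` \<sigma>"
      using keys_push_keys_nat[of fst "ind_exp \<sigma>"] finG by (metis supp_ind_exp)
    then show "\<eta> \<in> image fst ` G" using s by blast
  qed (use pi in blast)
  moreover have "inj_on (image fst) G"
  proof (rule inj_onI)
    fix \<sigma> \<tau> assume st: "\<sigma> \<in> G" "\<tau> \<in> G" "fst ` \<sigma> = fst ` \<tau>"
    then have "push_keys fst (ind_exp \<sigma>) = push_keys fst (ind_exp \<tau>)"
      using pi by metis
    then have "ind_exp \<sigma> = ind_exp \<tau>" using inj st minM by simp
    then show "\<sigma> = \<tau>" using inj_on_ind_exp[OF G(1)] st by (simp add: inj_on_def)
  qed
  moreover have "\<exists>\<rho>\<in>G. \<rho> \<subseteq> \<sigma> \<union> \<tau> - {x, y}"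
    if st: "\<sigma> \<in> G" "\<tau> \<in> G" "x \<in> \<sigma>" "y \<in> \<tau>" and xy: "x \<noteq> y" "fst x = fst y" for \<sigma> \<tau> x y
  proof (rule nzd_sq_expsD[OF _ G(1) st])
    have "x \<in> Y" "y \<in> Y" using st UG by auto
    then show "nzd (sq_exps Y G) x y"
      using nzd_of_merged[OF nzd xy(1)] xy(2) merge_eq by simp
    show "y \<notin> \<sigma>" using injs[OF st(1)] st(3) xy by (auto dest: inj_onD)
    show "x \<notin> \<tau>" using injs[OF st(2)] st(4) xy by (auto dest: inj_onD)
  qed
  ultimately have "is_lift H Y G"
    unfolding is_lift_def bij_betw_def using fin UG injs by blast
  then show ?thesis using that I by blast
qed

lemma maximal_polarized_iff:
  assumes "H \<subseteq> Fpow X" "antichain H" "{} \<notin> H"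
  shows "maximal_polarized X (sq_ideal X H :: ('v, 'k::field) mpoly set) \<longleftrightarrow>
    (\<forall>Y G. is_lift H Y G \<longrightarrow> inj_on fst Y)"
  unfolding maximal_polarized_def
  using polarization_of_lift[OF _ assms] lift_of_polarization[OF _ assms(1,2)] by metis

section \<open>Renaming copies\<close>

lemma subst_vars_cong:
  assumes "p \<in> mideal (exponents V)" "\<And>v. v \<in> V \<Longrightarrow> f v = g v"
  shows "subst_vars f p = subst_vars g p"
  unfolding subst_vars_def
proof (rule push_keys_cong, rule push_keys_cong)
  fix m v assume "m \<in> supp p" "v \<in> supp m"
  then have "v \<in> V" using assms(1) unfolding mideal_def exponents_def by auto
  then show "f v = g v" by (rule assms(2))
qed

lemma subst_vars_id: "subst_vars (\<lambda>v. v) p = p"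
proof -
  have "push_keys (\<lambda>v. v) m = m" for m :: "'v \<Rightarrow>\<^sub>0 nat" by (rule push_keys_ident) simp
  then show ?thesis unfolding subst_vars_def by (intro push_keys_ident) simp
qed

lemma subst_vars_rename_mideal:
  assumes N: "N \<subseteq> exponents Y" and r: "inj_on r Y"
  shows "subst_vars r ` mideal N = mideal (push_keys r ` N)"
proof (intro subset_antisym subsetI)
  fix q assume "q \<in> subst_vars r ` mideal N"
  then show "q \<in> mideal (push_keys r ` N)" by (auto intro: subst_vars_mideal)
next
  fix q assume q: "q \<in> mideal (push_keys r ` N)"
  let ?s = "inv_into Y r"
  have "push_keys ?s (push_keys r m) = m" if "m \<in> N" for m
    unfolding push_keys_comp
    by (rule push_keys_ident) (use that N r in \<open>auto simp: exponents_def subset_iff\<close>)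
  then have "push_keys ?s ` push_keys r ` N = N" by (auto simp: image_image)
  then have s: "subst_vars ?s q \<in> mideal N"
    using subst_vars_mideal[OF q, of ?s] by simp
  have "push_keys r ` N \<subseteq> exponents (r ` Y)" using N push_keys_exponents by blast
  then have "q \<in> mideal (exponents (r ` Y))" using q unfolding mideal_def by blast
  then have "subst_vars (r \<circ> ?s) q = subst_vars (\<lambda>v. v) q"
    by (rule subst_vars_cong) (simp add: f_inv_into_f)
  then have "subst_vars r (subst_vars ?s q) = q" by (simp add: subst_vars_comp subst_vars_id)
  with s show "q \<in> subst_vars r ` mideal N" by (metis imageI)
qed

lemma subst_vars_sq_ideal:
  assumes G: "G \<subseteq> Fpow Y" and r: "inj_on r Y"
  shows "subst_vars r ` (sq_ideal Y G :: ('v, 'k::field) mpoly set) = sq_ideal (r ` Y) (image r ` G)"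
proof -
  have "image r ` G \<subseteq> Fpow (r ` Y)" using G by (auto simp: Fpow_def)
  moreover have "push_keys r ` sq_exps Y G = sq_exps (r ` Y) (image r ` G)"
    using G by (intro push_sq_exps inj_on_subset[OF r]) (auto simp: Fpow_def)
  moreover have "sq_exps Y G \<subseteq> exponents Y" using upset_sq_exps[of Y G] by (simp add: upset_def)
  ultimately show ?thesis
    by (simp add: sq_ideal_eq G subst_vars_rename_mideal[OF _ r])
qed

lemma copy_renamingI:
  assumes "bij_betw r Y Y'" "\<And>y. y \<in> Y \<Longrightarrow> fst (r y) = fst y" "I' = subst_vars r ` I"
  shows "((Y, I), (Y', I')) \<in> copy_renaming"
  using assms unfolding copy_renaming_def by blast

lemma copy_renamingE:
  assumes "((Y, I), (Y', I')) \<in> copy_renaming"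
  obtains r where "bij_betw r Y Y'" "\<And>y. y \<in> Y \<Longrightarrow> fst (r y) = fst y" "I' = subst_vars r ` I"
  using assms unfolding copy_renaming_def by blast

lemma copy_renaming_refl: "((Y, I), (Y, I)) \<in> copy_renaming"
  by (rule copy_renamingI[of "\<lambda>v. v"]) (auto simp: subst_vars_id bij_betw_def)

text \<open>The renaming is controlled only on \<open>Y\<close>, so inverting it takes an ideal of
  the ring on \<open>Y\<close>.\<close>

lemma copy_renaming_sym:
  assumes I: "I \<subseteq> mideal (exponents Y)" and rn: "((Y, I), (Y', I')) \<in> copy_renaming"
  shows "((Y', I'), (Y, I)) \<in> copy_renaming"
proof -
  obtain r where r: "bij_betw r Y Y'" "\<And>y. y \<in> Y \<Longrightarrow> fst (r y) = fst y" "I' = subst_vars r ` I"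
    using rn by (rule copy_renamingE) blast
  let ?s = "inv_into Y r"
  have s: "?s y \<in> Y" "r (?s y) = y" if "y \<in> Y'" for y
    using r(1) that by (auto simp: bij_betw_def inv_into_into f_inv_into_f)
  show ?thesis
  proof (rule copy_renamingI)
    show "bij_betw ?s Y' Y" using r(1) by (rule bij_betw_inv_into)
    show "fst (?s y) = fst y" if "y \<in> Y'" for y
      using r(2)[OF s(1)[OF that]] s(2)[OF that] by simp
    have "subst_vars ?s (subst_vars r p) = p" if "p \<in> I" for p
    proof -
      have "subst_vars (?s \<circ> r) p = subst_vars (\<lambda>v. v) p"
        by (rule subst_vars_cong[of p Y]) (use that I r(1) in \<open>auto simp: bij_betw_def\<close>)
      then show ?thesis by (simp add: subst_vars_comp subst_vars_id)
    qed
    then show "I = subst_vars ?s ` I'" by (simp add: r(3) image_image)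
  qed
qed

lemma copy_renaming_trans:
  assumes "(a, b) \<in> copy_renaming" "(b, c) \<in> copy_renaming"
  shows "(a, c) \<in> copy_renaming"
proof -
  obtain Y I Y' I' Y'' I'' where e: "a = (Y, I)" "b = (Y', I')" "c = (Y'', I'')"
    by (metis surj_pair)
  obtain r where r: "bij_betw r Y Y'" "\<And>y. y \<in> Y \<Longrightarrow> fst (r y) = fst y" "I' = subst_vars r ` I"
    using assms(1) unfolding e by (rule copy_renamingE) blast
  obtain s where s: "bij_betw s Y' Y''" "\<And>y. y \<in> Y' \<Longrightarrow> fst (s y) = fst y" "I'' = subst_vars s ` I'"
    using assms(2) unfolding e by (rule copy_renamingE) blast
  show ?thesis unfolding e
  proof (rule copy_renamingI)
    show "bij_betw (s \<circ> r) Y Y''" using bij_betw_trans[OF r(1) s(1)] .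
    show "fst ((s \<circ> r) y) = fst y" if "y \<in> Y" for y
      using r(2)[OF that] s(2)[OF bij_betwE[OF r(1), rule_format, OF that]] by simp
    show "I'' = subst_vars (s \<circ> r) ` I"
      by (simp add: r(3) s(3) image_image subst_vars_comp)
  qed
qed

lemma copy_renaming_class_eq:
  assumes I: "I \<subseteq> mideal (exponents Y)" and rn: "((Y, I), b) \<in> copy_renaming"
  shows "copy_renaming `` {(Y, I)} = copy_renaming `` {b}"
proof -
  obtain Y' I' where b: "b = (Y', I')" by (rule prod.exhaust)
  have "(b, (Y, I)) \<in> copy_renaming" using copy_renaming_sym[OF I] rn b by blast
  then show ?thesis using rn copy_renaming_trans by (auto intro: copy_renaming_trans)
qed

lemma copy_renaming_sq_ideal_iff:
  assumes G: "G \<subseteq> Fpow Y" "antichain G" and G': "G' \<subseteq> Fpow Y'" "antichain G'"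
  shows "((Y, sq_ideal Y G :: ('v \<times> nat, 'k::field) mpoly set), (Y', sq_ideal Y' G')) \<in> copy_renaming \<longleftrightarrow>
    (\<exists>r. bij_betw r Y Y' \<and> (\<forall>y\<in>Y. fst (r y) = fst y) \<and> G' = image r ` G)"
    (is "?L \<longleftrightarrow> ?R")
proof
  assume ?L
  then obtain r where r: "bij_betw r Y Y'" "\<And>y. y \<in> Y \<Longrightarrow> fst (r y) = fst y"
    "(sq_ideal Y' G' :: ('v \<times> nat, 'k) mpoly set) = subst_vars r ` sq_ideal Y G"
    by (rule copy_renamingE) blast
  have rY: "r ` Y = Y'" "inj_on r Y" using r(1) by (auto simp: bij_betw_def)
  have F: "image r ` G \<subseteq> Fpow Y'" using G(1) unfolding rY(1)[symmetric] by (auto simp: Fpow_def)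
  have A: "antichain (image r ` G)"
    unfolding antichain_def
  proof (intro ballI impI, elim imageE)
    fix \<sigma>' \<tau>' \<sigma> \<tau> assume st: "\<sigma>' \<subseteq> \<tau>'" "\<sigma>' = r ` \<sigma>" "\<sigma> \<in> G" "\<tau>' = r ` \<tau>" "\<tau> \<in> G"
    have "\<sigma> \<subseteq> Y" "\<tau> \<subseteq> Y" using st G(1) by (auto simp: Fpow_def)
    then have "\<sigma> \<subseteq> \<tau>"
      using st(1) unfolding st(2,4)
      by (intro subsetI) (metis imageI inj_on_image_mem_iff[OF rY(2)] subsetD)
    then have "\<sigma> = \<tau>" using G(2) st(3,5) unfolding antichain_def by blast
    then show "\<sigma>' = \<tau>'" using st by simp
  qed
  have "(sq_ideal Y' G' :: ('v \<times> nat, 'k) mpoly set) = sq_ideal Y' (image r ` G)"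
    using r(3) subst_vars_sq_ideal[OF G(1) rY(2)] unfolding rY(1) by simp
  then have "G' = image r ` G" by (rule sq_ideal_inject[OF G' F A])
  then show ?R using r by blast
next
  assume ?R
  then obtain r where r: "bij_betw r Y Y'" "\<forall>y\<in>Y. fst (r y) = fst y" "G' = image r ` G" by blast
  then have rY: "r ` Y = Y'" "inj_on r Y" by (auto simp: bij_betw_def)
  have "(sq_ideal Y' G' :: ('v \<times> nat, 'k) mpoly set) = subst_vars r ` sq_ideal Y G"
    unfolding r(3) rY(1)[symmetric] by (rule subst_vars_sq_ideal[OF G(1) rY(2), symmetric])
  then show ?L using r by (intro copy_renamingI[of r]) auto
qed

lemma sq_ideal_exponents: "G \<subseteq> Fpow Y \<Longrightarrow> sq_ideal Y G \<subseteq> mideal (exponents Y)"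
  unfolding sq_ideal_eq using upset_sq_exps[of Y G] unfolding upset_def mideal_def by blast

lemma maximal_polarizations_eq:
  assumes H: "H \<subseteq> Fpow X" "antichain H" "{} \<notin> H"
  shows "maximal_polarizations X (sq_ideal X H :: ('v, 'k::field) mpoly set) =
    {(Y, sq_ideal Y G) | Y G. is_lift H Y G \<and> (\<forall>Y' G'. is_lift G Y' G' \<longrightarrow> inj_on fst Y')}"
proof -
  have max: "maximal_polarized Y (sq_ideal Y G :: (_, 'k) mpoly set) \<longleftrightarrow>
      (\<forall>Y' G'. is_lift G Y' G' \<longrightarrow> inj_on fst Y')" if l: "is_lift H Y G" for Y G
  proof (rule maximal_polarized_iff[OF is_lift_Fpow[OF l] is_lift_antichain[OF l H(2)]])
    have "image fst ` G = H" using l by (simp add: is_lift_def bij_betw_def)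
    then show "{} \<notin> G" using H(3) by (metis image_empty image_eqI)
  qed
  show ?thesis
  proof (intro subset_antisym subsetI)
    fix a :: "('v \<times> nat) set \<times> ('v \<times> nat, 'k) mpoly set"
    assume a: "a \<in> maximal_polarizations X (sq_ideal X H)"
    obtain Y I where YI: "a = (Y, I)" by (rule prod.exhaust)
    have p: "polarization X (sq_ideal X H) Y I" "maximal_polarized Y I"
      using a unfolding YI maximal_polarizations_def by auto
    obtain G where "is_lift H Y G" "I = sq_ideal Y G" using lift_of_polarization[OF p(1) H(1,2)] .
    then show "a \<in> {(Y, sq_ideal Y G) | Y G. is_lift H Y G \<and> (\<forall>Y' G'. is_lift G Y' G' \<longrightarrow> inj_on fst Y')}"
      using max p(2) YI by auto
  next
    fix a :: "('v \<times> nat) set \<times> ('v \<times> nat, 'k) mpoly set"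
    assume "a \<in> {(Y, sq_ideal Y G) | Y G. is_lift H Y G \<and> (\<forall>Y' G'. is_lift G Y' G' \<longrightarrow> inj_on fst Y')}"
    then obtain Y G where "a = (Y, sq_ideal Y G)" "is_lift H Y G" "\<forall>Y' G'. is_lift G Y' G' \<longrightarrow> inj_on fst Y'"
      by blast
    then show "a \<in> maximal_polarizations X (sq_ideal X H)"
      using max polarization_of_lift[OF _ H] unfolding maximal_polarizations_def by auto
  qed
qed

text \<open>\<open>copy_renaming\<close> relates arbitrary pairs, and its symmetry is established
  only for ideals inside their ambient ring. The conditions on \<open>R\<close> are therefore stated
  at the representatives \<open>F t\<close> instead of asking for an equivalence relation.\<close>

lemma bij_betw_classes:
  assumes "\<And>t. t \<in> T \<Longrightarrow> F t \<in> A"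
    and "\<And>t t'. t \<in> T \<Longrightarrow> t' \<in> T \<Longrightarrow> (F t, F t') \<in> R \<Longrightarrow> t = t'"
    and "\<And>a. a \<in> A \<Longrightarrow> \<exists>t\<in>T. (F t, a) \<in> R"
    and "\<And>t. t \<in> T \<Longrightarrow> (F t, F t) \<in> R"
    and "\<And>t b. t \<in> T \<Longrightarrow> (F t, b) \<in> R \<Longrightarrow> R `` {F t} = R `` {b}"
  shows "bij_betw (\<lambda>t. R `` {F t}) T (A // R)"
  unfolding bij_betw_def
proof
  show "inj_on (\<lambda>t. R `` {F t}) T"
  proof (rule inj_onI)
    fix t t' assume t: "t \<in> T" "t' \<in> T" "R `` {F t} = R `` {F t'}"
    then have "(F t, F t') \<in> R" using assms(4)[OF t(2)] by auto
    then show "t = t'" using assms(2) t by blast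
  qed
  show "(\<lambda>t. R `` {F t}) ` T = A // R"
  proof (intro subset_antisym subsetI)
    fix C assume "C \<in> (\<lambda>t. R `` {F t}) ` T"
    then show "C \<in> A // R" using assms(1) by (auto intro: quotientI)
  next
    fix C assume "C \<in> A // R"
    then obtain a where a: "a \<in> A" "C = R `` {a}" by (rule quotientE)
    then obtain t where "t \<in> T" "(F t, a) \<in> R" using assms(3) by blast
    then show "C \<in> (\<lambda>t. R `` {F t}) ` T" using assms(5) a(2) by blast
  qed
qed

section \<open>Copy systems\<close>

text \<open>A polarization of the ideals generated in degree \<open>n - 1\<close>, or in degree 2, is encoded by the
  variables \<open>W j v\<close> (\<open>j \<noteq> v\<close>): the copy of \<open>x\<^sub>j\<close> in the generator that lacks \<open>x\<^sub>v\<close>, respectively in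
  the generator lifting \<open>x\<^sub>j x\<^sub>v\<close>. The map \<open>ix\<close> recovers \<open>j\<close> from \<open>W j v\<close>.\<close>

definition vertex_gen :: "'a set \<Rightarrow> ('a \<Rightarrow> 'a \<Rightarrow> 'b) \<Rightarrow> 'a \<Rightarrow> 'b set" where
  "vertex_gen V W v = (\<lambda>j. W j v) ` (V - {v})"

definition vertex_gens :: "'a set \<Rightarrow> ('a \<Rightarrow> 'a \<Rightarrow> 'b) \<Rightarrow> 'b set set" where
  "vertex_gens V W = vertex_gen V W ` V"

definition pair_gens :: "'a set \<Rightarrow> ('a \<Rightarrow> 'a \<Rightarrow> 'b) \<Rightarrow> 'b set set" where
  "pair_gens V W = {{W i j, W j i} | i j. i \<in> V \<and> j \<in> V \<and> i \<noteq> j}"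

definition copies :: "'a set \<Rightarrow> ('a \<Rightarrow> 'a \<Rightarrow> 'b) \<Rightarrow> 'b set" where
  "copies V W = {W j v | j v. j \<in> V \<and> v \<in> V \<and> j \<noteq> v}"

abbreviation tagged :: "('a \<Rightarrow> 'a \<Rightarrow> nat) \<Rightarrow> 'a \<Rightarrow> 'a \<Rightarrow> 'a \<times> nat" where
  "tagged S \<equiv> \<lambda>j v. (j, S j v)"

text \<open>Copies of copies: the variables of a polarization of the polarization described by
  \<open>S\<close>.\<close>

abbreviation refined :: "('a \<Rightarrow> 'a \<Rightarrow> nat) \<Rightarrow> ('a \<Rightarrow> 'a \<Rightarrow> nat) \<Rightarrow> 'a \<Rightarrow> 'a \<Rightarrow> ('a \<times> nat) \<times> nat" where
  "refined S t \<equiv> \<lambda>j v. ((j, S j v), t j v)"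

definition indexed :: "'a set \<Rightarrow> ('a \<Rightarrow> 'a \<Rightarrow> 'b) \<Rightarrow> ('b \<Rightarrow> 'a) \<Rightarrow> bool" where
  "indexed V W ix \<longleftrightarrow> (\<forall>j\<in>V. \<forall>v\<in>V. j \<noteq> v \<longrightarrow> ix (W j v) = j)"

text \<open>Read \<open>W j u\<close> as the direction of \<open>u\<close> seen from
  \<open>j\<close>. In a tree, if \<open>u\<close> and \<open>v\<close> lie in different directions
  from \<open>j\<close>, the path from \<open>u\<close> to \<open>v\<close> passes through
  \<open>j\<close>, so \<open>u\<close> sees \<open>j\<close> and \<open>v\<close> in the same
  direction.\<close>

definition copy_system :: "'a set \<Rightarrow> ('a \<Rightarrow> 'a \<Rightarrow> 'b) \<Rightarrow> bool" where
  "copy_system V W \<longleftrightarrow>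
     (\<forall>j\<in>V. \<forall>u\<in>V. \<forall>v\<in>V. u \<noteq> j \<longrightarrow> v \<noteq> j \<longrightarrow> W j u \<noteq> W j v \<longrightarrow> W u j = W u v)"

lemma indexedD: "indexed V W ix \<Longrightarrow> j \<in> V \<Longrightarrow> v \<in> V \<Longrightarrow> j \<noteq> v \<Longrightarrow> ix (W j v) = j"
  by (simp add: indexed_def)

lemma copy_systemD:
  "copy_system V W \<Longrightarrow> j \<in> V \<Longrightarrow> u \<in> V \<Longrightarrow> v \<in> V \<Longrightarrow> u \<noteq> j \<Longrightarrow> v \<noteq> j \<Longrightarrow> W j u \<noteq> W j v \<Longrightarrow>
    W u j = W u v"
  unfolding copy_system_def by blast

text \<open>A vertex \<open>i\<close> separating \<open>j\<close> from both \<open>u\<close> and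
  \<open>v\<close> would itself lie, seen from \<open>j\<close>, in the class of \<open>u\<close>
  and in that of \<open>v\<close>.\<close>

lemma copy_system_separator:
  assumes W: "copy_system V W" and V: "j \<in> V" "u \<in> V" "v \<in> V" "i \<in> V" "u \<noteq> j" "v \<noteq> j"
    and i: "i \<noteq> j" "i \<noteq> u" "i \<noteq> v" and sep: "W j u \<noteq> W j v"
  shows "W i j = W i u \<or> W i j = W i v"
proof (rule ccontr)
  assume "\<not> ?thesis"
  then have "W j i = W j u" "W j i = W j v"
    using copy_systemD[OF W, of i j u] copy_systemD[OF W, of i j v] V i by metis+
  with sep show False by simp
qed

lemma vertex_gen_index: "indexed V W ix \<Longrightarrow> v \<in> V \<Longrightarrow> ix ` vertex_gen V W v = V - {v}"
  unfolding vertex_gen_def image_image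
  by (subst image_cong[OF refl, of _ _ "\<lambda>j. j"]) (auto intro: indexedD)

lemma in_vertex_gen:
  assumes "indexed V W ix" "v \<in> V" "x \<in> vertex_gen V W v"
  shows "ix x \<in> V" "ix x \<noteq> v" "x = W (ix x) v"
proof -
  obtain j where j: "j \<in> V" "j \<noteq> v" "x = W j v" using assms(3) by (auto simp: vertex_gen_def)
  then have "ix x = j" using indexedD[OF assms(1) j(1) assms(2)] by simp
  with j show "ix x \<in> V" "ix x \<noteq> v" "x = W (ix x) v" by simp_all
qed

lemma vertex_gen_mem:
  assumes "indexed V W ix" "u \<in> V" "v \<in> V" "j \<in> V" "j \<noteq> u"
  shows "W j u \<in> vertex_gen V W v \<longleftrightarrow> j \<noteq> v \<and> W j u = W j v"
proof
  assume a: "W j u \<in> vertex_gen V W v"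
  have "ix (W j u) = j" using assms by (intro indexedD) auto
  then show "j \<noteq> v \<and> W j u = W j v" using in_vertex_gen[OF assms(1,3) a] by simp
next
  assume "j \<noteq> v \<and> W j u = W j v"
  then show "W j u \<in> vertex_gen V W v" using assms by (auto simp: vertex_gen_def)
qed

lemma vertex_gens_antichain:
  assumes ix: "indexed V W ix"
  shows "antichain (vertex_gens V W)"
  unfolding antichain_def
proof (intro ballI impI)
  fix \<sigma> \<tau> assume st: "\<sigma> \<in> vertex_gens V W" "\<tau> \<in> vertex_gens V W" "\<sigma> \<subseteq> \<tau>"
  then obtain u v where uv: "u \<in> V" "v \<in> V" "\<sigma> = vertex_gen V W u" "\<tau> = vertex_gen V W v"
    by (auto simp: vertex_gens_def)
  have "ix ` \<sigma> \<subseteq> ix ` \<tau>" using st(3) by (rule image_mono)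
  then have "V - {u} \<subseteq> V - {v}" using vertex_gen_index[OF ix] uv by metis
  then show "\<sigma> = \<tau>" using uv by auto
qed

lemma pair_gensI: "i \<in> V \<Longrightarrow> j \<in> V \<Longrightarrow> i \<noteq> j \<Longrightarrow> {W i j, W j i} \<in> pair_gens V W"
  by (auto simp: pair_gens_def)

lemma pair_gensE:
  assumes "\<sigma> \<in> pair_gens V W"
  obtains i j where "i \<in> V" "j \<in> V" "i \<noteq> j" "\<sigma> = {W i j, W j i}"
  using assms unfolding pair_gens_def by (elim CollectE exE conjE)

lemma in_pair_gens:
  assumes "\<sigma> \<in> pair_gens V W" "x \<in> \<sigma>"
  obtains i j where "i \<in> V" "j \<in> V" "i \<noteq> j" "x = W i j" "\<sigma> = {W i j, W j i}"
  using assms unfolding pair_gens_def by auto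

lemma pair_gen_index:
  "indexed V W ix \<Longrightarrow> i \<in> V \<Longrightarrow> j \<in> V \<Longrightarrow> i \<noteq> j \<Longrightarrow> ix ` {W i j, W j i} = {i, j}"
  by (simp add: indexed_def)

lemma pair_gens_antichain:
  assumes ix: "indexed V W ix"
  shows "antichain (pair_gens V W)"
  unfolding antichain_def
proof (intro ballI impI)
  fix \<sigma> \<tau> assume st: "\<sigma> \<in> pair_gens V W" "\<tau> \<in> pair_gens V W" "\<sigma> \<subseteq> \<tau>"
  then obtain i j k l where ijkl: "i \<in> V" "j \<in> V" "i \<noteq> j" "\<sigma> = {W i j, W j i}"
    "k \<in> V" "l \<in> V" "k \<noteq> l" "\<tau> = {W k l, W l k}"
    by (auto simp: pair_gens_def)
  have "ix ` \<sigma> \<subseteq> ix ` \<tau>" using st(3) by (rule image_mono)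
  then have "{i, j} \<subseteq> {k, l}" using pair_gen_index[OF ix] ijkl by metis
  then have "i = k \<and> j = l \<or> i = l \<and> j = k" using ijkl by auto
  then show "\<sigma> = \<tau>" using ijkl by auto
qed

lemma vertex_gens_Fpow: "finite V \<Longrightarrow> vertex_gens V W \<subseteq> Fpow (copies V W)"
  by (auto simp: vertex_gens_def vertex_gen_def copies_def Fpow_def)

lemma pair_gens_Fpow: "pair_gens V W \<subseteq> Fpow (copies V W)"
  by (auto simp: pair_gens_def copies_def Fpow_def)

lemma finite_copies: "finite V \<Longrightarrow> finite (copies V W)"
  by (rule finite_subset[of _ "(\<lambda>(j, v). W j v) ` (V \<times> V)"]) (auto simp: copies_def)

lemma copies_image:
  assumes "\<And>j v. j \<in> V \<Longrightarrow> v \<in> V \<Longrightarrow> j \<noteq> v \<Longrightarrow> r (W1 j v) = W2 j v"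
  shows "r ` copies V W1 = copies V W2"
proof (intro subset_antisym subsetI)
  fix y assume "y \<in> r ` copies V W1"
  then obtain j v where "j \<in> V" "v \<in> V" "j \<noteq> v" "y = r (W1 j v)" by (auto simp: copies_def)
  then show "y \<in> copies V W2" unfolding copies_def using assms by auto
next
  fix y assume "y \<in> copies V W2"
  then obtain j v where jv: "j \<in> V" "v \<in> V" "j \<noteq> v" "y = W2 j v" by (auto simp: copies_def)
  then have "y = r (W1 j v)" "W1 j v \<in> copies V W1" using assms by (auto simp: copies_def)
  then show "y \<in> r ` copies V W1" by blast
qed

lemma vertex_gens_image:
  assumes "\<And>j v. j \<in> V \<Longrightarrow> v \<in> V \<Longrightarrow> j \<noteq> v \<Longrightarrow> r (W1 j v) = W2 j v"
  shows "image r ` vertex_gens V W1 = vertex_gens V W2"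
proof -
  have "r ` vertex_gen V W1 v = vertex_gen V W2 v" if "v \<in> V" for v
    unfolding vertex_gen_def image_image by (rule image_cong) (use assms that in auto)
  then show ?thesis
    unfolding vertex_gens_def image_image by (intro image_cong refl)
qed

lemma pair_gens_image:
  assumes "\<And>j v. j \<in> V \<Longrightarrow> v \<in> V \<Longrightarrow> j \<noteq> v \<Longrightarrow> r (W1 j v) = W2 j v"
  shows "image r ` pair_gens V W1 = pair_gens V W2"
proof (intro subset_antisym subsetI)
  fix y assume "y \<in> image r ` pair_gens V W1"
  then obtain i j where "i \<in> V" "j \<in> V" "i \<noteq> j" "y = r ` {W1 i j, W1 j i}" by (auto simp: pair_gens_def)
  then show "y \<in> pair_gens V W2" unfolding pair_gens_def using assms by auto
next
  fix y assume "y \<in> pair_gens V W2"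
  then obtain i j where "i \<in> V" "j \<in> V" "i \<noteq> j" "y = {W2 i j, W2 j i}" by (auto simp: pair_gens_def)
  then have "y = r ` {W1 i j, W1 j i}" "{W1 i j, W1 j i} \<in> pair_gens V W1"
    using assms by (auto simp: pair_gens_def)
  then show "y \<in> image r ` pair_gens V W1" by blast
qed

lemma indexed_fst:
  assumes "indexed V (\<lambda>j v. fst (W j v)) ix"
  shows "indexed V W (ix \<circ> fst)"
  using assms by (simp add: indexed_def)

section \<open>Copy systems give lifts\<close>

text \<open>For two copies \<open>W j u\<close> and \<open>W j v\<close> the exchange generator is
  that of \<open>j\<close>, the only one with no copy of \<open>j\<close>. Each of its members
  \<open>W i j\<close> equals \<open>W i u\<close> or \<open>W i v\<close>. The base variables are
  arbitrary, so that this serves for first copies and for copies of copies.\<close>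

lemma vertex_gens_lift:
  fixes W :: "'a \<Rightarrow> 'a \<Rightarrow> 'b \<times> nat"
  assumes V: "finite V" and ix: "indexed V (\<lambda>j v. fst (W j v)) ix" and W: "copy_system V W"
  shows "is_lift (vertex_gens V (\<lambda>j v. fst (W j v))) (copies V W) (vertex_gens V W)"
proof -
  let ?B = "\<lambda>j v. fst (W j v)"
  note ixW = indexed_fst[OF ix]
  have fst_gen: "fst ` vertex_gen V W v = vertex_gen V ?B v" for v
    by (simp add: vertex_gen_def image_image)
  have inj: "inj_on fst \<sigma>" if "\<sigma> \<in> vertex_gens V W" for \<sigma>
  proof (rule inj_onI)
    fix x y assume xy: "x \<in> \<sigma>" "y \<in> \<sigma>" "fst x = fst y"
    obtain v where v: "v \<in> V" "\<sigma> = vertex_gen V W v" using \<open>\<sigma> \<in> vertex_gens V W\<close> by (auto simp: vertex_gens_def)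
    then show "x = y"
      using in_vertex_gen(3)[OF ixW v(1), of x] in_vertex_gen(3)[OF ixW v(1), of y] xy by simp
  qed
  have im: "image fst ` vertex_gens V W = vertex_gens V ?B" by (rule vertex_gens_image) simp
  have inj_im: "inj_on (image fst) (vertex_gens V W)"
  proof (rule inj_onI)
    fix \<sigma> \<tau> assume st: "\<sigma> \<in> vertex_gens V W" "\<tau> \<in> vertex_gens V W" "fst ` \<sigma> = fst ` \<tau>"
    then obtain u v where uv: "u \<in> V" "v \<in> V" "\<sigma> = vertex_gen V W u" "\<tau> = vertex_gen V W v"
      by (auto simp: vertex_gens_def)
    have "vertex_gen V ?B u = vertex_gen V ?B v" using st(3) uv by (simp add: fst_gen)
    then have "V - {u} = V - {v}" using vertex_gen_index[OF ix] uv by metis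
    then show "\<sigma> = \<tau>" using uv by auto
  qed
  have ex: "\<exists>\<rho>\<in>vertex_gens V W. \<rho> \<subseteq> \<sigma> \<union> \<tau> - {x, y}"
    if st: "\<sigma> \<in> vertex_gens V W" "\<tau> \<in> vertex_gens V W" "x \<in> \<sigma>" "y \<in> \<tau>" "x \<noteq> y" "fst x = fst y"
    for \<sigma> \<tau> x y
  proof -
    obtain u v where uv: "u \<in> V" "v \<in> V" "\<sigma> = vertex_gen V W u" "\<tau> = vertex_gen V W v"
      using st by (auto simp: vertex_gens_def)
    define j where "j = (ix \<circ> fst) x"
    have jy: "(ix \<circ> fst) y = j" using st(6) by (simp add: j_def)
    have j: "j \<in> V" "j \<noteq> u" "j \<noteq> v" and xy: "x = W j u" "y = W j v"
      using in_vertex_gen[OF ixW uv(1) st(3)[unfolded uv]] in_vertex_gen[OF ixW uv(2) st(4)[unfolded uv]]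
      unfolding j_def[symmetric] jy by auto
    have sep: "W j u \<noteq> W j v" using st(5) xy by simp
    have "W i j \<in> \<sigma> \<union> \<tau> - {x, y}" if i: "i \<in> V" "i \<noteq> j" for i
    proof -
      have "(ix \<circ> fst) (W i j) \<noteq> j" using indexedD[OF ixW i(1) j(1) i(2)] i by simp
      then have ne: "W i j \<noteq> x" "W i j \<noteq> y" using jy j_def by auto
      have uv_ne: "u \<noteq> v" using sep by auto
      consider "i = u" | "i = v" | "i \<noteq> u" "i \<noteq> v" by blast
      then have "i \<noteq> u \<and> W i j = W i u \<or> i \<noteq> v \<and> W i j = W i v"
      proof cases
        case 1
        then show ?thesis using copy_systemD[OF W j(1) uv(1,2)] j sep uv_ne by auto
      next
        case 2
        then show ?thesis using copy_systemD[OF W j(1) uv(2,1)] j sep uv_ne by auto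
      next
        case 3
        then show ?thesis using copy_system_separator[OF W j(1) uv(1,2) i(1)] j i(2) sep by auto
      qed
      then have "W i j \<in> \<sigma> \<union> \<tau>"
        using vertex_gen_mem[OF ixW j(1) uv(1) i(1,2)] vertex_gen_mem[OF ixW j(1) uv(2) i(1,2)] uv(3,4)
        by blast
      then show ?thesis using ne by blast
    qed
    then have "vertex_gen V W j \<subseteq> \<sigma> \<union> \<tau> - {x, y}" unfolding vertex_gen_def by blast
    then show ?thesis using j(1) unfolding vertex_gens_def by blast
  qed
  have un: "\<Union>(vertex_gens V W) = copies V W"
    by (auto simp: vertex_gens_def vertex_gen_def copies_def)
  show ?thesis
    unfolding is_lift_def bij_betw_def
    by (intro conjI ballI impI finite_copies V un inj inj_im im ex)
qed

text \<open>For the pairs of \<open>j\<close> with \<open>u\<close> and with \<open>v\<close>, the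
  exchange generator is the pair of \<open>u\<close> and \<open>v\<close>: the copy system condition
  at \<open>j\<close> gives \<open>W u v = W u j\<close> and \<open>W v u = W v j\<close>.\<close>

lemma pair_gens_lift:
  fixes W :: "'a \<Rightarrow> 'a \<Rightarrow> 'b \<times> nat"
  assumes V: "finite V" and ix: "indexed V (\<lambda>j v. fst (W j v)) ix" and W: "copy_system V W"
  shows "is_lift (pair_gens V (\<lambda>j v. fst (W j v))) (copies V W) (pair_gens V W)"
proof -
  let ?B = "\<lambda>j v. fst (W j v)"
  note ixW = indexed_fst[OF ix]
  have inj: "inj_on fst \<sigma>" if "\<sigma> \<in> pair_gens V W" for \<sigma>
  proof -
    obtain i j where ij: "i \<in> V" "j \<in> V" "i \<noteq> j" "\<sigma> = {W i j, W j i}"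
      using \<open>\<sigma> \<in> pair_gens V W\<close> by (auto simp: pair_gens_def)
    have "fst (W i j) \<noteq> fst (W j i)" using indexedD[OF ix, of i j] indexedD[OF ix, of j i] ij by auto
    then show ?thesis unfolding ij by auto
  qed
  have im: "image fst ` pair_gens V W = pair_gens V ?B" by (rule pair_gens_image) simp
  have inj_im: "inj_on (image fst) (pair_gens V W)"
  proof (rule inj_onI)
    fix \<sigma> \<tau> assume st: "\<sigma> \<in> pair_gens V W" "\<tau> \<in> pair_gens V W" "fst ` \<sigma> = fst ` \<tau>"
    then obtain i j k l where ijkl: "i \<in> V" "j \<in> V" "i \<noteq> j" "\<sigma> = {W i j, W j i}"
      "k \<in> V" "l \<in> V" "k \<noteq> l" "\<tau> = {W k l, W l k}"
      by (auto simp: pair_gens_def)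
    have "ix ` fst ` \<sigma> = ix ` fst ` \<tau>" using st(3) by simp
    then have "{i, j} = {k, l}"
      using pair_gen_index[OF ixW, of i j] pair_gen_index[OF ixW, of k l] ijkl by (simp add: image_image)
    then have "i = k \<and> j = l \<or> i = l \<and> j = k" using ijkl by auto
    then show "\<sigma> = \<tau>" using ijkl by auto
  qed
  have ex: "\<exists>\<rho>\<in>pair_gens V W. \<rho> \<subseteq> \<sigma> \<union> \<tau> - {x, y}"
    if st: "\<sigma> \<in> pair_gens V W" "\<tau> \<in> pair_gens V W" "x \<in> \<sigma>" "y \<in> \<tau>" "x \<noteq> y" "fst x = fst y"
    for \<sigma> \<tau> x y
  proof -
    obtain j u where ju: "j \<in> V" "u \<in> V" "j \<noteq> u" "x = W j u" "\<sigma> = {W j u, W u j}"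
      using st(1,3) by (rule in_pair_gens)
    obtain j' v where jv: "j' \<in> V" "v \<in> V" "j' \<noteq> v" "y = W j' v" "\<tau> = {W j' v, W v j'}"
      using st(2,4) by (rule in_pair_gens)
    have "ix (fst x) = j" "ix (fst y) = j'"
      using indexedD[OF ix] ju jv by auto
    then have [simp]: "j' = j" using st(6) by simp
    have sep: "W j u \<noteq> W j v" "u \<noteq> v" using st(5) ju jv by auto
    have "W u j = W u v" "W v j = W v u"
      using copy_systemD[OF W, of j u v] copy_systemD[OF W, of j v u] ju jv sep by auto
    moreover have "ix (fst (W u j)) = u" "ix (fst (W v j)) = v" "ix (fst (W j u)) = j" "ix (fst (W j v)) = j"
      using indexedD[OF ix] ju jv by auto
    ultimately have "{W u v, W v u} \<subseteq> \<sigma> \<union> \<tau> - {x, y}"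
      using ju jv by auto
    moreover have "{W u v, W v u} \<in> pair_gens V W" using ju(2) jv(2) sep(2) by (auto simp: pair_gens_def)
    ultimately show ?thesis by blast
  qed
  have un: "\<Union>(pair_gens V W) = copies V W"
    unfolding pair_gens_def copies_def by blast
  show ?thesis
    unfolding is_lift_def bij_betw_def
    by (intro conjI ballI impI finite_copies V un inj inj_im im ex)
qed

text \<open>A transversal \<open>\<tau>\<close> of all vertex generators contains a pair: otherwise the sets
  \<open>{j. W j v \<in> \<tau>}\<close> strictly shrink along \<open>v \<mapsto> j\<close> with \<open>W j v \<in> \<tau>\<close>.\<close>

lemma transversal_contains_pair:
  assumes V: "finite V" "V \<noteq> {}" and W: "copy_system V W"
    and \<tau>: "\<And>v. v \<in> V \<Longrightarrow> \<tau> \<inter> vertex_gen V W v \<noteq> {}"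
  shows "\<exists>\<rho>\<in>pair_gens V W. \<rho> \<subseteq> \<tau>"
proof (rule ccontr)
  assume no: "\<not> ?thesis"
  have no: "\<not> (W i j \<in> \<tau> \<and> W j i \<in> \<tau>)" if "i \<in> V" "j \<in> V" "i \<noteq> j" for i j
    using no that unfolding pair_gens_def by auto
  define R where "R v = {j \<in> V - {v}. W j v \<in> \<tau>}" for v
  have ne: "R v \<noteq> {}" if "v \<in> V" for v
    using \<tau>[OF that] by (auto simp: R_def vertex_gen_def)
  have dec: "R j \<subset> R v" if v: "v \<in> V" and j: "j \<in> R v" for v j
  proof
    have jV: "j \<in> V" "j \<noteq> v" "W j v \<in> \<tau>" using j by (auto simp: R_def)
    show "R j \<subseteq> R v"
    proof
      fix l assume "l \<in> R j"
      then have l: "l \<in> V" "l \<noteq> j" "W l j \<in> \<tau>" by (auto simp: R_def)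
      have "W v j \<notin> \<tau>" using no[of v j] v jV by auto
      then have "l \<noteq> v" using l by auto
      have "W j l \<notin> \<tau>" using no[of l j] l jV by auto
      \<comment> \<open>The copy \<open>W j v\<close> is in \<open>\<tau>\<close> while
        \<open>W j l\<close> is not, so \<open>j\<close> separates \<open>l\<close> from
        \<open>v\<close>, and \<open>l\<close> sees \<open>j\<close> and \<open>v\<close>
        alike.\<close>
      then have "W j l \<noteq> W j v" using jV by auto
      then have "W l j = W l v" using copy_systemD[OF W, of j l v] jV l v by auto
      then show "l \<in> R v" using l \<open>l \<noteq> v\<close> by (simp add: R_def)
    qed
    show "R j \<noteq> R v" using j by (auto simp: R_def)
  qed
  have fin: "finite (R v)" for v using V by (simp add: R_def)
  have False if "v \<in> V" for v
    using that
  proof (induction "card (R v)" arbitrary: v rule: less_induct)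
    case less
    obtain j where j: "j \<in> R v" using ne[OF less.prems] by auto
    then have "card (R j) < card (R v)" using dec[OF less.prems j] fin by (intro psubset_card_mono) auto
    then show False using less.hyps j by (auto simp: R_def)
  qed
  then show False using V by auto
qed

text \<open>If \<open>W i j\<close> is not in the generator of a third vertex \<open>v\<close>, then
  \<open>i\<close> separates \<open>j\<close> from \<open>v\<close>, which gives
  \<open>W j i = W j v\<close>.\<close>

lemma pair_meets_vertex_gen:
  assumes W: "copy_system V W" and V: "i \<in> V" "j \<in> V" "v \<in> V" "i \<noteq> j"
  shows "{W i j, W j i} \<inter> vertex_gen V W v \<noteq> {}"
proof -
  consider "v = i" | "v = j" | "v \<noteq> i" "v \<noteq> j" "W i v = W i j" | "v \<noteq> i" "v \<noteq> j" "W j v = W j i"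
    using copy_systemD[OF W, of i j v] V by metis
  then show ?thesis
  proof cases
    case 1
    then show ?thesis using V by (auto simp: vertex_gen_def)
  next
    case 2
    then show ?thesis using V by (auto simp: vertex_gen_def)
  next
    case 3
    then have "W i j \<in> vertex_gen V W v" using V unfolding vertex_gen_def by (metis DiffI image_eqI singletonD)
    then show ?thesis by auto
  next
    case 4
    then have "W j i \<in> vertex_gen V W v" using V unfolding vertex_gen_def by (metis DiffI image_eqI singletonD)
    then show ?thesis by auto
  qed
qed

text \<open>Pairs are transversals of the vertex generators, and every transversal contains a pair,
  so both families generate the same ideal.\<close>

lemma alexander_dual_vertex_gens:
  assumes V: "finite V" "V \<noteq> {}" and W: "copy_system V W" and ix: "indexed V W ix"
  shows "alexander_dual (copies V W) (sq_ideal (copies V W) (vertex_gens V W)) =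
    (sq_ideal (copies V W) (pair_gens V W) :: ('b, 'k::field) mpoly set)"
proof -
  let ?Y = "copies V W"
  let ?D = "{\<tau> \<in> Fpow ?Y. \<forall>\<sigma>\<in>vertex_gens V W. \<tau> \<inter> \<sigma> \<noteq> {}}"
  have F: "vertex_gens V W \<subseteq> Fpow ?Y" by (rule vertex_gens_Fpow[OF V(1)])
  have min: "min_gens (sq_ideal ?Y (vertex_gens V W) :: ('b, 'k) mpoly set) = ind_exp ` vertex_gens V W"
    by (rule min_gens_sq_ideal[OF F vertex_gens_antichain[OF ix]])
  have "supp (ind_exp \<sigma>) = \<sigma>" if "\<sigma> \<in> vertex_gens V W" for \<sigma>
    using that F by (intro supp_ind_exp) (auto simp: Fpow_def)
  then have "{\<tau> \<in> Fpow ?Y. \<forall>m\<in>min_gens (sq_ideal ?Y (vertex_gens V W) :: ('b, 'k) mpoly set). \<tau> \<inter> supp m \<noteq> {}} = ?D"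
    unfolding min by simp
  then have "alexander_dual ?Y (sq_ideal ?Y (vertex_gens V W)) = (sq_ideal ?Y ?D :: ('b, 'k) mpoly set)"
    by (simp add: alexander_dual_def)
  also have "\<dots> = mideal (sq_exps ?Y ?D)" by (rule sq_ideal_eq) auto
  also have "sq_exps ?Y ?D = sq_exps ?Y (pair_gens V W)"
  proof -
    have "\<exists>\<rho>\<in>pair_gens V W. \<rho> \<subseteq> \<tau>" if "\<tau> \<in> ?D" for \<tau>
      by (rule transversal_contains_pair[OF V W]) (use that in \<open>auto simp: vertex_gens_def\<close>)
    moreover have "pair_gens V W \<subseteq> ?D"
    proof
      fix \<rho> assume r: "\<rho> \<in> pair_gens V W"
      then obtain i j where "i \<in> V" "j \<in> V" "i \<noteq> j" "\<rho> = {W i j, W j i}" by (auto simp: pair_gens_def)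
      then have "\<forall>\<sigma>\<in>vertex_gens V W. \<rho> \<inter> \<sigma> \<noteq> {}"
        using pair_meets_vertex_gen[OF W] by (auto simp: vertex_gens_def)
      then show "\<rho> \<in> ?D" using r pair_gens_Fpow[of V W] by blast
    qed
    ultimately have "(\<exists>\<sigma>\<in>?D. \<sigma> \<subseteq> A) \<longleftrightarrow> (\<exists>\<sigma>\<in>pair_gens V W. \<sigma> \<subseteq> A)" for A
      by (meson order.trans subsetD)
    then show ?thesis by (simp add: sq_exps_def)
  qed
  also have "mideal \<dots> = (sq_ideal ?Y (pair_gens V W) :: ('b, 'k) mpoly set)"
    by (rule sq_ideal_eq[symmetric]) (rule pair_gens_Fpow)
  finally show ?thesis .
qed

section \<open>Renamings between copy systems\<close>

text \<open>If the partitions agree, only the names of the classes differ: a class is renamed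
  through any vertex representing it.\<close>

lemma copies_rename:
  assumes ix1: "indexed V W1 ix1" and ix2: "indexed V W2 ix2"
    and eq: "\<And>j u v. j \<in> V \<Longrightarrow> u \<in> V \<Longrightarrow> v \<in> V \<Longrightarrow> u \<noteq> j \<Longrightarrow> v \<noteq> j \<Longrightarrow> W1 j u = W1 j v \<longleftrightarrow> W2 j u = W2 j v"
  obtains r where "bij_betw r (copies V W1) (copies V W2)"
    "\<And>j v. j \<in> V \<Longrightarrow> v \<in> V \<Longrightarrow> j \<noteq> v \<Longrightarrow> r (W1 j v) = W2 j v"
proof -
  define r where "r y = W2 (ix1 y) (SOME v. v \<in> V \<and> v \<noteq> ix1 y \<and> W1 (ix1 y) v = y)" for y
  have r: "r (W1 j v) = W2 j v" if jv: "j \<in> V" "v \<in> V" "j \<noteq> v" for j v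
  proof -
    have i: "ix1 (W1 j v) = j" by (rule indexedD[OF ix1 jv])
    let ?P = "\<lambda>u. u \<in> V \<and> u \<noteq> j \<and> W1 j u = W1 j v"
    have "?P (SOME u. ?P u)" by (rule someI[of ?P v]) (use jv in auto)
    then show ?thesis unfolding r_def i using eq[of j "SOME u. ?P u" v] jv by simp
  qed
  have "inj_on r (copies V W1)"
  proof (rule inj_onI)
    fix x y assume xy: "x \<in> copies V W1" "y \<in> copies V W1" "r x = r y"
    obtain j u where ju: "j \<in> V" "u \<in> V" "j \<noteq> u" "x = W1 j u" using xy(1) by (auto simp: copies_def)
    obtain k v where kv: "k \<in> V" "v \<in> V" "k \<noteq> v" "y = W1 k v" using xy(2) by (auto simp: copies_def)
    have e: "W2 j u = W2 k v" using xy(3) r ju kv by simp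
    then have "j = k" using indexedD[OF ix2 ju(1-3)] indexedD[OF ix2 kv(1-3)] by simp
    then show "x = y" using e eq[of j u v] ju kv by auto
  qed
  moreover have "r ` copies V W1 = copies V W2" by (rule copies_image) (rule r)
  ultimately show ?thesis using that r by (auto simp: bij_betw_def)
qed

text \<open>A renaming preserves the index set of a generator. The missing index identifies the
  vertex of the generator, and the index of a variable identifies its place there.\<close>

lemma rename_vertex_gens_eq:
  assumes ix: "indexed V W1 ix" "indexed V W2 ix"
    and r: "\<And>y. y \<in> copies V W1 \<Longrightarrow> ix (r y) = ix y" "image r ` vertex_gens V W1 = vertex_gens V W2"
    and jv: "j \<in> V" "v \<in> V" "j \<noteq> v"
  shows "r (W1 j v) = W2 j v"
proof -
  have "r ` vertex_gen V W1 v \<in> vertex_gens V W2"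
    using r(2) jv(2) unfolding vertex_gens_def by blast
  then obtain u where u: "u \<in> V" "r ` vertex_gen V W1 v = vertex_gen V W2 u"
    by (auto simp: vertex_gens_def)
  have cp: "y \<in> copies V W1" if "y \<in> vertex_gen V W1 v" for y
    using that jv(2) by (auto simp: copies_def vertex_gen_def)
  have "ix ` vertex_gen V W2 u = ix ` vertex_gen V W1 v"
    unfolding u(2)[symmetric] image_image by (rule image_cong) (use r(1) cp in auto)
  then have "V - {u} = V - {v}" using vertex_gen_index[OF ix(1) jv(2)] vertex_gen_index[OF ix(2) u(1)] by simp
  then have [simp]: "u = v" using u(1) jv(2) by auto
  have y: "W1 j v \<in> vertex_gen V W1 v" using jv by (auto simp: vertex_gen_def)
  have "ix (r (W1 j v)) = j" using r(1)[OF cp[OF y]] indexedD[OF ix(1) jv] by simp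
  moreover have "r (W1 j v) \<in> vertex_gen V W2 v" using u(2) y by auto
  ultimately show ?thesis using in_vertex_gen(3)[OF ix(2) jv(2)] by metis
qed

lemma rename_pair_gens_eq:
  assumes ix: "indexed V W1 ix" "indexed V W2 ix"
    and r: "\<And>y. y \<in> copies V W1 \<Longrightarrow> ix (r y) = ix y" "image r ` pair_gens V W1 = pair_gens V W2"
    and jv: "j \<in> V" "v \<in> V" "j \<noteq> v"
  shows "r (W1 j v) = W2 j v"
proof -
  have cp: "W1 j v \<in> copies V W1" "W1 v j \<in> copies V W1" using jv by (auto simp: copies_def)
  have ir: "ix (r (W1 j v)) = j" "ix (r (W1 v j)) = v"
    using r(1)[OF cp(1)] r(1)[OF cp(2)] indexedD[OF ix(1)] jv by auto
  have "{W1 j v, W1 v j} \<in> pair_gens V W1" using jv by (auto simp: pair_gens_def)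
  then have "r ` {W1 j v, W1 v j} \<in> pair_gens V W2" using r(2) by blast
  moreover have "r (W1 j v) \<in> r ` {W1 j v, W1 v j}" by simp
  ultimately obtain k l where kl: "k \<in> V" "l \<in> V" "k \<noteq> l" "r (W1 j v) = W2 k l"
    "r ` {W1 j v, W1 v j} = {W2 k l, W2 l k}"
    by (rule in_pair_gens)
  have k: "k = j" using ir(1) indexedD[OF ix(2) kl(1-3)] kl(4) by simp
  have "ix ` r ` {W1 j v, W1 v j} = {k, l}" unfolding kl(5) by (rule pair_gen_index[OF ix(2) kl(1-3)])
  then have "l = v" using ir k jv by auto
  then show ?thesis using kl(4) k by simp
qed

section \<open>Every lift comes from a copy system\<close>

lemma lift_vertex_gens_copies:
  assumes lift: "is_lift (vertex_gens V (\<lambda>j v. j)) Y G"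
  obtains S where "copy_system V (tagged S)" "Y = copies V (tagged S)"
    "G = vertex_gens V (tagged S)"
proof -
  note UG = is_liftD(2)[OF lift] and inj = is_liftD(3)[OF lift] and inj_im = is_liftD(4)[OF lift]
    and im = is_liftD(5)[OF lift] and ex = is_liftD(6)[OF lift]
  have base: "vertex_gens V (\<lambda>j v. j) = (\<lambda>v. V - {v}) ` V"
    by (simp add: vertex_gens_def vertex_gen_def)
  have "\<forall>v\<in>V. \<exists>\<sigma>. \<sigma> \<in> G \<and> fst ` \<sigma> = V - {v}"
  proof
    fix v assume "v \<in> V"
    then have "V - {v} \<in> image fst ` G" unfolding im base by blast
    then show "\<exists>\<sigma>. \<sigma> \<in> G \<and> fst ` \<sigma> = V - {v}" by auto
  qed
  then obtain \<sigma> where \<sigma>: "\<forall>v\<in>V. \<sigma> v \<in> G \<and> fst ` \<sigma> v = V - {v}" by (rule bchoice[THEN exE])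
  \<comment> \<open>The tag of the copy of \<open>j\<close> in the generator lying over the
    complement of \<open>v\<close>.\<close>
  define S where "S j v = (SOME k. (j, k) \<in> \<sigma> v)" for j v
  let ?W = "tagged S"
  have ix: "indexed V ?W fst" by (simp add: indexed_def)
  have S: "(j, S j v) \<in> \<sigma> v" if "v \<in> V" "j \<in> V" "j \<noteq> v" for j v
  proof -
    have "j \<in> fst ` \<sigma> v" using \<sigma> that by simp
    then have "\<exists>k. (j, k) \<in> \<sigma> v" by auto
    then show ?thesis unfolding S_def by (rule someI_ex)
  qed
  have gen: "\<sigma> v = vertex_gen V ?W v" if v: "v \<in> V" for v
  proof (intro subset_antisym subsetI)
    fix x assume x: "x \<in> \<sigma> v"
    then have "fst x \<in> fst ` \<sigma> v" by simp
    then have "fst x \<in> V - {v}" using \<sigma> v by simp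
    moreover from this have "(fst x, S (fst x) v) \<in> \<sigma> v" using S v by simp
    then have "x = (fst x, S (fst x) v)" using inj_onD[OF inj _ x] \<sigma> v by auto
    ultimately show "x \<in> vertex_gen V ?W v" unfolding vertex_gen_def by blast
  next
    fix x assume "x \<in> vertex_gen V ?W v"
    then show "x \<in> \<sigma> v" using S v by (auto simp: vertex_gen_def)
  qed
  have G: "G = vertex_gens V ?W"
  proof (intro subset_antisym subsetI)
    fix \<tau> assume t: "\<tau> \<in> G"
    then have "fst ` \<tau> \<in> (\<lambda>v. V - {v}) ` V" using im base by blast
    then obtain v where v: "v \<in> V" "fst ` \<tau> = V - {v}" by auto
    then have "\<tau> = \<sigma> v" using inj_onD[OF inj_im _ t] \<sigma> by simp
    then show "\<tau> \<in> vertex_gens V ?W" using gen v unfolding vertex_gens_def by simp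
  next
    fix \<tau> assume "\<tau> \<in> vertex_gens V ?W"
    then obtain v where "v \<in> V" "\<tau> = vertex_gen V ?W v" unfolding vertex_gens_def by (rule imageE) simp
    then show "\<tau> \<in> G" using gen \<sigma> by metis
  qed
  have "copy_system V ?W"
    unfolding copy_system_def
  proof (intro ballI impI)
    fix j u v assume V: "j \<in> V" "u \<in> V" "v \<in> V" and ne: "u \<noteq> j" "v \<noteq> j" and sep: "?W j u \<noteq> ?W j v"
    have x: "?W j u \<in> vertex_gen V ?W u" "?W j v \<in> vertex_gen V ?W v"
      using V ne by (auto simp: vertex_gen_def)
    have "vertex_gen V ?W u \<in> G" "vertex_gen V ?W v \<in> G" using V by (auto simp: G vertex_gens_def)
    from ex[OF this x sep] obtain \<rho> where r: "\<rho> \<in> G"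
      "\<rho> \<subseteq> vertex_gen V ?W u \<union> vertex_gen V ?W v - {?W j u, ?W j v}" by auto
    obtain w where w: "w \<in> V" "\<rho> = vertex_gen V ?W w" using r(1) unfolding G vertex_gens_def by (rule imageE) simp
    \<comment> \<open>Any other generator contains a copy of \<open>j\<close>. Inside the union this
      copy could only be one of the two that were removed.\<close>
    have "w = j"
    proof (rule ccontr)
      assume "w \<noteq> j"
      then have "?W j w \<in> \<rho>" using w V by (auto simp: vertex_gen_def)
      then have "?W j w \<in> vertex_gen V ?W u \<union> vertex_gen V ?W v" "?W j w \<noteq> ?W j u" "?W j w \<noteq> ?W j v"
        using r(2) by blast+
      then show False
        using vertex_gen_mem[OF ix w(1) V(2) V(1)] vertex_gen_mem[OF ix w(1) V(3) V(1)] \<open>w \<noteq> j\<close> by auto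
    qed
    then have "?W u j \<in> \<rho>" using w V ne by (auto simp: vertex_gen_def)
    then have "?W u j \<in> vertex_gen V ?W u \<union> vertex_gen V ?W v" using r(2) by blast
    then show "?W u j = ?W u v"
      using vertex_gen_mem[OF ix V(1) V(2) V(2) ne(1)] vertex_gen_mem[OF ix V(1) V(3) V(2) ne(1)] by auto
  qed
  moreover have "Y = copies V ?W"
    unfolding UG[symmetric] G by (auto simp: vertex_gens_def vertex_gen_def copies_def)
  ultimately show ?thesis using that G by blast
qed

lemma lift_pair_gens_copies:
  assumes lift: "is_lift (pair_gens V (\<lambda>j v. j)) Y G"
  obtains S where "copy_system V (tagged S)" "Y = copies V (tagged S)"
    "G = pair_gens V (tagged S)"
proof -
  let ?P = "pair_gens V (\<lambda>j v. j)"
  note UG = is_liftD(2)[OF lift] and inj = is_liftD(3)[OF lift] and inj_im = is_liftD(4)[OF lift]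
    and im = is_liftD(5)[OF lift] and ex = is_liftD(6)[OF lift]
  have P: "{i, j} \<in> ?P" if "i \<in> V" "j \<in> V" "i \<noteq> j" for i j
    using that by (auto simp: pair_gens_def)
  have "\<forall>p\<in>?P. \<exists>\<sigma>. \<sigma> \<in> G \<and> fst ` \<sigma> = p"
  proof
    fix p assume "p \<in> ?P"
    then have "p \<in> image fst ` G" unfolding im .
    then show "\<exists>\<sigma>. \<sigma> \<in> G \<and> fst ` \<sigma> = p" by auto
  qed
  then obtain \<sigma> where \<sigma>: "\<forall>p\<in>?P. \<sigma> p \<in> G \<and> fst ` \<sigma> p = p" by (rule bchoice[THEN exE])
  \<comment> \<open>Generators are chosen for unordered pairs, so \<open>S i j\<close> and
    \<open>S j i\<close> are tags within one and the same generator.\<close>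
  define S where "S i j = (SOME k. (i, k) \<in> \<sigma> {i, j})" for i j
  let ?W = "tagged S"
  have S: "(i, S i j) \<in> \<sigma> {i, j}" if "i \<in> V" "j \<in> V" "i \<noteq> j" for i j
  proof -
    have "i \<in> fst ` \<sigma> {i, j}" using \<sigma> P[OF that] by simp
    then have "\<exists>k. (i, k) \<in> \<sigma> {i, j}" by auto
    then show ?thesis unfolding S_def by (rule someI_ex)
  qed
  have gen: "\<sigma> {i, j} = {?W i j, ?W j i}" if ij: "i \<in> V" "j \<in> V" "i \<noteq> j" for i j
  proof -
    have s: "\<sigma> {i, j} \<in> G" "fst ` \<sigma> {i, j} = {i, j}" using \<sigma> P[OF ij] by auto
    have m: "?W i j \<in> \<sigma> {i, j}" "?W j i \<in> \<sigma> {i, j}"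
      using S[OF ij] S[OF ij(2,1)] ij(3) by (auto simp: insert_commute)
    have "x = ?W i j \<or> x = ?W j i" if x: "x \<in> \<sigma> {i, j}" for x
    proof -
      have "fst x \<in> {i, j}" using s(2) x by blast
      then show ?thesis using inj_onD[OF inj[OF s(1)] _ x m(1)] inj_onD[OF inj[OF s(1)] _ x m(2)] by auto
    qed
    then show ?thesis using m by blast
  qed
  have G: "G = pair_gens V ?W"
  proof (intro subset_antisym subsetI)
    fix \<tau> assume t: "\<tau> \<in> G"
    then have "fst ` \<tau> \<in> ?P" using im by blast
    then obtain i j where ij: "i \<in> V" "j \<in> V" "i \<noteq> j" "fst ` \<tau> = {i, j}" by (auto simp: pair_gens_def)
    then have "\<tau> = \<sigma> {i, j}" using inj_onD[OF inj_im _ t] \<sigma> P by simp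
    then have "\<tau> = {?W i j, ?W j i}" using gen[OF ij(1-3)] by simp
    then show "\<tau> \<in> pair_gens V ?W" using pair_gensI[OF ij(1-3), of ?W] by simp
  next
    fix \<tau> assume "\<tau> \<in> pair_gens V ?W"
    then obtain i j where ij: "i \<in> V" "j \<in> V" "i \<noteq> j" "\<tau> = {?W i j, ?W j i}" by (rule pair_gensE)
    then have "\<tau> = \<sigma> {i, j}" using gen[OF ij(1-3)] by simp
    then show "\<tau> \<in> G" using \<sigma> P[OF ij(1-3)] by simp
  qed
  have "copy_system V ?W"
    unfolding copy_system_def
  proof (intro ballI impI)
    fix j u v assume V: "j \<in> V" "u \<in> V" "v \<in> V" and ne: "u \<noteq> j" "v \<noteq> j" and sep: "?W j u \<noteq> ?W j v"
    have g: "{?W j u, ?W u j} \<in> G" "{?W j v, ?W v j} \<in> G" 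
      unfolding G using V ne by (auto intro!: pair_gensI[of _ _ _ ?W])
    have "\<exists>\<rho>\<in>G. \<rho> \<subseteq> {?W j u, ?W u j} \<union> {?W j v, ?W v j} - {?W j u, ?W j v}"
      by (rule ex[OF g]) (use sep in auto)
    then obtain \<rho> where r0: "\<rho> \<in> G" "\<rho> \<subseteq> {?W j u, ?W u j} \<union> {?W j v, ?W v j} - {?W j u, ?W j v}" by (rule bexE)
    have r: "\<rho> \<in> G" "\<rho> \<subseteq> {?W u j, ?W v j}" using r0 by auto
    obtain k l where kl: "k \<in> V" "l \<in> V" "k \<noteq> l" "\<rho> = {?W k l, ?W l k}"
      using r(1) unfolding G by (rule pair_gensE)
    \<comment> \<open>The two members of \<open>\<rho>\<close> have distinct indices, and only the
      indices \<open>u\<close> and \<open>v\<close> are available.\<close>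
    have "k = u \<and> l = v \<or> k = v \<and> l = u" using r(2) kl by auto
    then have "?W u v \<in> {?W u j, ?W v j}" "u \<noteq> v" using r(2) kl by auto
    then show "?W u j = ?W u v" by auto
  qed
  moreover have "Y = copies V ?W"
    unfolding UG[symmetric] G pair_gens_def copies_def by blast
  ultimately show ?thesis using that G by blast
qed

text \<open>In the copy system of a tree, \<open>k\<close> below is the neighbour of \<open>j\<close> in the direction of \<open>u\<close>.\<close>

definition tight :: "'a set \<Rightarrow> ('a \<Rightarrow> 'a \<Rightarrow> 'b) \<Rightarrow> bool" where
  "tight V W \<longleftrightarrow> (\<forall>j\<in>V. \<forall>u\<in>V. u \<noteq> j \<longrightarrow> (\<exists>k\<in>V. k \<noteq> j \<and> W j k = W j u \<and>
     (\<forall>v\<in>V. v \<noteq> j \<longrightarrow> v \<noteq> k \<longrightarrow> W j v = W j k \<longrightarrow> W k v \<noteq> W k j)))"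

lemma tightE:
  assumes "tight V W" "j \<in> V" "u \<in> V" "u \<noteq> j"
  obtains k where "k \<in> V" "k \<noteq> j" "W j k = W j u"
    "\<And>v. v \<in> V \<Longrightarrow> v \<noteq> j \<Longrightarrow> v \<noteq> k \<Longrightarrow> W j v = W j k \<Longrightarrow> W k v \<noteq> W k j"
  using assms unfolding tight_def by meson

section \<open>Tight systems admit no further separation\<close>

text \<open>Two copies of \<open>W j u = W j v\<close> would force an exchange generator over that
  of \<open>j\<close>. It contains a copy of \<open>W k j\<close>, with \<open>k\<close> the vertex
  given by tightness; but \<open>k\<close> sees \<open>j\<close> in another direction than
  \<open>u\<close> and \<open>v\<close>, so this copy occurs in neither of the two
  generators.\<close>

lemma tight_vertex_gens_maximal:
  assumes ix: "indexed V W ix" and tight: "tight V W" and lift: "is_lift (vertex_gens V W) Y G"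
  shows "inj_on fst Y"
proof (rule inj_onI, rule ccontr)
  fix x y assume xy: "x \<in> Y" "y \<in> Y" "fst x = fst y" "x \<noteq> y"
  note UG = is_liftD(2)[OF lift] and inj = is_liftD(3)[OF lift] and im = is_liftD(5)[OF lift]
    and ex = is_liftD(6)[OF lift]
  obtain \<sigma> \<tau> where st: "\<sigma> \<in> G" "x \<in> \<sigma>" "\<tau> \<in> G" "y \<in> \<tau>" using xy UG by blast
  have v: "\<exists>v\<in>V. fst ` \<rho> = vertex_gen V W v" if "\<rho> \<in> G" for \<rho>
  proof -
    have "fst ` \<rho> \<in> vertex_gens V W" unfolding im[symmetric] using that by (rule imageI)
    then show ?thesis unfolding vertex_gens_def by auto
  qed
  obtain u where u: "u \<in> V" "fst ` \<sigma> = vertex_gen V W u" using v[OF st(1)] by blast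
  obtain v where v': "v \<in> V" "fst ` \<tau> = vertex_gen V W v" using v[OF st(3)] by blast
  obtain \<rho> where r: "\<rho> \<in> G" "\<rho> \<subseteq> \<sigma> \<union> \<tau> - {x, y}" using ex[OF st(1,3,2,4) xy(4,3)] by (rule bexE)
  obtain w where w: "w \<in> V" "fst ` \<rho> = vertex_gen V W w" using v[OF r(1)] by blast
  define j where "j = ix (fst x)"
  have fx: "fst x \<in> vertex_gen V W u" using st(2) u(2) by blast
  have fy: "fst x \<in> vertex_gen V W v" unfolding xy(3) using st(4) v'(2) by blast
  have j: "j \<in> V" "j \<noteq> u" "j \<noteq> v" "fst x = W j u" "fst x = W j v"
    using in_vertex_gen[OF ix u(1) fx] in_vertex_gen[OF ix v'(1) fy] unfolding j_def by simp_all
  have sub: "a \<in> vertex_gen V W u \<or> a \<in> vertex_gen V W v" "a \<noteq> fst x" if a: "a \<in> vertex_gen V W w" for a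
  proof -
    obtain z where z: "z \<in> \<rho>" "a = fst z" using a unfolding w(2)[symmetric] by (rule imageE) simp
    then have zs: "z \<in> \<sigma> \<or> z \<in> \<tau>" "z \<noteq> x" "z \<noteq> y" using r(2) by auto
    then show "a \<in> vertex_gen V W u \<or> a \<in> vertex_gen V W v" using z(2) u(2) v'(2) by blast
    show "a \<noteq> fst x"
      using zs z(2) inj_onD[OF inj[OF st(1)], of z x] inj_onD[OF inj[OF st(3)], of z y] st(2,4) xy(3) by auto
  qed
  have [simp]: "w = j"
  proof (rule ccontr)
    assume "w \<noteq> j"
    then have m: "W j w \<in> vertex_gen V W w" using j(1) by (auto simp: vertex_gen_def)
    have "W j w = W j u \<or> W j w = W j v"
      using sub(1)[OF m] vertex_gen_mem[OF ix w(1) u(1) j(1)] vertex_gen_mem[OF ix w(1) v'(1) j(1)] \<open>w \<noteq> j\<close>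
      by auto
    then show False using sub(2)[OF m] j by auto
  qed
  obtain k where k: "k \<in> V" "k \<noteq> j" "W j k = W j u"
    "\<And>v. v \<in> V \<Longrightarrow> v \<noteq> j \<Longrightarrow> v \<noteq> k \<Longrightarrow> W j v = W j k \<Longrightarrow> W k v \<noteq> W k j"
    using tightE[OF tight j(1) u(1)] j(2) by metis
  have "W k j \<in> vertex_gen V W w" using k by (auto simp: vertex_gen_def)
  then have "k \<noteq> u \<and> W k j = W k u \<or> k \<noteq> v \<and> W k j = W k v"
    using sub(1)[of "W k j"] vertex_gen_mem[OF ix j(1) u(1) k(1,2)] vertex_gen_mem[OF ix j(1) v'(1) k(1,2)]
    by auto
  then show False using k(3) k(4)[of u] k(4)[of v] j u(1) v'(1) by metis
qed

text \<open>Every copy of \<open>W j u\<close> is compared with the copy \<open>z\<close> in the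
  generator over the pair of \<open>j\<close> and \<open>k\<close>. If another copy came from the
  pair of \<open>j\<close> and \<open>v\<close>, exchange would force the pair of \<open>v\<close>
  and \<open>k\<close>, hence \<open>W k v = W k j\<close>, against tightness.\<close>

lemma tight_pair_gens_maximal:
  assumes ix: "indexed V W ix" and tight: "tight V W" and lift: "is_lift (pair_gens V W) Y G"
  shows "inj_on fst Y"
proof (rule inj_onI)
  fix x y assume xy: "x \<in> Y" "y \<in> Y" "fst x = fst y"
  note UG = is_liftD(2)[OF lift] and inj = is_liftD(3)[OF lift] and im = is_liftD(5)[OF lift]
    and ex = is_liftD(6)[OF lift]
  have gen: "\<exists>j u. j \<in> V \<and> u \<in> V \<and> j \<noteq> u \<and> fst z = W j u \<and> fst ` \<sigma> = {W j u, W u j}"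
    if "\<sigma> \<in> G" "z \<in> \<sigma>" for \<sigma> z
  proof -
    have s: "fst ` \<sigma> \<in> pair_gens V W" "fst z \<in> fst ` \<sigma>"
      unfolding im[symmetric] using that by (auto intro: imageI)
    obtain j u where "j \<in> V" "u \<in> V" "j \<noteq> u" "fst z = W j u" "fst ` \<sigma> = {W j u, W u j}"
      using in_pair_gens[OF s] .
    then show ?thesis by blast
  qed
  obtain \<sigma> where s: "\<sigma> \<in> G" "x \<in> \<sigma>" using xy UG by blast
  obtain j u where ju: "j \<in> V" "u \<in> V" "j \<noteq> u" "fst x = W j u" using gen[OF s] by blast
  obtain k where k: "k \<in> V" "k \<noteq> j" "W j k = W j u"
    "\<And>v. v \<in> V \<Longrightarrow> v \<noteq> j \<Longrightarrow> v \<noteq> k \<Longrightarrow> W j v = W j k \<Longrightarrow> W k v \<noteq> W k j"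
    using tightE[OF tight ju(1,2)] ju(3) by metis
  have "{W j k, W k j} \<in> image fst ` G"
    unfolding im by (rule pair_gensI[OF ju(1) k(1) k(2)[symmetric]])
  then obtain \<pi> where p: "{W j k, W k j} = fst ` \<pi>" "\<pi> \<in> G" by (rule imageE)
  have "W j k \<in> fst ` \<pi>" unfolding p(1)[symmetric] by simp
  then obtain z where z: "W j k = fst z" "z \<in> \<pi>" by (rule imageE)
  have "a = z" if a: "a \<in> Y" "fst a = fst x" for a
  proof (rule ccontr)
    assume az: "a \<noteq> z"
    obtain \<tau> where t: "\<tau> \<in> G" "a \<in> \<tau>" using a UG by blast
    obtain i v where iv: "i \<in> V" "v \<in> V" "i \<noteq> v" "fst a = W i v" "fst ` \<tau> = {W i v, W v i}"
      using gen[OF t] by blast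
    have ia: "ix (fst a) = i" "ix (fst x) = j" using indexedD[OF ix] iv ju by auto
    have [simp]: "i = j" using ia a(2) by simp
    have az': "fst a = fst z" using a(2) ju(4) k(3) z(1) by simp
    obtain \<rho> where r: "\<rho> \<in> G" "\<rho> \<subseteq> \<tau> \<union> \<pi> - {a, z}" 
      using ex[OF t(1) p(2) t(2) z(2) az az'] by (rule bexE)
    have sub: "fst b \<in> {W v j, W k j}" if b: "b \<in> \<rho>" for b
    proof -
      have "b \<in> \<tau> \<or> b \<in> \<pi>" "b \<noteq> a" "b \<noteq> z" using r(2) b by auto
      then have "fst b \<noteq> fst a" "fst b \<in> fst ` \<tau> \<union> fst ` \<pi>"
        using inj_onD[OF inj[OF t(1)], of b a] inj_onD[OF inj[OF p(2)], of b z] t(2) z(2) az' by auto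
      then show ?thesis using iv(4,5) p(1) az' z(1) by auto
    qed
    have "fst ` \<rho> \<in> pair_gens V W" unfolding im[symmetric] using r(1) by (rule imageI)
    then obtain c d where cd: "c \<in> V" "d \<in> V" "c \<noteq> d" "fst ` \<rho> = {W c d, W d c}"
      by (rule pair_gensE)
    have "fst ` \<rho> \<subseteq> {W v j, W k j}" using sub by blast
    then have subs: "{W c d, W d c} \<subseteq> {W v j, W k j}" unfolding cd(4) .
    then have "ix ` {W c d, W d c} \<subseteq> ix ` {W v j, W k j}" by (rule image_mono)
    moreover have ixs: "ix (W v j) = v" "ix (W k j) = k" "ix (W c d) = c" "ix (W d c) = d"
      using indexedD[OF ix] iv k(1,2) ju(1) cd by auto
    ultimately have "c = v \<and> d = k \<or> c = k \<and> d = v" using cd(3) by auto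
    then have "W k v \<in> {W v j, W k j}" "v \<noteq> k" using subs cd(3) by auto
    moreover have "ix (W k v) = k" using indexedD[OF ix k(1) iv(2)] \<open>v \<noteq> k\<close> by simp
    ultimately have "W k v = W k j" using ixs by auto
    moreover have "W j v = W j k" using iv(4) a(2) ju(4) k(3) by simp
    ultimately show False using k(4)[OF iv(2)] iv(3) \<open>v \<noteq> k\<close> by auto
  qed
  then show "x = y" using xy by metis
qed

section \<open>Unseparated pairs\<close>

text \<open>The vertex generators of \<open>i\<close> and \<open>k\<close> then share all variables
  except \<open>W k i\<close> and \<open>W i k\<close>, so they satisfy a linear syzygy.\<close>

definition linear_pairs :: "'a set \<Rightarrow> ('a \<Rightarrow> 'a \<Rightarrow> 'b) \<Rightarrow> 'a set set" where
  "linear_pairs V W = {{i, k} | i k. i \<in> V \<and> k \<in> V \<and> i \<noteq> k \<and>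
     (\<forall>j\<in>V. j \<noteq> i \<longrightarrow> j \<noteq> k \<longrightarrow> W j i = W j k)}"

lemma linear_pairsD:
  assumes "{i, k} \<in> linear_pairs V W" "j \<in> V" "j \<noteq> i" "j \<noteq> k"
  shows "W j i = W j k"
  using assms unfolding linear_pairs_def by (auto simp: doubleton_eq_iff)

lemma reachable_refl: "(u, u) \<in> reachable_by E"
  by (simp add: reachable_by_def)

lemma reachable_trans: "(u, v) \<in> reachable_by E \<Longrightarrow> (v, w) \<in> reachable_by E \<Longrightarrow> (u, w) \<in> reachable_by E"
  unfolding reachable_by_def by (rule rtrancl_trans)

lemma reachable_edge: "{u, v} \<in> E \<Longrightarrow> (u, v) \<in> reachable_by E"
  unfolding reachable_by_def by auto

lemma reachable_sym: "(u, v) \<in> reachable_by E \<Longrightarrow> (v, u) \<in> reachable_by E"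
proof -
  have "sym {(u, v). {u, v} \<in> E}" by (auto intro!: symI simp: insert_commute)
  then show "(u, v) \<in> reachable_by E \<Longrightarrow> (v, u) \<in> reachable_by E"
    unfolding reachable_by_def by (meson sym_rtrancl symD)
qed

lemma reachable_mono: "E \<subseteq> F \<Longrightarrow> (u, v) \<in> reachable_by E \<Longrightarrow> (u, v) \<in> reachable_by F"
  unfolding reachable_by_def by (rule rtrancl_mono[THEN subsetD]) auto

lemma reachable_induct [consumes 1, case_names refl step]:
  assumes "(u, v) \<in> reachable_by E" "P u"
    "\<And>y z. (u, y) \<in> reachable_by E \<Longrightarrow> {y, z} \<in> E \<Longrightarrow> P y \<Longrightarrow> P z"
  shows "P v"
  using assms(1) unfolding reachable_by_def
proof (induction rule: rtrancl_induct)
  case base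
  show ?case by (rule assms(2))
next
  case (step y z)
  then show ?case using assms(3)[of y z] by (simp add: reachable_by_def)
qed

text \<open>Induction on the number of separators: if \<open>j\<close> separates \<open>u\<close>
  from \<open>v\<close>, the pairs of \<open>j\<close> with \<open>u\<close> and with
  \<open>v\<close> have fewer, so both can be connected first.\<close>

lemma linear_pairs_connected:
  assumes V: "finite V" and W: "copy_system V W" and uv: "u \<in> V" "v \<in> V"
  shows "(u, v) \<in> reachable_by (linear_pairs V W)"
  using uv
proof (induction "card {j \<in> V. j \<noteq> u \<and> j \<noteq> v \<and> W j u \<noteq> W j v}" arbitrary: u v rule: less_induct)
  case less
  let ?sep = "\<lambda>u v. {j \<in> V. j \<noteq> u \<and> j \<noteq> v \<and> W j u \<noteq> W j v}"
  show ?case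
  proof (cases "u = v \<or> ?sep u v = {}")
    case True
    then have "u = v \<or> {u, v} \<in> linear_pairs V W"
      using less.prems unfolding linear_pairs_def by blast
    then show ?thesis using reachable_edge reachable_refl by metis
  next
    case False
    then obtain j where j: "j \<in> V" "j \<noteq> u" "j \<noteq> v" "W j u \<noteq> W j v" by blast
    have shrink: "card (?sep a j) < card (?sep u v)"
      if ab: "a = u \<and> b = v \<or> a = v \<and> b = u" for a b
    proof (rule psubset_card_mono)
      show "finite (?sep u v)" using V by simp
      have abV: "a \<in> V" "b \<in> V" "j \<noteq> a" "j \<noteq> b" "W j a \<noteq> W j b" using ab j less.prems by auto
      \<comment> \<open>If \<open>i\<close> separates \<open>a\<close> from \<open>j\<close>, it
        cannot separate \<open>j\<close> from \<open>b\<close> as well, so it separates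
        \<open>a\<close> from \<open>b\<close>. It differs from \<open>b\<close>, since
        \<open>b\<close> sees \<open>a\<close> and \<open>j\<close> alike.\<close>
      have "i \<in> ?sep u v" if i: "i \<in> ?sep a j" for i
      proof -
        have i': "i \<in> V" "i \<noteq> a" "i \<noteq> j" "W i a \<noteq> W i j" using i by auto
        have "i \<noteq> b" using copy_systemD[OF W, of j b a] abV j(1) i' by metis
        then have "W i j = W i b"
          using copy_system_separator[OF W j(1) abV(1,2) i'(1)] abV i' by metis
        then show ?thesis using i' ab \<open>i \<noteq> b\<close> by auto
      qed
      moreover have "j \<in> ?sep u v" "j \<notin> ?sep a j" using j by auto
      ultimately show "?sep a j \<subset> ?sep u v" by blast
    qed
    have 1: "(u, j) \<in> reachable_by (linear_pairs V W)"
      by (rule less.hyps[OF shrink[of u v] less.prems(1) j(1)]) simp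
    have 2: "(v, j) \<in> reachable_by (linear_pairs V W)"
      by (rule less.hyps[OF shrink[of v u] less.prems(2) j(1)]) simp
    show ?thesis using reachable_trans[OF 1 reachable_sym[OF 2]] .
  qed
qed

section \<open>Spanning trees\<close>

lemma cycle_edge_removal:
  assumes cyc: "is_cycle T vs"
  obtains d where "d \<in> T" "\<And>u v. (u, v) \<in> reachable_by T \<Longrightarrow> (u, v) \<in> reachable_by (T - {d})"
proof -
  let ?L = "length vs"
  have L: "?L \<ge> 3" and dist: "distinct vs"
    and edge: "\<And>i. i < ?L \<Longrightarrow> {vs ! i, vs ! (Suc i mod ?L)} \<in> T"
    using cyc by (auto simp: is_cycle_def)
  have "Suc (?L - 1) = ?L" using L by linarith
  then have mod: "Suc (?L - 1) mod ?L = 0" by (simp only: mod_self)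
  \<comment> \<open>The closing edge of the cycle; the remaining edges form a path between its ends
    that replaces it.\<close>
  define d where "d = {vs ! (?L - 1), vs ! 0}"
  have dT: "d \<in> T" using edge[of "?L - 1"] L unfolding mod d_def by linarith
  have path: "i < ?L \<Longrightarrow> (vs ! 0, vs ! i) \<in> reachable_by (T - {d})" for i
  proof (induction i)
    case 0
    show ?case by (rule reachable_refl)
  next
    case (Suc i)
    have "{vs ! i, vs ! Suc i} \<in> T" using edge[of i] Suc.prems by simp
    moreover have "{vs ! i, vs ! Suc i} \<noteq> d"
    proof
      assume "{vs ! i, vs ! Suc i} = d"
      then have "vs ! i = vs ! (?L - 1) \<or> vs ! i = vs ! 0 \<and> vs ! Suc i = vs ! (?L - 1)"
        by (auto simp: d_def doubleton_eq_iff)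
      \<comment> \<open>The first case contradicts the bound on \<open>Suc i\<close>, the second the
        length of at least 3.\<close>
      then have "i = ?L - 1 \<or> i = 0 \<and> Suc i = ?L - 1"
        using nth_eq_iff_index_eq[OF dist, of i "?L - 1"] nth_eq_iff_index_eq[OF dist, of i 0]
          nth_eq_iff_index_eq[OF dist, of "Suc i" "?L - 1"] Suc.prems L by linarith
      then show False using Suc.prems L by linarith
    qed
    ultimately have "(vs ! i, vs ! Suc i) \<in> reachable_by (T - {d})" by (intro reachable_edge) simp
    then show ?case using Suc reachable_trans by (metis Suc_lessD)
  qed
  have end_path: "(vs ! 0, vs ! (?L - 1)) \<in> reachable_by (T - {d})" using path L by simp
  have "(u, v) \<in> reachable_by (T - {d})" if "(u, v) \<in> reachable_by T" for u v
    using that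
  proof (induction rule: reachable_induct)
    case refl
    show ?case by (rule reachable_refl)
  next
    case (step y z)
    have "(y, z) \<in> reachable_by (T - {d})"
    proof (cases "{y, z} = d")
      case True
      then show ?thesis using end_path reachable_sym[OF end_path] by (auto simp: d_def doubleton_eq_iff)
    next
      case False
      then show ?thesis using step by (intro reachable_edge) simp
    qed
    then show ?case using step.IH reachable_trans by metis
  qed
  then show ?thesis using that dT by blast
qed

lemma spanning_tree_exists:
  assumes "E \<subseteq> complete_edges n" "\<And>u v. u \<in> {1..n} \<Longrightarrow> v \<in> {1..n} \<Longrightarrow> (u, v) \<in> reachable_by E"
  obtains T where "T \<subseteq> E" "T \<in> spanning_trees n"
proof -
  have "complete_edges n \<subseteq> Pow {1..n}" by (auto simp: complete_edges_def)
  then have fin: "finite E" using assms(1) by (meson finite_Pow_iff finite_atLeastAtMost finite_subset)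
  have "\<exists>T\<subseteq>E. T \<in> spanning_trees n"
    using fin assms
  proof (induction "card E" arbitrary: E rule: less_induct)
    case less
    show ?case
    proof (cases "\<exists>vs. is_cycle E vs")
      case True
      then obtain vs where "is_cycle E vs" by auto
      then obtain d where d: "d \<in> E" "\<And>u v. (u, v) \<in> reachable_by E \<Longrightarrow> (u, v) \<in> reachable_by (E - {d})"
        by (rule cycle_edge_removal) blast
      have "\<exists>T\<subseteq>E - {d}. T \<in> spanning_trees n"
      proof (rule less.hyps)
        show "card (E - {d}) < card E" using d(1) less.prems(1) by (meson card_Diff1_less)
      qed (use less.prems d(2) in auto)
      then show ?thesis by blast
    next
      case False
      then have "E \<in> spanning_trees n" using less.prems by (auto simp: spanning_trees_def)
      then show ?thesis by blast
    qed
  qed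
  then show ?thesis using that by blast
qed

lemma reachable_simple_path:
  assumes "(u, v) \<in> reachable_by E"
  shows "\<exists>vs. vs \<noteq> [] \<and> distinct vs \<and> hd vs = u \<and> last vs = v \<and>
    (\<forall>i. Suc i < length vs \<longrightarrow> {vs ! i, vs ! Suc i} \<in> E)"
  using assms
proof (induction rule: reachable_induct)
  case refl
  show ?case by (rule exI[of _ "[u]"]) simp
next
  case (step y z)
  then obtain vs where vs: "vs \<noteq> []" "distinct vs" "hd vs = u" "last vs = y"
    "\<And>i. Suc i < length vs \<Longrightarrow> {vs ! i, vs ! Suc i} \<in> E" by blast
  show ?case
  proof (cases "z \<in> set vs")
    case True
    then obtain k where k: "k < length vs" "vs ! k = z" by (auto simp: in_set_conv_nth)
    let ?ws = "take (Suc k) vs"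
    have "last ?ws = z" using k by (simp add: take_Suc_conv_app_nth)
    moreover have "?ws \<noteq> []" "distinct ?ws" "hd ?ws = u" using vs by auto
    moreover have "\<forall>i. Suc i < length ?ws \<longrightarrow> {?ws ! i, ?ws ! Suc i} \<in> E" using vs(5) by simp
    ultimately show ?thesis by blast
  next
    case False
    let ?ws = "vs @ [z]"
    have "{?ws ! i, ?ws ! Suc i} \<in> E" if "Suc i < length ?ws" for i
    proof (cases "Suc i < length vs")
      case True
      then show ?thesis using vs(5)[of i] by (simp add: nth_append)
    next
      case F: False
      then have i: "Suc i = length vs" using that by simp
      then have "vs ! i = y" using vs(1,4) by (metis diff_Suc_1 last_conv_nth)
      then show ?thesis using i step(2) by (simp add: nth_append)
    qed
    moreover have "?ws \<noteq> []" "distinct ?ws" "hd ?ws = u" "last ?ws = z" using vs False by auto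
    ultimately show ?thesis by blast
  qed
qed

text \<open>A simple path between the ends avoiding the edge would close up to a cycle. It has at
  least three vertices, since a path of two would use the removed edge.\<close>

lemma acyclic_bridge:
  assumes T: "\<nexists>vs. is_cycle T vs" and jk: "{j, k} \<in> T" "j \<noteq> k"
  shows "(j, k) \<notin> reachable_by (T - {{j, k}})"
proof
  assume "(j, k) \<in> reachable_by (T - {{j, k}})"
  from reachable_simple_path[OF this] obtain vs where vs: "vs \<noteq> []" "distinct vs" "hd vs = j" "last vs = k"
    "\<And>i. Suc i < length vs \<Longrightarrow> {vs ! i, vs ! Suc i} \<in> T - {{j, k}}" by blast
  let ?L = "length vs"
  have hl: "vs ! 0 = j" "vs ! (?L - 1) = k" using vs by (auto simp: hd_conv_nth last_conv_nth)
  have "?L \<noteq> 0" "?L \<noteq> 1" using vs(1) hl jk(2) by auto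
  moreover have "?L \<noteq> 2" using vs(5)[of 0] hl by auto
  ultimately have L: "?L \<ge> 3" by linarith
  have "{vs ! i, vs ! (Suc i mod ?L)} \<in> T" if i: "i < ?L" for i
  proof (cases "Suc i < ?L")
    case True
    then show ?thesis using vs(5)[of i] by simp
  next
    case False
    then have "i = ?L - 1" "Suc i = ?L" using i by auto
    then show ?thesis using hl jk(1) by (simp add: insert_commute)
  qed
  then have "is_cycle T vs" using L vs(2) by (simp add: is_cycle_def)
  then show False using T by blast
qed

text \<open>The walk never meets \<open>j\<close>, so \<open>f\<close> is compared only along edges
  avoiding \<open>j\<close>. It serves for functions that are constant across such edges, namely the
  directions and the tags at \<open>j\<close>.\<close>

lemma reachable_invariant:
  assumes uv: "(u, v) \<in> reachable_by F" and j: "(u, j) \<notin> reachable_by F"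
    and f: "\<And>p q. {p, q} \<in> F \<Longrightarrow> p \<noteq> j \<Longrightarrow> q \<noteq> j \<Longrightarrow> f p = f q"
  shows "f u = f v"
  using uv
proof (induction rule: reachable_induct)
  case refl
  show ?case ..
next
  case (step y z)
  have "(u, z) \<in> reachable_by F" using step(1) reachable_edge[OF step(2)] by (rule reachable_trans)
  then have "y \<noteq> j" "z \<noteq> j" using j step(1) by auto
  then show ?case using f[OF step(2)] step(3) by simp
qed

section \<open>Directions in a labelled tree\<close>

text \<open>The index of the edge at \<open>j\<close> that begins the path to \<open>v\<close>: a
  label \<open>(j, i)\<close> of \<open>v\<close> says that the edge \<open>e i\<close> at
  \<open>j\<close> separates \<open>v\<close> from \<open>j\<close>.\<close>

definition tree_dir :: "nat \<Rightarrow> (nat \<Rightarrow> nat set) \<Rightarrow> nat \<Rightarrow> nat \<Rightarrow> nat" where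
  "tree_dir n e j v = (THE i. (j, i) \<in> tree_labels n e v)"

abbreviation tree_copy :: "nat \<Rightarrow> (nat \<Rightarrow> nat set) \<Rightarrow> nat \<Rightarrow> nat \<Rightarrow> nat \<times> nat" where
  "tree_copy n e j v \<equiv> (j, tree_dir n e j v)"

locale labelled_tree =
  fixes n :: nat and T :: "nat set set" and e :: "nat \<Rightarrow> nat set"
  assumes tree: "T \<in> spanning_trees n" and bij: "bij_betw e {1..n-1} T"
begin

abbreviation "verts \<equiv> {1..n}"
abbreviation "dir \<equiv> tree_dir n e"

lemma im: "e ` {1..n-1} = T"
  using bij by (simp add: bij_betw_def)

lemma connected: "u \<in> verts \<Longrightarrow> v \<in> verts \<Longrightarrow> (u, v) \<in> reachable_by T"
  using tree by (simp add: spanning_trees_def)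

lemma edge_cases:
  assumes "d \<in> T" "j \<in> d"
  obtains k where "d = {j, k}" "j \<noteq> k" "j \<in> verts" "k \<in> verts"
proof -
  have "d \<in> complete_edges n" using tree assms(1) by (auto simp: spanning_trees_def)
  then obtain u v where uv: "d = {u, v}" "u \<in> verts" "v \<in> verts" "u \<noteq> v" by (auto simp: complete_edges_def)
  show ?thesis
  proof (cases "j = u")
    case True
    then show ?thesis using that[of v] uv by auto
  next
    case False
    then show ?thesis using that[of u] uv assms(2) by auto
  qed
qed

lemma bridge: "{j, k} \<in> T \<Longrightarrow> j \<noteq> k \<Longrightarrow> (j, k) \<notin> reachable_by (T - {{j, k}})"
  using tree by (intro acyclic_bridge) (simp_all add: spanning_trees_def)

lemma label_iff:
  "(j, i) \<in> tree_labels n e v \<longleftrightarrow> i \<in> {1..n-1} \<and> j \<in> e i \<and> (v, j) \<notin> reachable_by (T - {e i})"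
  unfolding tree_labels_def im by auto

lemma bridge_sides:
  assumes "{j, k} \<in> T" "v \<in> verts"
  shows "(j, v) \<in> reachable_by (T - {{j, k}}) \<or> (k, v) \<in> reachable_by (T - {{j, k}})"
proof -
  have "j \<in> verts" using edge_cases[OF assms(1), of j] by auto
  from connected[OF this assms(2)] show ?thesis
  proof (induction rule: reachable_induct)
    case refl
    then show ?case by (simp add: reachable_refl)
  next
    case (step y z)
    show ?case
    proof (cases "{y, z} = {j, k}")
      case True
      then have "z = j \<or> z = k" by auto
      then show ?thesis using reachable_refl by metis
    next
      case False
      then have "(y, z) \<in> reachable_by (T - {{j, k}})" using step(2) by (intro reachable_edge) simp
      then show ?thesis using step(3) reachable_trans by metis
    qed
  qed
qed

text \<open>The edge is the last one by which a walk from \<open>j\<close> to \<open>v\<close>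
  leaves \<open>j\<close>; every return to \<open>j\<close> restarts the choice.\<close>

lemma first_edge:
  assumes "j \<in> verts" "v \<in> verts" "v \<noteq> j"
  obtains k where "{j, k} \<in> T" "j \<noteq> k" "(k, v) \<in> reachable_by {d \<in> T. j \<notin> d}"
proof -
  have "v \<noteq> j \<longrightarrow> (\<exists>k. {j, k} \<in> T \<and> j \<noteq> k \<and> (k, v) \<in> reachable_by {d \<in> T. j \<notin> d})"
    using connected[OF assms(1,2)]
  proof (induction rule: reachable_induct)
    case refl
    then show ?case by simp
  next
    case (step y z)
    show ?case
    proof
      assume z: "z \<noteq> j"
      show "\<exists>k. {j, k} \<in> T \<and> j \<noteq> k \<and> (k, z) \<in> reachable_by {d \<in> T. j \<notin> d}"
      proof (cases "y = j")
        case True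
        then have "{j, z} \<in> T \<and> j \<noteq> z \<and> (z, z) \<in> reachable_by {d \<in> T. j \<notin> d}"
          using step(2) z by (simp add: reachable_refl)
        then show ?thesis by (rule exI)
      next
        case False
        then obtain k where k: "{j, k} \<in> T" "j \<noteq> k" "(k, y) \<in> reachable_by {d \<in> T. j \<notin> d}"
          using step(3) by blast
        have "(y, z) \<in> reachable_by {d \<in> T. j \<notin> d}"
          using step(2) z False by (intro reachable_edge) simp
        then have "(k, z) \<in> reachable_by {d \<in> T. j \<notin> d}" by (rule reachable_trans[OF k(3)])
        then show ?thesis using k(1,2) by (intro exI conjI)
      qed
    qed
  qed
  then show ?thesis using that assms(3) by blast
qed

text \<open>The first edge towards \<open>v\<close> is a bridge, so it gives a label. Removing any
  other edge at \<open>j\<close> leaves \<open>v\<close> joined to \<open>j\<close> through that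
  first edge.\<close>

lemma label_unique:
  assumes "j \<in> verts" "v \<in> verts" "v \<noteq> j"
  shows "\<exists>!i. (j, i) \<in> tree_labels n e v"
proof -
  obtain k where k: "{j, k} \<in> T" "j \<noteq> k" "(k, v) \<in> reachable_by {d \<in> T. j \<notin> d}"
    using first_edge[OF assms] .
  obtain i where i: "i \<in> {1..n-1}" "e i = {j, k}" using k(1) im by (metis imageE)
  have kv: "(k, v) \<in> reachable_by (T - {d})" if "j \<in> d" for d
    using reachable_mono[OF _ k(3), of "T - {d}"] that by auto
  show ?thesis
  proof (rule ex1I)
    have "(v, j) \<notin> reachable_by (T - {e i})"
    proof
      assume "(v, j) \<in> reachable_by (T - {e i})"
      then have "(k, j) \<in> reachable_by (T - {{j, k}})"
        using reachable_trans[OF kv[of "{j, k}"]] i(2) by simp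
      then show False using bridge[OF k(1,2)] reachable_sym by metis
    qed
    then show "(j, i) \<in> tree_labels n e v" using i unfolding label_iff by simp
    fix i' assume "(j, i') \<in> tree_labels n e v"
    then have i': "i' \<in> {1..n-1}" "j \<in> e i'" "(v, j) \<notin> reachable_by (T - {e i'})"
      unfolding label_iff by auto
    show "i' = i"
    proof (rule ccontr)
      assume "i' \<noteq> i"
      then have "e i' \<noteq> e i" using bij i'(1) i(1) by (auto simp: bij_betw_def dest: inj_onD)
      then have "(j, k) \<in> reachable_by (T - {e i'})" using k(1) i(2) by (intro reachable_edge) auto
      from reachable_sym[OF reachable_trans[OF this kv[OF i'(2)]]] show False using i'(3) by simp
    qed
  qed
qed

lemma label_dir:
  assumes "j \<in> verts" "v \<in> verts" "v \<noteq> j"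
  shows "(j, i) \<in> tree_labels n e v \<longleftrightarrow> dir j v = i"
  using theI'[OF label_unique[OF assms]] label_unique[OF assms] unfolding tree_dir_def by blast

lemma labels_eq: "v \<in> verts \<Longrightarrow> tree_labels n e v = vertex_gen verts (tree_copy n e) v"
proof (intro subset_antisym subsetI)
  fix x assume v: "v \<in> verts" and x: "x \<in> tree_labels n e v"
  obtain j i where ji: "x = (j, i)" by (rule prod.exhaust)
  then have l: "i \<in> {1..n-1}" "j \<in> e i" "(v, j) \<notin> reachable_by (T - {e i})"
    using x label_iff[of j i v] by blast+
  have "e i \<in> T" using l(1) im by auto
  then have j: "j \<in> verts" using l(2) by (rule edge_cases) auto
  have "v \<noteq> j" using l(3) reachable_refl by metis
  then have "dir j v = i" using label_dir[OF j v] x ji by auto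
  then show "x \<in> vertex_gen verts (tree_copy n e) v"
    using j \<open>v \<noteq> j\<close> ji by (auto simp: vertex_gen_def)
next
  fix x assume v: "v \<in> verts" and "x \<in> vertex_gen verts (tree_copy n e) v"
  then obtain j where "j \<in> verts" "j \<noteq> v" "x = (j, dir j v)"
    unfolding vertex_gen_def by blast
  then show "x \<in> tree_labels n e v" using label_dir[of j v "dir j v"] v by auto
qed

lemma dir_edge:
  assumes "j \<in> verts" "v \<in> verts" "v \<noteq> j"
  shows "dir j v \<in> {1..n-1}" "j \<in> e (dir j v)" "e (dir j v) \<in> T" "(v, j) \<notin> reachable_by (T - {e (dir j v)})"
  using label_dir[OF assms, of "dir j v"] im unfolding label_iff by auto

lemma dir_eqI:
  assumes "j \<in> verts" "v \<in> verts" "i \<in> {1..n-1}" "j \<in> e i" "(v, j) \<notin> reachable_by (T - {e i})"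
  shows "dir j v = i"
proof -
  have "v \<noteq> j" using assms(5) reachable_refl by metis
  then show ?thesis using label_dir[OF assms(1,2)] assms unfolding label_iff by auto
qed

lemma dir_neighbour:
  assumes "i \<in> {1..n-1}" "e i = {j, k}" "j \<noteq> k" "j \<in> verts" "k \<in> verts"
  shows "dir j k = i"
proof (rule dir_eqI)
  have "{j, k} \<in> T" using assms(1,2) im by auto
  then show "(k, j) \<notin> reachable_by (T - {e i})"
    using bridge[of j k] assms(2,3) reachable_sym by metis
qed (use assms in auto)

text \<open>The vertex \<open>u\<close> lies on one side of the edge, so the edge cannot lead
  towards \<open>u\<close> from both of its ends.\<close>

lemma dir_opposite:
  assumes "e (dir j u) = {j, k}" "j \<in> verts" "k \<in> verts" "u \<in> verts" "u \<noteq> j" "u \<noteq> k"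
  shows "dir k u \<noteq> dir j u"
proof
  assume eq: "dir k u = dir j u"
  note ju = dir_edge[OF assms(2,4,5)] and ku = dir_edge[OF assms(3,4,6)]
  have "{j, k} \<in> T" using ju(3) assms(1) by simp
  from bridge_sides[OF this assms(4)] have "(u, j) \<in> reachable_by (T - {{j, k}}) \<or> (u, k) \<in> reachable_by (T - {{j, k}})"
    using reachable_sym by metis
  then show False using ju(4) ku(4) unfolding eq assms(1) by blast
qed

text \<open>The edge does not contain \<open>l\<close>, so it survives the removal of any edge at
  \<open>l\<close>.\<close>

lemma dir_across_edge:
  assumes "{j, k} \<in> T" "l \<in> verts" "l \<noteq> j" "l \<noteq> k"
  shows "dir l j = dir l k"
proof -
  have V: "j \<in> verts" "k \<in> verts"
    using edge_cases[OF assms(1), of j] edge_cases[OF assms(1), of k] by auto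
  note lj = dir_edge[OF assms(2) V(1) assms(3)[symmetric]]
  have "(j, k) \<in> reachable_by (T - {e (dir l j)})"
    using assms lj(2) by (intro reachable_edge) auto
  then have "(k, l) \<notin> reachable_by (T - {e (dir l j)})" using lj(4) reachable_trans by metis
  from dir_eqI[OF assms(2) V(2) lj(1,2) this] show ?thesis by simp
qed

lemma edge_iff:
  assumes V: "j \<in> verts" "k \<in> verts" "j \<noteq> k"
  shows "{j, k} \<in> T \<longleftrightarrow> (\<forall>l\<in>verts. l \<noteq> j \<longrightarrow> l \<noteq> k \<longrightarrow> dir l j = dir l k)"
proof
  assume "{j, k} \<in> T"
  then show "\<forall>l\<in>verts. l \<noteq> j \<longrightarrow> l \<noteq> k \<longrightarrow> dir l j = dir l k" using dir_across_edge by blast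
next
  assume all: "\<forall>l\<in>verts. l \<noteq> j \<longrightarrow> l \<noteq> k \<longrightarrow> dir l j = dir l k"
  show "{j, k} \<in> T"
  proof (rule ccontr)
    assume no: "{j, k} \<notin> T"
    note jk = dir_edge[OF V(1,2) V(3)[symmetric]]
    \<comment> \<open>The neighbour of \<open>j\<close> towards \<open>k\<close>. Without an edge
      between \<open>j\<close> and \<open>k\<close> it is a third vertex, and it separates
      them.\<close>
    obtain l where l: "e (dir j k) = {j, l}" "j \<noteq> l" "l \<in> verts" using edge_cases[OF jk(3,2)] by metis
    have "l \<noteq> k" using no jk(3) l(1) by auto
    have "dir l k \<noteq> dir j k" using dir_opposite[OF l(1) V(1) l(3) V(2)] V(3) \<open>l \<noteq> k\<close> by auto
    moreover have "dir l j = dir j k"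
      by (rule dir_neighbour[OF jk(1)]) (use l V in auto)
    ultimately show False using all l \<open>l \<noteq> k\<close> by metis
  qed
qed

lemma dir_constant:
  assumes f: "\<And>p q. {p, q} \<in> T \<Longrightarrow> p \<noteq> j \<Longrightarrow> q \<noteq> j \<Longrightarrow> f p = f q"
    and V: "j \<in> verts" "u \<in> verts" "v \<in> verts" "u \<noteq> j" "v \<noteq> j" and eq: "dir j u = dir j v"
  shows "f u = f v"
proof -
  note ju = dir_edge[OF V(1,2,4)] and jv = dir_edge[OF V(1,3,5)]
  obtain k where k: "e (dir j u) = {j, k}" using edge_cases[OF ju(3,2)] by metis
  \<comment> \<open>Whatever the edge cuts off from \<open>j\<close> is on the side of
    \<open>k\<close>, so \<open>u\<close> and \<open>v\<close> are joined without passing through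
    \<open>j\<close>.\<close>
  have "(k, w) \<in> reachable_by (T - {e (dir j u)})"
    if "w \<in> verts" "(w, j) \<notin> reachable_by (T - {e (dir j u)})" for w
    using bridge_sides[of j k w] ju(3) that reachable_sym unfolding k by metis
  then have "(u, v) \<in> reachable_by (T - {e (dir j u)})"
    using V ju(4) jv(4) eq reachable_trans reachable_sym by metis
  then show ?thesis by (rule reachable_invariant[OF _ ju(4)]) (use f in auto)
qed

lemma tree_copy_system: "copy_system verts (tree_copy n e)"
  unfolding copy_system_def
proof (intro ballI impI)
  fix j u v assume V: "j \<in> verts" "u \<in> verts" "v \<in> verts" "u \<noteq> j" "v \<noteq> j" and ne: "tree_copy n e j u \<noteq> tree_copy n e j v"
  note uj = dir_edge[OF V(2,1) V(4)[symmetric]]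
  let ?F = "T - {e (dir u j)}"
  \<comment> \<open>Otherwise a walk from \<open>u\<close> to \<open>v\<close> would avoid the edge
    that leads from \<open>u\<close> to \<open>j\<close>, hence avoid \<open>j\<close>, and
    \<open>j\<close> would see both in one direction.\<close>
  have "(v, u) \<notin> reachable_by ?F"
  proof
    assume "(v, u) \<in> reachable_by ?F"
    then have uv: "(u, v) \<in> reachable_by ?F" by (rule reachable_sym)
    have "(u, j) \<notin> reachable_by ?F" using uj(4) reachable_sym by metis
    from reachable_invariant[OF uv this, of "dir j"] have "dir j u = dir j v"
      using dir_across_edge V(1) by blast
    then show False using ne by simp
  qed
  from dir_eqI[OF V(2,3) uj(1,2) this] show "tree_copy n e u j = tree_copy n e u v" by simp
qed

lemma tree_copy_indexed: "indexed verts (tree_copy n e) fst"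
  by (simp add: indexed_def)

lemma tree_copy_tight: "tight verts (tree_copy n e)"
  unfolding tight_def
proof (intro ballI impI)
  fix j u assume V: "j \<in> verts" "u \<in> verts" "u \<noteq> j"
  note ju = dir_edge[OF V]
  obtain k where k: "e (dir j u) = {j, k}" "j \<noteq> k" "k \<in> verts" using edge_cases[OF ju(3,2)] by metis
  have jk: "dir j k = dir j u" using dir_neighbour[OF ju(1) k(1,2) V(1) k(3)] .
  have kj: "dir k j = dir j u"
    by (rule dir_neighbour[OF ju(1)]) (use k V in auto)
  have "dir k v \<noteq> dir k j" if v: "v \<in> verts" "v \<noteq> j" "v \<noteq> k" "dir j v = dir j k" for v
    using dir_opposite[of j v k] k v V(1) jk kj by metis
  then show "\<exists>k\<in>verts. k \<noteq> j \<and> tree_copy n e j k = tree_copy n e j u \<and>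
      (\<forall>v\<in>verts. v \<noteq> j \<longrightarrow> v \<noteq> k \<longrightarrow> tree_copy n e j v = tree_copy n e j k \<longrightarrow> tree_copy n e k v \<noteq> tree_copy n e k j)"
    using k jk by (intro bexI[of _ k]) auto
qed

lemma tree_vars_eq: "tree_vars n e = copies verts (tree_copy n e)"
proof (intro subset_antisym subsetI)
  fix x assume "x \<in> tree_vars n e"
  then obtain j i where x: "x = (j, i)" "i \<in> {1..n-1}" "j \<in> e i" by (auto simp: tree_vars_def)
  have "e i \<in> T" using x(2) im by auto
  from edge_cases[OF this x(3)] obtain k where k: "e i = {j, k}" "j \<noteq> k" "j \<in> verts" "k \<in> verts" .
  then have "dir j k = i" using dir_neighbour[OF x(2)] by blast
  then have "x = tree_copy n e j k" using x(1) by simp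
  then show "x \<in> copies verts (tree_copy n e)" using k unfolding copies_def by blast
next
  fix x assume "x \<in> copies verts (tree_copy n e)"
  then obtain j v where jv: "x = tree_copy n e j v" "j \<in> verts" "v \<in> verts" "j \<noteq> v" unfolding copies_def by blast
  then show "x \<in> tree_vars n e" using dir_edge[OF jv(2,3) jv(4)[symmetric]] by (simp add: tree_vars_def)
qed

lemma tree_ideal_eq:
  "(tree_ideal n e :: (nat \<times> nat, 'k::field) mpoly set) = sq_ideal (copies verts (tree_copy n e)) (vertex_gens verts (tree_copy n e))"
proof -
  have "(\<lambda>v. sqfree_monomial (tree_labels n e v)) ` verts =
      (sqfree_monomial ` vertex_gens verts (tree_copy n e) :: (nat \<times> nat, 'k) mpoly set)"
    unfolding vertex_gens_def image_image by (rule image_cong) (simp_all add: labels_eq)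
  then show ?thesis by (simp add: tree_ideal_def tree_vars_eq)
qed

text \<open>Every edge of \<open>T\<close> is unseparated by third vertices, so the tag
  \<open>S j\<close> is constant on each branch at \<open>j\<close>. The refined tag is thus
  determined by the direction alone, and the condition is inherited from the tree.\<close>

lemma refined_copy_system:
  assumes W: "copy_system verts (tagged S)" and T: "T \<subseteq> linear_pairs verts (tagged S)"
  shows "copy_system verts (refined S dir)"
    and "\<And>j u v. j \<in> verts \<Longrightarrow> u \<in> verts \<Longrightarrow> v \<in> verts \<Longrightarrow> u \<noteq> j \<Longrightarrow> v \<noteq> j \<Longrightarrow> dir j u = dir j v \<Longrightarrow> S j u = S j v"
proof -
  show const: "S j u = S j v" if V: "j \<in> verts" "u \<in> verts" "v \<in> verts" "u \<noteq> j" "v \<noteq> j" "dir j u = dir j v" for j u v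
  proof (rule dir_constant[OF _ V])
    fix p q assume "{p, q} \<in> T" "p \<noteq> j" "q \<noteq> j"
    then show "S j p = S j q"
      using linear_pairsD[of p q verts "tagged S" j] T V(1) by auto
  qed
  show "copy_system verts (refined S dir)"
    unfolding copy_system_def
  proof (intro ballI impI)
    fix j u v assume V: "j \<in> verts" "u \<in> verts" "v \<in> verts" "u \<noteq> j" "v \<noteq> j"
      and ne: "((j, S j u), dir j u) \<noteq> ((j, S j v), dir j v)"
    then have d: "dir j u \<noteq> dir j v" using const[OF V] by auto
    then have "dir u j = dir u v" using copy_systemD[OF tree_copy_system V] by simp
    moreover have "u \<noteq> v" using d by auto
    ultimately show "((u, S u j), dir u j) = ((u, S u v), dir u v)" using const[OF V(2,1,3)] V by auto
  qed
qed

end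

section \<open>Trees and maximal polarizations\<close>

text \<open>By \<open>edge_iff\<close> the edges depend only on which directions coincide, and an
  injective renaming preserves coincidences.\<close>

lemma same_dirs_imp_same_tree:
  assumes "labelled_tree n T e" "labelled_tree n T' e'"
    and eq: "\<And>j v. j \<in> {1..n} \<Longrightarrow> v \<in> {1..n} \<Longrightarrow> j \<noteq> v \<Longrightarrow> r (tree_copy n e j v) = tree_copy n e' j v"
    and inj: "inj_on r (copies {1..n} (tree_copy n e))"
  shows "T = T'"
proof -
  interpret A: labelled_tree n T e by fact
  interpret B: labelled_tree n T' e' by fact
  have same: "tree_dir n e l j = tree_dir n e l k \<longleftrightarrow> tree_dir n e' l j = tree_dir n e' l k"
    if "l \<in> {1..n}" "j \<in> {1..n}" "k \<in> {1..n}" "l \<noteq> j" "l \<noteq> k" for l j k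
  proof -
    have "tree_copy n e l j \<in> copies {1..n} (tree_copy n e)" "tree_copy n e l k \<in> copies {1..n} (tree_copy n e)"
      using that unfolding copies_def by blast+
    then have "r (tree_copy n e l j) = r (tree_copy n e l k) \<longleftrightarrow> tree_copy n e l j = tree_copy n e l k"
      by (rule inj_on_eq_iff[OF inj])
    then show ?thesis using eq[OF that(1,2,4)] eq[OF that(1,3,5)] by auto
  qed
  have edge: "{j, k} \<in> T \<longleftrightarrow> {j, k} \<in> T'" if "j \<in> {1..n}" "k \<in> {1..n}" "j \<noteq> k" for j k
    unfolding A.edge_iff[OF that] B.edge_iff[OF that]
    by (intro ball_cong[OF refl] imp_cong[OF refl] same that(1,2))
  have "T \<subseteq> complete_edges n" "T' \<subseteq> complete_edges n"
    using A.tree B.tree by (simp_all add: spanning_trees_def)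
  then show ?thesis using edge unfolding complete_edges_def by blast
qed

lemma labelled_tree_of_copy_system:
  assumes "copy_system {1..n} W"
  obtains T where "T \<in> spanning_trees n" "T \<subseteq> linear_pairs {1..n} W"
proof -
  have "linear_pairs {1..n} W \<subseteq> complete_edges n"
    unfolding linear_pairs_def complete_edges_def by blast
  from spanning_tree_exists[OF this linear_pairs_connected[OF _ assms]] show ?thesis using that by auto
qed

lemma sqfree_degree_vertex_gens:
  assumes "n \<ge> 2"
  shows "{\<sigma>. \<sigma> \<subseteq> {1..n} \<and> card \<sigma> = n - 1} = vertex_gens {1..n} (\<lambda>j v. j)"
proof (intro subset_antisym subsetI)
  fix \<sigma> assume "\<sigma> \<in> {\<sigma>. \<sigma> \<subseteq> {1..n} \<and> card \<sigma> = n - 1}"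
  then have s: "\<sigma> \<subseteq> {1..n}" "card \<sigma> = n - 1" by auto
  have "card ({1..n} - \<sigma>) = 1"
    using s assms by (simp add: card_Diff_subset finite_subset[OF s(1)])
  then obtain v where v: "{1..n} - \<sigma> = {v}" by (auto simp: card_1_singleton_iff)
  then have "\<sigma> = {1..n} - {v}" "v \<in> {1..n}" using s(1) by blast+
  then show "\<sigma> \<in> vertex_gens {1..n} (\<lambda>j v. j)" by (simp add: vertex_gens_def vertex_gen_def)
next
  fix \<sigma> :: "nat set" assume "\<sigma> \<in> vertex_gens {1..n} (\<lambda>j v. j)"
  then obtain v where "v \<in> {1..n}" "\<sigma> = {1..n} - {v}" by (auto simp: vertex_gens_def vertex_gen_def)
  then show "\<sigma> \<in> {\<sigma>. \<sigma> \<subseteq> {1..n} \<and> card \<sigma> = n - 1}" by auto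
qed

lemma sqfree_degree_pair_gens:
  fixes n :: nat
  shows "{\<sigma>. \<sigma> \<subseteq> {1..n} \<and> card \<sigma> = 2} = pair_gens {1..n} (\<lambda>j v. j)"
proof (intro subset_antisym subsetI)
  fix \<sigma> assume "\<sigma> \<in> {\<sigma>. \<sigma> \<subseteq> {1..n} \<and> card \<sigma> = 2}"
  then obtain i j where "\<sigma> = {i, j}" "i \<noteq> j" "i \<in> {1..n}" "j \<in> {1..n}" by (auto simp: card_2_iff)
  then show "\<sigma> \<in> pair_gens {1..n} (\<lambda>j v. j)" using pair_gensI[of i "{1..n}" j "\<lambda>j v. j"] by simp
next
  fix \<sigma> :: "nat set" assume "\<sigma> \<in> pair_gens {1..n} (\<lambda>j v. j)"
  then show "\<sigma> \<in> {\<sigma>. \<sigma> \<subseteq> {1..n} \<and> card \<sigma> = 2}" by (rule pair_gensE) auto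
qed

text \<open>Here \<open>gens1\<close> and \<open>gens2\<close> stand for two type instances of the vertex generators, or of the
  pair generators, of a copy system.\<close>

lemma maximal_polarizations_trees:
  fixes n :: nat and V :: "nat set" and e :: "nat set set \<Rightarrow> nat \<Rightarrow> nat set"
  fixes gens1 :: "(nat \<Rightarrow> nat \<Rightarrow> nat \<times> nat) \<Rightarrow> (nat \<times> nat) set set"
  fixes gens2 :: "(nat \<Rightarrow> nat \<Rightarrow> (nat \<times> nat) \<times> nat) \<Rightarrow> ((nat \<times> nat) \<times> nat) set set"
  assumes V_def: "V = {1..n}"
    and e: "\<And>T. T \<in> spanning_trees n \<Longrightarrow> bij_betw (e T) {1..n-1} T"
    and H: "H \<subseteq> Fpow V" "antichain H" "{} \<notin> H"
    and lift1: "\<And>S. copy_system V (tagged S) \<Longrightarrow>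
      is_lift H (copies V (tagged S)) (gens1 (tagged S))"
    and lift2: "\<And>S t. copy_system V (refined S t) \<Longrightarrow>
      is_lift (gens1 (tagged S)) (copies V (refined S t))
        (gens2 (refined S t))"
    and copies: "\<And>Y G. is_lift H Y G \<Longrightarrow> \<exists>S. copy_system V (tagged S) \<and>
      Y = copies V (tagged S) \<and> G = gens1 (tagged S)"
    and maximal: "\<And>S Y G. tight V (tagged S) \<Longrightarrow> is_lift (gens1 (tagged S)) Y G \<Longrightarrow> inj_on fst Y"
    and gens_image: "\<And>r S t. (\<And>j v. j \<in> V \<Longrightarrow> v \<in> V \<Longrightarrow> j \<noteq> v \<Longrightarrow> r (j, S j v) = (j, t j v)) \<Longrightarrow>
      image r ` gens1 (tagged S) = gens1 (tagged t)"
    and rename_eq: "\<And>S t r j v. (\<And>y. y \<in> copies V (tagged S) \<Longrightarrow> fst (r y) = fst y) \<Longrightarrow>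
      image r ` gens1 (tagged S) = gens1 (tagged t) \<Longrightarrow>
      j \<in> V \<Longrightarrow> v \<in> V \<Longrightarrow> j \<noteq> v \<Longrightarrow> r (j, S j v) = (j, t j v)"
  shows "bij_betw (\<lambda>T. copy_renaming `` {(copies V (tree_copy n (e T)),
             sq_ideal (copies V (tree_copy n (e T))) (gens1 (tree_copy n (e T))) :: (nat \<times> nat, 'k::field) mpoly set)})
           (spanning_trees n)
           (maximal_polarizations V (sq_ideal V H) // copy_renaming)"
proof (rule bij_betw_classes)
  let ?Y = "\<lambda>T. copies V (tree_copy n (e T))" and ?G = "\<lambda>T. gens1 (tree_copy n (e T))"
  let ?F = "\<lambda>T. (?Y T, sq_ideal (?Y T) (?G T) :: (nat \<times> nat, 'k) mpoly set)"
  have lt: "labelled_tree n T (e T)" if "T \<in> spanning_trees n" for T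
    using that e[OF that] by (rule labelled_tree.intro)
  have lift: "is_lift H (?Y T) (?G T)" if "T \<in> spanning_trees n" for T
    using lift1 labelled_tree.tree_copy_system[OF lt[OF that]] unfolding V_def .
  note GF = is_lift_Fpow[OF lift] and GA = is_lift_antichain[OF lift H(2)]
  fix T assume T: "T \<in> spanning_trees n"
  have "inj_on fst Y" if "is_lift (?G T) Y G" for Y G
    by (rule maximal[OF _ that]) (use labelled_tree.tree_copy_tight[OF lt[OF T]] in \<open>simp add: V_def\<close>)
  then show "?F T \<in> maximal_polarizations V (sq_ideal V H)"
    unfolding maximal_polarizations_eq[OF H] using lift[OF T] by blast
  show "(?F T, ?F T) \<in> copy_renaming"
    by (rule copy_renaming_refl)
  show "copy_renaming `` {?F T} = copy_renaming `` {b}"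
    if "(?F T, b) \<in> copy_renaming" for b
    by (rule copy_renaming_class_eq[OF sq_ideal_exponents[OF GF[OF T]] that])
  show "T = T'" if T': "T' \<in> spanning_trees n"
    and ren: "(?F T, ?F T') \<in> copy_renaming" for T'
  proof -
    obtain r where r: "bij_betw r (?Y T) (?Y T')" "\<forall>y\<in>?Y T. fst (r y) = fst y" "?G T' = image r ` ?G T"
      using ren unfolding copy_renaming_sq_ideal_iff[OF GF[OF T] GA[OF T] GF[OF T'] GA[OF T']] by blast
    have "r (tree_copy n (e T) j v) = tree_copy n (e T') j v" if "j \<in> V" "v \<in> V" "j \<noteq> v" for j v
      by (rule rename_eq[of _ r]) (use r that in auto)
    then show ?thesis
      using same_dirs_imp_same_tree[OF lt[OF T] lt[OF T']] r(1) unfolding V_def bij_betw_def by blast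
  qed
next
  let ?Y = "\<lambda>T. copies V (tree_copy n (e T))" and ?G = "\<lambda>T. gens1 (tree_copy n (e T))"
  let ?F = "\<lambda>T. (?Y T, sq_ideal (?Y T) (?G T) :: (nat \<times> nat, 'k) mpoly set)"
  fix a :: "(nat \<times> nat) set \<times> (nat \<times> nat, 'k) mpoly set"
  assume "a \<in> maximal_polarizations V (sq_ideal V H)"
  then obtain Y G where a: "a = (Y, sq_ideal Y G)" and l: "is_lift H Y G"
    and max: "\<And>Y' G'. is_lift G Y' G' \<Longrightarrow> inj_on fst Y'"
    unfolding maximal_polarizations_eq[OF H] by blast
  obtain S where S: "copy_system V (tagged S)" "Y = copies V (tagged S)"
    "G = gens1 (tagged S)" using copies[OF l] by blast
  obtain T where T: "T \<in> spanning_trees n" "T \<subseteq> linear_pairs V (tagged S)"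
    using labelled_tree_of_copy_system[OF S(1)[unfolded V_def]] unfolding V_def .
  let ?t = "tree_dir n (e T)"
  interpret labelled_tree n T "e T" using T(1) e[OF T(1)] by (rule labelled_tree.intro)
  note ref = refined_copy_system[OF S(1)[unfolded V_def] T(2)[unfolded V_def], folded V_def]
  \<comment> \<open>The refinement by the tree is a lift of \<open>G\<close>, so maximality forbids
    it to split any copy: the branches are no finer than the classes of \<open>S\<close>.\<close>
  have inj: "inj_on fst (copies V (refined S ?t))"
    by (rule max) (unfold S(3), rule lift2[OF ref(1)])
  have eq: "?t j u = ?t j v \<longleftrightarrow> S j u = S j v"
    if V: "j \<in> V" "u \<in> V" "v \<in> V" "u \<noteq> j" "v \<noteq> j" for j u v
  proof
    assume "S j u = S j v"
    moreover have "((j, S j u), ?t j u) \<in> copies V (refined S ?t)"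
      "((j, S j v), ?t j v) \<in> copies V (refined S ?t)"
      using V unfolding copies_def by blast+
    ultimately show "?t j u = ?t j v" using inj_onD[OF inj] by fastforce
  qed (rule ref(2)[OF V])
  have lT: "is_lift H (?Y T) (?G T)"
    using lift1 tree_copy_system unfolding V_def .
  have ix: "indexed V (tree_copy n (e T)) fst" "indexed V (tagged S) fst"
    by (simp_all add: indexed_def)
  have eqW: "tree_copy n (e T) j u = tree_copy n (e T) j v \<longleftrightarrow> (j, S j u) = (j, S j v)"
    if "j \<in> V" "u \<in> V" "v \<in> V" "u \<noteq> j" "v \<noteq> j" for j u v
    using eq[OF that] by simp
  obtain r where r: "bij_betw r (?Y T) (copies V (tagged S))"
    "\<And>j v. j \<in> V \<Longrightarrow> v \<in> V \<Longrightarrow> j \<noteq> v \<Longrightarrow> r (tree_copy n (e T) j v) = (j, S j v)"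
    by (rule copies_rename[OF ix]) (rule eqW, assumption+, rule that)
  have gr: "image r ` ?G T = G"
    unfolding S(3) by (rule gens_image) (rule r(2))
  have "fst (r y) = fst y" if "y \<in> ?Y T" for y
    using that r(2) unfolding copies_def by auto
  then have "(?F T, a) \<in> copy_renaming"
    unfolding a copy_renaming_sq_ideal_iff[OF is_lift_Fpow[OF lT] is_lift_antichain[OF lT H(2)]
        is_lift_Fpow[OF l] is_lift_antichain[OF l H(2)]]
    using r(1)[folded S(2)] gr by blast
  then show "\<exists>T\<in>spanning_trees n. (?F T, a) \<in> copy_renaming"
    using T(1) by blast
qed

theorem mainTheorem5:
  fixes n :: nat and e :: "nat set set \<Rightarrow> nat \<Rightarrow> nat set"
  assumes "n \<ge> 2"
    and "\<And>T. T \<in> spanning_trees n \<Longrightarrow> bij_betw (e T) {1..n-1} T"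
  shows "bij_betw (\<lambda>T. copy_renaming `` {(tree_vars n (e T), tree_ideal n (e T))})
           (spanning_trees n)
           (maximal_polarizations {1..n} (sqfree_degree_ideal n (n - 1) :: (nat, 'k::field) mpoly set)
              // copy_renaming)
       \<and> bij_betw (\<lambda>T. copy_renaming `` {(tree_vars n (e T),
              alexander_dual (tree_vars n (e T)) (tree_ideal n (e T)))})
           (spanning_trees n)
           (maximal_polarizations {1..n} (sqfree_degree_ideal n 2 :: (nat, 'k) mpoly set)
              // copy_renaming)"
proof
  let ?V = "{1..n}"
  let ?Y = "\<lambda>T. copies ?V (tree_copy n (e T))"
  have lt: "labelled_tree n T (e T)" if "T \<in> spanning_trees n" for T
    using that assms(2)[OF that] by (rule labelled_tree.intro)
  have base: "indexed ?V (\<lambda>j v. j) (\<lambda>j. j)" by (simp add: indexed_def)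
  have ix: "indexed ?V (tagged S) fst" for S :: "nat \<Rightarrow> nat \<Rightarrow> nat" by (simp add: indexed_def)
  have fst1: "indexed ?V (\<lambda>j v. fst (j, S j v)) (\<lambda>j. j)" for S :: "nat \<Rightarrow> nat \<Rightarrow> nat"
    by (simp add: indexed_def)
  have fst2: "indexed ?V (\<lambda>j v. fst ((j, S j v), t j v)) fst" for S t :: "nat \<Rightarrow> nat \<Rightarrow> nat"
    by (simp add: indexed_def)
  have copies_base: "copies ?V (\<lambda>j v. j) \<subseteq> ?V" by (auto simp: copies_def)
  have vF: "vertex_gens ?V (\<lambda>j v. j) \<subseteq> Fpow ?V"
    using vertex_gens_Fpow[of ?V "\<lambda>j v. j"] copies_base by (auto simp: Fpow_def)
  have pF: "pair_gens ?V (\<lambda>j v. j) \<subseteq> Fpow ?V"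
    using pair_gens_Fpow[of ?V "\<lambda>j v. j"] copies_base by (auto simp: Fpow_def)
  \<comment> \<open>Here \<open>n \<ge> 2\<close> enters: for \<open>n = 1\<close> the empty set
    would be a generator.\<close>
  have "{} \<notin> {\<sigma>. \<sigma> \<subseteq> ?V \<and> card \<sigma> = n - 1}" using assms(1) by auto
  then have v0: "{} \<notin> vertex_gens ?V (\<lambda>j v. j)" unfolding sqfree_degree_vertex_gens[OF assms(1)] .
  have p0: "{} \<notin> pair_gens ?V (\<lambda>j v. j)" by (auto simp: pair_gens_def)
  have b1: "bij_betw (\<lambda>T. copy_renaming `` {(?Y T,
             sq_ideal (?Y T) (vertex_gens ?V (tree_copy n (e T))) :: (nat \<times> nat, 'k) mpoly set)})
           (spanning_trees n)
           (maximal_polarizations ?V (sq_ideal ?V (vertex_gens ?V (\<lambda>j v. j))) // copy_renaming)"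
  proof (rule maximal_polarizations_trees[of ?V n e _ "vertex_gens ?V" "vertex_gens ?V",
        OF refl assms(2) vF vertex_gens_antichain[OF base] v0])
    fix S t :: "nat \<Rightarrow> nat \<Rightarrow> nat"
    show "is_lift (vertex_gens ?V (\<lambda>j v. j)) (copies ?V (tagged S)) (vertex_gens ?V (tagged S))"
      if "copy_system ?V (tagged S)"
      using vertex_gens_lift[OF _ fst1 that] by simp
    show "is_lift (vertex_gens ?V (tagged S)) (copies ?V (refined S t))
        (vertex_gens ?V (refined S t))"
      if "copy_system ?V (refined S t)"
      using vertex_gens_lift[OF _ fst2 that] by simp
    show "image r ` vertex_gens ?V (tagged S) = vertex_gens ?V (tagged t)"
      if "\<And>j v. j \<in> ?V \<Longrightarrow> v \<in> ?V \<Longrightarrow> j \<noteq> v \<Longrightarrow> r (j, S j v) = (j, t j v)" for r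
      by (rule vertex_gens_image) (rule that)
  next
    fix Y G assume "is_lift (vertex_gens ?V (\<lambda>j v. j)) Y G"
    then show "\<exists>S. copy_system ?V (tagged S) \<and>
      Y = copies ?V (tagged S) \<and> G = vertex_gens ?V (tagged S)"
      by (rule lift_vertex_gens_copies) blast
  next
    fix S :: "nat \<Rightarrow> nat \<Rightarrow> nat" and Y G
    assume "tight ?V (tagged S)" "is_lift (vertex_gens ?V (tagged S)) Y G"
    then show "inj_on fst Y" by (rule tight_vertex_gens_maximal[OF ix])
  next
    fix S t :: "nat \<Rightarrow> nat \<Rightarrow> nat" and r j v
    assume r: "\<And>y. y \<in> copies ?V (tagged S) \<Longrightarrow> fst (r y) = fst y"
      "image r ` vertex_gens ?V (tagged S) = vertex_gens ?V (tagged t)"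
      "j \<in> ?V" "v \<in> ?V" "j \<noteq> v"
    show "r (j, S j v) = (j, t j v)" by (rule rename_vertex_gens_eq[OF ix[of S] ix[of t] r])
  qed
  have d1: "(sqfree_degree_ideal n (n - 1) :: (nat, 'k) mpoly set) = sq_ideal ?V (vertex_gens ?V (\<lambda>j v. j))"
    unfolding sqfree_degree_ideal_def sqfree_degree_vertex_gens[OF assms(1)] ..
  have t1: "tree_vars n (e T) = ?Y T"
    "(tree_ideal n (e T) :: (nat \<times> nat, 'k) mpoly set) = sq_ideal (?Y T) (vertex_gens ?V (tree_copy n (e T)))"
    if "T \<in> spanning_trees n" for T
    using labelled_tree.tree_vars_eq[OF lt[OF that]] labelled_tree.tree_ideal_eq[OF lt[OF that]] .
  show "bij_betw (\<lambda>T. copy_renaming `` {(tree_vars n (e T), tree_ideal n (e T))})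
           (spanning_trees n)
           (maximal_polarizations ?V (sqfree_degree_ideal n (n - 1) :: (nat, 'k) mpoly set) // copy_renaming)"
    unfolding d1 by (rule iffD1[OF bij_betw_cong b1]) (simp only: t1)
  have b2: "bij_betw (\<lambda>T. copy_renaming `` {(?Y T,
             sq_ideal (?Y T) (pair_gens ?V (tree_copy n (e T))) :: (nat \<times> nat, 'k) mpoly set)})
           (spanning_trees n)
           (maximal_polarizations ?V (sq_ideal ?V (pair_gens ?V (\<lambda>j v. j))) // copy_renaming)"
  proof (rule maximal_polarizations_trees[of ?V n e _ "pair_gens ?V" "pair_gens ?V",
        OF refl assms(2) pF pair_gens_antichain[OF base] p0])
    fix S t :: "nat \<Rightarrow> nat \<Rightarrow> nat"
    show "is_lift (pair_gens ?V (\<lambda>j v. j)) (copies ?V (tagged S)) (pair_gens ?V (tagged S))"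
      if "copy_system ?V (tagged S)"
      using pair_gens_lift[OF _ fst1 that] by simp
    show "is_lift (pair_gens ?V (tagged S)) (copies ?V (refined S t))
        (pair_gens ?V (refined S t))"
      if "copy_system ?V (refined S t)"
      using pair_gens_lift[OF _ fst2 that] by simp
    show "image r ` pair_gens ?V (tagged S) = pair_gens ?V (tagged t)"
      if "\<And>j v. j \<in> ?V \<Longrightarrow> v \<in> ?V \<Longrightarrow> j \<noteq> v \<Longrightarrow> r (j, S j v) = (j, t j v)" for r
      by (rule pair_gens_image) (rule that)
  next
    fix Y G assume "is_lift (pair_gens ?V (\<lambda>j v. j)) Y G"
    then show "\<exists>S. copy_system ?V (tagged S) \<and>
      Y = copies ?V (tagged S) \<and> G = pair_gens ?V (tagged S)"
      by (rule lift_pair_gens_copies) blast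
  next
    fix S :: "nat \<Rightarrow> nat \<Rightarrow> nat" and Y G
    assume "tight ?V (tagged S)" "is_lift (pair_gens ?V (tagged S)) Y G"
    then show "inj_on fst Y" by (rule tight_pair_gens_maximal[OF ix])
  next
    fix S t :: "nat \<Rightarrow> nat \<Rightarrow> nat" and r j v
    assume r: "\<And>y. y \<in> copies ?V (tagged S) \<Longrightarrow> fst (r y) = fst y"
      "image r ` pair_gens ?V (tagged S) = pair_gens ?V (tagged t)"
      "j \<in> ?V" "v \<in> ?V" "j \<noteq> v"
    show "r (j, S j v) = (j, t j v)" by (rule rename_pair_gens_eq[OF ix[of S] ix[of t] r])
  qed
  have d2: "(sqfree_degree_ideal n 2 :: (nat, 'k) mpoly set) = sq_ideal ?V (pair_gens ?V (\<lambda>j v. j))"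
    unfolding sqfree_degree_ideal_def sqfree_degree_pair_gens ..
  have t2: "(alexander_dual (tree_vars n (e T)) (tree_ideal n (e T)) :: (nat \<times> nat, 'k) mpoly set) =
      sq_ideal (?Y T) (pair_gens ?V (tree_copy n (e T)))"
    if T: "T \<in> spanning_trees n" for T
  proof -
    interpret labelled_tree n T "e T" by (rule lt[OF T])
    show "(alexander_dual (tree_vars n (e T)) (tree_ideal n (e T)) :: (nat \<times> nat, 'k) mpoly set) =
        sq_ideal (?Y T) (pair_gens ?V (tree_copy n (e T)))"
      unfolding tree_vars_eq tree_ideal_eq
      by (rule alexander_dual_vertex_gens[OF _ _ tree_copy_system tree_copy_indexed]) (use assms(1) in auto)
  qed
  show "bij_betw (\<lambda>T. copy_renaming `` {(tree_vars n (e T),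
              alexander_dual (tree_vars n (e T)) (tree_ideal n (e T)))})
           (spanning_trees n)
           (maximal_polarizations ?V (sqfree_degree_ideal n 2 :: (nat, 'k) mpoly set) // copy_renaming)"
    unfolding d2 by (rule iffD1[OF bij_betw_cong b2]) (simp only: t2, simp only: t1(1))
qed

end
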